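(* Let $\alpha>0$, $\lambda>0$, $H=\frac12+\alpha$. For each $n\ge 1$ let $\{X^{\lambda/n}_k\}$ be the ARTFIMA$(0,\alpha,\lambda/n,0)$ time series, and define $$T^{\lambda/n}(t):=\sum_{k=1}^{[t]}X^{\lambda/n}_{k}+(t-[t])\,X^{\lambda/n}_{[t]+1},\qquad t\ge 0 .$$ Then, as $n\to\infty$, $$n^{-H}\,T^{\lambda/n}(nt)\ \Rightarrow\ Z^{1}_{H,\lambda}(t)$$ weakly in $C[0,1]$.
   Context: $[t]$ is the largest integer less than or equal to $t$, an empty sum is $0$, and $C[0,1]$ is the space of continuous functions on $[0,1]$. $\{Z_j\}_{j\in\mathbb Z}$ is an i.i.d. sequence of real random variables with mean zero and finite variance $\sigma^2$. For $\mu>0$ the ARTFIMA$(0,\alpha,\mu,0)$ time series is $$X^{\mu}_k=\sum_{j=0}^\infty(-1)^j\binom{-\alpha}{j}e^{-\mu j}Z_{k-j},$$ used here with tempering parameter $\mu=\lambda/n$. The tempered Hermite process of order one is the Gaussian process $$Z^1_{H,\lambda}(t)=\int_{\mathbb R}\int_0^t (s-y)_+^{H-\frac32}e^{-\lambda(s-y)_+}\,ds\,B(dy),$$ where $(x)_+=x\,I(x>0)$ (the integrand vanishes for $s\le y$) and $B(dy)$ is an independently scattered Gaussian random measure on $\mathbb R$ with control measure $\sigma^2\,dy$.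
   Formalization: The limit is stated as Z^1_{H,λ}(t)/Γ(α) instead of Z^1_{H,λ}(t): since (-1)^j binom(-α,j) ~ j^{α-1}/Γ(α), the printed claim fails when σ>0 and Γ(α)≠1 (for α=3 the limit is Z^1_{H,λ}/2). *)

theory Defs
  imports "HOL-Probability.Probability"
begin

subsection \<open>Weak convergence in \<open>C[0,1]\<close>\<close>

definition borel_in :: "'c topology \<Rightarrow> 'c measure" where
  "borel_in X = sigma (topspace X) {U. openin X U}"

text \<open>The two sides may live on different probability spaces.\<close>

definition converges_weakly ::
  "'c topology \<Rightarrow> 'a measure \<Rightarrow> (nat \<Rightarrow> 'a \<Rightarrow> 'c) \<Rightarrow> 'b measure \<Rightarrow> ('b \<Rightarrow> 'c) \<Rightarrow> bool" where
  "converges_weakly X M Y N W \<longleftrightarrow>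
     (\<forall>n. Y n \<in> measurable M (borel_in X)) \<and> W \<in> measurable N (borel_in X) \<and>
     (\<forall>F. continuous_map X euclideanreal F \<and> bounded (F ` topspace X) \<longrightarrow>
        (\<lambda>n. \<integral>\<omega>. F (Y n \<omega>) \<partial>M) \<longlonglongrightarrow> (\<integral>\<omega>. F (W \<omega>) \<partial>N))"

text \<open>The carrier consists of the continuous functions on \<open>[0,1]\<close>, extended by
  \<^const>\<open>undefined\<close> outside \<open>[0,1]\<close>; the metric is the supremum metric.\<close>

definition C01 :: "(real \<Rightarrow> real) topology" where
  "C01 = mtopology_of (cfunspace (top_of_set {0..1}) euclidean_metric)"

definition path01 :: "(real \<Rightarrow> 'a \<Rightarrow> real) \<Rightarrow> 'a \<Rightarrow> (real \<Rightarrow> real)" where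
  "path01 X \<omega> = restrict (\<lambda>t. X t \<omega>) {0..1}"


subsection \<open>Gaussian random measures and their integrals\<close>

definition centred_gaussian :: "'b measure \<Rightarrow> ('b \<Rightarrow> real) \<Rightarrow> real \<Rightarrow> bool" where
  "centred_gaussian N X v \<longleftrightarrow> X \<in> borel_measurable N \<and>
     (if v = 0 then (AE \<omega> in N. X \<omega> = 0)
      else distributed N lborel X (\<lambda>x. ennreal (normal_density 0 (sqrt v) x)))"

definition finite_sets :: "'c measure \<Rightarrow> 'c set set" where
  "finite_sets \<mu> = {A \<in> sets \<mu>. emeasure \<mu> A < \<infinity>}"

text \<open>\<open>B\<close> is an independently scattered Gaussian random measure with control measure \<open>\<mu>\<close>.
  Only its values on sets of finite \<open>\<mu>\<close>-measure are meaningful.\<close>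

definition gaussian_random_measure ::
  "'b measure \<Rightarrow> 'c measure \<Rightarrow> ('c set \<Rightarrow> 'b \<Rightarrow> real) \<Rightarrow> bool" where
  "gaussian_random_measure N \<mu> B \<longleftrightarrow>
     prob_space N \<and>
     (\<forall>A\<in>finite_sets \<mu>. centred_gaussian N (B A) (measure \<mu> A)) \<and>
     (\<forall>(A :: nat \<Rightarrow> 'c set) n. disjoint_family_on A {..<n} \<and> A ` {..<n} \<subseteq> finite_sets \<mu> \<longrightarrow>
        prob_space.indep_vars N (\<lambda>_. borel) (\<lambda>i. B (A i)) {..<n}) \<and>
     (\<forall>A :: nat \<Rightarrow> 'c set. disjoint_family A \<and> range A \<subseteq> finite_sets \<mu> \<and>
        (\<Union>i. A i) \<in> finite_sets \<mu> \<longrightarrow>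
        (AE \<omega> in N. (\<lambda>i. B (A i) \<omega>) sums B (\<Union>i. A i) \<omega>))"

definition simple_L2 :: "'c measure \<Rightarrow> ('c \<Rightarrow> real) \<Rightarrow> bool" where
  "simple_L2 \<mu> s \<longleftrightarrow> simple_function \<mu> s \<and> emeasure \<mu> {y \<in> space \<mu>. s y \<noteq> 0} < \<infinity>"

definition simple_stoch_integral ::
  "'c measure \<Rightarrow> ('c set \<Rightarrow> 'b \<Rightarrow> real) \<Rightarrow> ('c \<Rightarrow> real) \<Rightarrow> 'b \<Rightarrow> real" where
  "simple_stoch_integral \<mu> B s \<omega> =
     (\<Sum>c\<in>s ` space \<mu> - {0}. c * B (s -` {c} \<inter> space \<mu>) \<omega>)"

text \<open>\<open>I = \<integral> f dB\<close>, the \<open>L\<^sup>2\<close>-isometric extension from simple functions. This determines \<open>I\<close>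
  up to null sets, hence a relation. Nonnegative integrals are used for the squared distances
  because they do not default to \<open>0\<close> when infinite.\<close>

definition has_stoch_integral ::
  "'b measure \<Rightarrow> 'c measure \<Rightarrow> ('c set \<Rightarrow> 'b \<Rightarrow> real) \<Rightarrow> ('c \<Rightarrow> real) \<Rightarrow> ('b \<Rightarrow> real) \<Rightarrow> bool" where
  "has_stoch_integral N \<mu> B f I \<longleftrightarrow>
     f \<in> borel_measurable \<mu> \<and> I \<in> borel_measurable N \<and>
     (\<exists>s. (\<forall>m. simple_L2 \<mu> (s m)) \<and>
        (\<lambda>m. \<integral>\<^sup>+y. ennreal ((s m y - f y)\<^sup>2) \<partial>\<mu>) \<longlonglongrightarrow> 0 \<and>
        (\<lambda>m. \<integral>\<^sup>+\<omega>. ennreal ((simple_stoch_integral \<mu> B (s m) \<omega> - I \<omega>)\<^sup>2) \<partial>N) \<longlonglongrightarrow> 0)"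


subsection \<open>The tempered Hermite process of order one\<close>

definition tempered_kernel :: "real \<Rightarrow> real \<Rightarrow> real \<Rightarrow> real \<Rightarrow> real" where
  "tempered_kernel H lam t y =
     (LINT s:{0..t}|lborel.
        (if y < s then (s - y) powr (H - 3/2) * exp (- lam * (s - y)) else 0))"

text \<open>\<open>W\<close> is a version of the process on \<open>[0,1]\<close> all of whose paths are continuous, that is,
  a version that is a random element of \<open>C[0,1]\<close>. The control measure is \<open>\<sigma>\<^sup>2 dy\<close>.\<close>

definition tempered_Hermite1 ::
  "'b measure \<Rightarrow> real \<Rightarrow> (real set \<Rightarrow> 'b \<Rightarrow> real) \<Rightarrow> real \<Rightarrow> real \<Rightarrow> (real \<Rightarrow> 'b \<Rightarrow> real) \<Rightarrow> bool" where
  "tempered_Hermite1 N \<sigma> B H lam W \<longleftrightarrow>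
     (\<forall>t\<in>{0..1}. has_stoch_integral N (scale_measure (ennreal (\<sigma>\<^sup>2)) lborel) B
        (tempered_kernel H lam t) (W t)) \<and>
     (\<forall>\<omega>\<in>space N. continuous_on {0..1} (\<lambda>t. W t \<omega>))"


subsection \<open>The ARTFIMA time series\<close>

definition artfima_coeff :: "real \<Rightarrow> nat \<Rightarrow> real" where
  "artfima_coeff \<alpha> j = (-1) ^ j * ((- \<alpha>) gchoose j)"

definition artfima :: "real \<Rightarrow> real \<Rightarrow> (int \<Rightarrow> 'a \<Rightarrow> real) \<Rightarrow> int \<Rightarrow> 'a \<Rightarrow> real" where
  "artfima \<alpha> \<mu> Z k \<omega> =
     (\<Sum>j. artfima_coeff \<alpha> j * exp (- \<mu> * real j) * Z (k - int j) \<omega>)"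

definition artfima_sum :: "real \<Rightarrow> real \<Rightarrow> (int \<Rightarrow> 'a \<Rightarrow> real) \<Rightarrow> real \<Rightarrow> 'a \<Rightarrow> real" where
  "artfima_sum \<alpha> \<mu> Z t \<omega> =
     (\<Sum>k\<in>{1..\<lfloor>t\<rfloor>}. artfima \<alpha> \<mu> Z k \<omega>) + (t - of_int \<lfloor>t\<rfloor>) * artfima \<alpha> \<mu> Z (\<lfloor>t\<rfloor> + 1) \<omega>"

text \<open>The coefficients are equivalent to \<open>j\<^bsup>\<alpha>-1\<^esup> / \<Gamma>(\<alpha>)\<close>, whereas \<^const>\<open>tempered_kernel\<close> is
  built from the unnormalised power \<open>(s-y)\<^bsup>\<alpha>-1\<^esup>\<close> when \<open>H = 1/2 + \<alpha>\<close>. The scaling limit of the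
  partial sums is therefore \<open>1 / \<Gamma>(\<alpha>)\<close> times the process above.\<close>

lemma artfima_coeff_asymptotic:
  "(\<lambda>j. artfima_coeff \<alpha> j / real j powr (\<alpha> - 1)) \<longlonglongrightarrow> 1 / Gamma \<alpha>"
proof (rule Lim_transform_eventually)
  show "(\<lambda>n. ((- \<alpha>) gchoose n) / ((-1) ^ n / exp ((- \<alpha> + 1) * of_real (ln (real n)))))
          \<longlonglongrightarrow> 1 / Gamma \<alpha>"
    using gbinomial_asymptotic[of "- \<alpha>"] by (simp add: inverse_eq_divide)
  show "\<forall>\<^sub>F n in sequentially.
      ((- \<alpha>) gchoose n) / ((-1) ^ n / exp ((- \<alpha> + 1) * of_real (ln (real n)))) =
      artfima_coeff \<alpha> n / real n powr (\<alpha> - 1)"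
    using eventually_gt_at_top[of 0]
  proof eventually_elim
    case (elim n)
    have "real n powr (\<alpha> - 1) = inverse (exp ((- \<alpha> + 1) * ln (real n)))"
      using elim by (simp add: powr_def exp_minus[symmetric] algebra_simps)
    then show ?case
      by (cases "even n") (simp_all add: artfima_coeff_def divide_inverse)
  qed
qed

end

theory Submission
  imports Defs
begin

text \<open>
  The argument is a central limit theorem at the level of functions, and apart from the classical
  one-dimensional central limit theorem it uses second moments only.

  Write \<open>\<phi>\<^sub>n(j) = n\<^bsup>1-\<alpha>\<^esup> a\<^sub>j e\<^bsup>-\<lambda>j/n\<^esup>\<close> for the rescaled ARTFIMA coefficients (\<open>scaled_coeff\<close>). Exchanging
  the order of summation turns the rescaled partial sum process into the linear form
  \<open>n\<^bsup>-1/2\<^esup> \<Sum>\<^sub>i k\<^sub>n(t,i) Z\<^sub>i\<close> with \<open>k\<^sub>n(t,i) = \<integral>\<^sub>0\<^sup>t \<phi>\<^sub>n(\<lceil>ns\<rceil> - i) ds\<close> (\<open>lattice_kernel\<close>), which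
  is a discrete copy of the stochastic integral that defines the limit. As
  \<open>a\<^sub>j \<sim> j\<^bsup>\<alpha>-1\<^esup> / \<Gamma>(\<alpha>)\<close>, the step function \<open>y \<mapsto> k\<^sub>n(t,\<lceil>ny\<rceil>)\<close> converges pointwise to the tempered
  kernel divided by \<open>\<Gamma>(\<alpha>)\<close>.

  A single estimate controls everything else: the increments over \<open>[s,t]\<close> of all kernels that
  occur, discrete or continuous, are bounded by \<open>\<integral>\<^sub>s\<^sup>t \<psi>(v-y) dv\<close> with
  \<open>\<psi>(u) = C |u|\<^bsup>\<theta>-1\<^esup> e\<^bsup>-\<kappa>|u|\<^esup>\<close> and \<open>\<theta> = min \<alpha> 1\<close> (\<open>scaled_coeff_le_majorant\<close>), and the integral
  over \<open>y\<close> of the square of this bound is at most \<open>C' (t-s)\<^bsup>1+\<theta>\<^esup>\<close> (\<open>window_square_integral\<close>). On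
  the one hand this is the dominating function for convergence of the kernels in \<open>L\<^sup>2\<close>. On the other
  hand the exponent \<open>1+\<theta>\<close> exceeds \<open>1\<close>, and then dyadic chaining bounds the expected supremum of
  a process by second moments of its increments (\<open>expected_supremum_le\<close>).

  The kernel \<open>k\<^sub>K(t,\<lceil>Ky\<rceil>)\<close> for fixed \<open>K\<close>, cut off at finitely many cells, serves as the
  approximating step function on both sides. Integrated against the lattice noise it gives a finite
  combination of block sums of the \<open>Z\<^sub>j\<close> (\<open>coarse_sum\<close>), integrated against \<open>B\<close> it gives the
  same combination of independent Gaussian variables (\<open>gauss_sum\<close>). For fixed \<open>K\<close> the first
  converges in law to the second, because block sums over disjoint blocks are independent and each of
  them obeys the central limit theorem (\<open>joint_block_clt\<close>). For large \<open>K\<close> both are close in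
  expected supremum norm to the processes they approximate (\<open>discrete_approximation\<close>,
  \<open>expected_supremum_wiener\<close>), so that the two limits may be interchanged
  (\<open>weak_limit_by_approximation\<close>).

  The same bounds show that the coarse Gaussian processes form a Cauchy sequence in expected supremum
  norm. A subsequence converges uniformly almost surely, which yields a version of the tempered
  Hermite process with continuous paths (\<open>continuous_limit_exists\<close>).
\<close>

section \<open>Weak convergence in metric spaces\<close>

text \<open>The inf-convolution \<open>G\<^sub>k(x) = inf\<^sub>y (F(y) + k d(x,y))\<close> increases to \<open>F\<close> wherever \<open>F\<close> is
  continuous. Hence weak convergence in a metric space may be tested on Lipschitz functions.\<close>

lemma lipschitz_minorants:
  fixes F :: "'c::metric_space \<Rightarrow> real"
  assumes cont: "continuous_on UNIV F" and bd: "\<And>x. \<bar>F x\<bar> \<le> c"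
  obtains G :: "nat \<Rightarrow> 'c \<Rightarrow> real" where
    "\<And>k. (real k)-lipschitz_on UNIV (G k)" "\<And>k x. \<bar>G k x\<bar> \<le> c" "\<And>k x. G k x \<le> F x"
    "\<And>x. (\<lambda>k. G k x) \<longlonglongrightarrow> F x"
proof -
  define G where "G k x = (INF y. F y + real k * dist x y)" for k x
  have low: "-c \<le> F y + real k * dist x y" for k x y
  proof -
    have "0 \<le> real k * dist x y" by simp
    then show ?thesis using bd[of y] by linarith
  qed
  have bdd: "bdd_below (range (\<lambda>y. F y + real k * dist x y))" for k x
    by (rule bdd_belowI2[of _ "-c"]) (rule low)
  have ge: "-c \<le> G k x" for k x
    unfolding G_def by (rule cINF_greatest) (auto intro: low)
  have le: "G k x \<le> F x" for k x
    unfolding G_def using cINF_lower[OF bdd, of x k x] by simp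
  have lip: "G k x \<le> G k z + real k * dist x z" for k x z
  proof -
    have "G k x - real k * dist x z \<le> F y + real k * dist z y" for y
    proof -
      have "G k x \<le> F y + real k * dist x y"
        unfolding G_def by (rule cINF_lower[OF bdd]) simp
      also have "real k * dist x y \<le> real k * (dist x z + dist z y)"
        by (intro mult_left_mono dist_triangle) auto
      finally show ?thesis by (simp add: algebra_simps)
    qed
    then have "G k x - real k * dist x z \<le> G k z"
      unfolding G_def[of k z] by (intro cINF_greatest) auto
    then show ?thesis by simp
  qed
  show thesis
  proof (rule that[of G])
    show "(real k)-lipschitz_on UNIV (G k)" for k
    proof (rule lipschitz_onI)
      fix x y show "dist (G k x) (G k y) \<le> real k * dist x y"
        using lip[of k x y] lip[of k y x] by (simp add: dist_real_def abs_le_iff dist_commute)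
    qed simp
    show "\<bar>G k x\<bar> \<le> c" for k x using ge[of k x] le[of k x] bd[of x] by auto
    show "G k x \<le> F x" for k x by (rule le)
    show "(\<lambda>k. G k x) \<longlonglongrightarrow> F x" for x
    proof (rule LIMSEQ_I)
      fix r :: real assume r: "r > 0"
      obtain d where d: "d > 0" and dF: "\<And>y. dist y x < d \<Longrightarrow> dist (F y) (F x) < r/2"
        using cont half_gt_zero[OF r] unfolding continuous_on_iff by blast
      obtain k0 where k0: "real k0 * d > 2 * c" using reals_Archimedean3[OF d] by blast
      show "\<exists>no. \<forall>k\<ge>no. norm (G k x - F x) < r"
      proof (intro exI allI impI)
        fix k assume k: "k \<ge> k0"
        have "F x - r/2 \<le> F y + real k * dist x y" for y
        proof (cases "dist y x < d")
          case True
          have "0 \<le> real k * dist x y" by simp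
          then show ?thesis using dF[OF True] unfolding dist_real_def by linarith
        next
          case False
          have "real k0 * d \<le> real k * dist x y"
            using False k d by (intro mult_mono) (auto simp: dist_commute)
          then show ?thesis using bd[of x] bd[of y] k0 r by linarith
        qed
        then have "F x - r/2 \<le> G k x" unfolding G_def by (intro cINF_greatest) auto
        then show "norm (G k x - F x) < r" using le[of k x] r by auto
      qed
    qed
  qed
qed

text \<open>The distance of two random elements of a non-separable space may fail to be measurable; the
  nonnegative integral of it is then a lower integral, and monotonicity still suffices.\<close>

lemma expectation_lipschitz_dist_le:
  fixes X Y :: "'a \<Rightarrow> 'c::metric_space" and F :: "'c \<Rightarrow> real"
  assumes "prob_space M" and [measurable]: "X \<in> borel_measurable M" "Y \<in> borel_measurable M"
    and F: "k-lipschitz_on UNIV F" "\<And>x. \<bar>F x\<bar> \<le> c"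
    and e: "(\<integral>\<^sup>+\<omega>. ennreal (dist (X \<omega>) (Y \<omega>)) \<partial>M) \<le> ennreal e" "0 \<le> e"
  shows "\<bar>(\<integral>\<omega>. F (X \<omega>) \<partial>M) - (\<integral>\<omega>. F (Y \<omega>) \<partial>M)\<bar> \<le> k * e"
proof -
  interpret prob_space M by fact
  have [measurable]: "F \<in> borel_measurable borel"
    using F(1) by (intro borel_measurable_continuous_onI) (rule lipschitz_on_continuous_on)
  have k: "0 \<le> k" using F(1) by (rule lipschitz_on_nonneg)
  have int: "integrable M (\<lambda>\<omega>. F (X \<omega>))" "integrable M (\<lambda>\<omega>. F (Y \<omega>))"
    using F(2) by (auto intro!: integrable_const_bound[where B=c])
  have lip: "\<bar>F x - F y\<bar> \<le> k * dist x y" for x y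
    using lipschitz_onD[OF F(1), of x y] by (simp add: dist_real_def)
  have "ennreal (\<integral>\<omega>. \<bar>F (X \<omega>) - F (Y \<omega>)\<bar> \<partial>M) = (\<integral>\<^sup>+\<omega>. ennreal \<bar>F (X \<omega>) - F (Y \<omega>)\<bar> \<partial>M)"
    using int by (intro nn_integral_eq_integral[symmetric]) auto
  also have "\<dots> \<le> ennreal (k * e)"
  proof (cases "k = 0")
    case True
    then have "ennreal \<bar>F x - F y\<bar> = 0" for x y using lip[of x y] by simp
    then show ?thesis by (simp only: nn_integral_const) simp
  next
    case False
    then have k': "k > 0" using k by simp
    have "(\<integral>\<^sup>+\<omega>. ennreal \<bar>F (X \<omega>) - F (Y \<omega>)\<bar> \<partial>M)
        = (\<integral>\<^sup>+\<omega>. ennreal k * ennreal (\<bar>F (X \<omega>) - F (Y \<omega>)\<bar> / k) \<partial>M)"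
      using k' by (simp add: ennreal_mult[symmetric])
    also have "\<dots> = ennreal k * (\<integral>\<^sup>+\<omega>. ennreal (\<bar>F (X \<omega>) - F (Y \<omega>)\<bar> / k) \<partial>M)"
      by (rule nn_integral_cmult) measurable
    also have "(\<integral>\<^sup>+\<omega>. ennreal (\<bar>F (X \<omega>) - F (Y \<omega>)\<bar> / k) \<partial>M) \<le> (\<integral>\<^sup>+\<omega>. ennreal (dist (X \<omega>) (Y \<omega>)) \<partial>M)"
      using lip k' by (intro nn_integral_mono ennreal_leI) (simp add: field_simps)
    also note e(1)
    finally show ?thesis using k e by (simp add: ennreal_mult mult_left_mono)
  qed
  finally have "(\<integral>\<omega>. \<bar>F (X \<omega>) - F (Y \<omega>)\<bar> \<partial>M) \<le> k * e"
    using k e by (subst (asm) ennreal_le_iff) auto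
  moreover have "(\<integral>\<omega>. F (X \<omega>) \<partial>M) - (\<integral>\<omega>. F (Y \<omega>) \<partial>M) = (\<integral>\<omega>. F (X \<omega>) - F (Y \<omega>) \<partial>M)"
    using int by simp
  moreover have "\<bar>\<integral>\<omega>. F (X \<omega>) - F (Y \<omega>) \<partial>M\<bar> \<le> (\<integral>\<omega>. \<bar>F (X \<omega>) - F (Y \<omega>)\<bar> \<partial>M)"
    by (rule integral_abs_bound)
  ultimately show ?thesis by linarith
qed

text \<open>Lipschitz minorants of \<open>F\<close> give the lower bound \<open>liminf E F(X\<^sub>n) \<ge> E F(Y)\<close>; the upper bound is
  the lower bound for \<open>-F\<close>.\<close>

lemma weak_limit_from_lipschitz:
  fixes X :: "nat \<Rightarrow> 'a \<Rightarrow> 'c::metric_space" and Y :: "'b \<Rightarrow> 'c"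
  assumes "prob_space M" "prob_space N"
    and [measurable]: "\<And>n. X n \<in> borel_measurable M" "Y \<in> borel_measurable N"
    and lip: "\<And>(F :: 'c \<Rightarrow> real) c k. k-lipschitz_on UNIV F \<Longrightarrow> (\<And>x. \<bar>F x\<bar> \<le> c) \<Longrightarrow>
      (\<lambda>n. \<integral>\<omega>. F (X n \<omega>) \<partial>M) \<longlonglongrightarrow> (\<integral>\<omega>. F (Y \<omega>) \<partial>N)"
    and F: "continuous_on UNIV F" "\<And>x. \<bar>F x\<bar> \<le> (c::real)"
  shows "(\<lambda>n. \<integral>\<omega>. F (X n \<omega>) \<partial>M) \<longlonglongrightarrow> (\<integral>\<omega>. F (Y \<omega>) \<partial>N)"
proof -
  interpret M: prob_space M by fact
  interpret N: prob_space N by fact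
  have lower: "\<forall>\<^sub>F n in sequentially. (\<integral>\<omega>. F (Y \<omega>) \<partial>N) - e < (\<integral>\<omega>. F (X n \<omega>) \<partial>M)"
    if F: "continuous_on UNIV F" "\<And>x. \<bar>F x\<bar> \<le> c" and e: "e > 0" for F :: "'c \<Rightarrow> real" and e
  proof -
    obtain G where G: "\<And>k. (real k)-lipschitz_on UNIV (G k)" "\<And>k x. \<bar>G k x\<bar> \<le> c"
        "\<And>k x. G k x \<le> F x" "\<And>x. (\<lambda>k. G k x) \<longlonglongrightarrow> F x"
      using lipschitz_minorants[OF F] by metis
    have [measurable]: "F \<in> borel_measurable borel" "G k \<in> borel_measurable borel" for k
      using F(1) lipschitz_on_continuous_on[OF G(1)] by (auto intro: borel_measurable_continuous_onI)
    have "(\<lambda>k. \<integral>\<omega>. G k (Y \<omega>) \<partial>N) \<longlonglongrightarrow> (\<integral>\<omega>. F (Y \<omega>) \<partial>N)"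
      by (rule integral_dominated_convergence[where w="\<lambda>_. c"]) (use G(2,4) in auto)
    then have "\<forall>\<^sub>F k in sequentially. (\<integral>\<omega>. F (Y \<omega>) \<partial>N) - e < (\<integral>\<omega>. G k (Y \<omega>) \<partial>N)"
      by (rule order_tendstoD) (use e in simp)
    then obtain k where k: "(\<integral>\<omega>. F (Y \<omega>) \<partial>N) - e < (\<integral>\<omega>. G k (Y \<omega>) \<partial>N)"
      by (meson eventually_sequentially order_refl)
    have "\<forall>\<^sub>F n in sequentially. (\<integral>\<omega>. F (Y \<omega>) \<partial>N) - e < (\<integral>\<omega>. G k (X n \<omega>) \<partial>M)"
      by (rule order_tendstoD(1)[OF lip[OF G(1)[of k] G(2)[of k]] k])
    moreover have "(\<integral>\<omega>. G k (X n \<omega>) \<partial>M) \<le> (\<integral>\<omega>. F (X n \<omega>) \<partial>M)" for n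
      by (rule integral_mono)
        (use G F in \<open>auto intro!: M.integrable_const_bound[where B=c]\<close>)
    ultimately show ?thesis
      by (auto elim!: eventually_mono intro: less_le_trans)
  qed
  show ?thesis
  proof (rule order_tendstoI)
    fix a assume "a < (\<integral>\<omega>. F (Y \<omega>) \<partial>N)"
    then show "\<forall>\<^sub>F n in sequentially. a < (\<integral>\<omega>. F (X n \<omega>) \<partial>M)"
      using lower[OF F, of "(\<integral>\<omega>. F (Y \<omega>) \<partial>N) - a"] by simp
  next
    fix a assume "(\<integral>\<omega>. F (Y \<omega>) \<partial>N) < a"
    then show "\<forall>\<^sub>F n in sequentially. (\<integral>\<omega>. F (X n \<omega>) \<partial>M) < a"
      using lower[of "\<lambda>x. - F x" "a - (\<integral>\<omega>. F (Y \<omega>) \<partial>N)"] F by (simp add: continuous_on_minus)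
  qed
qed

text \<open>The two limits \<open>n \<rightarrow> \<infinity>\<close> and \<open>K \<rightarrow> \<infinity>\<close> may be interchanged because a Lipschitz test function
  moves in expectation by at most a multiple of the expected distance.\<close>

theorem weak_limit_by_approximation:
  fixes X :: "nat \<Rightarrow> 'a \<Rightarrow> 'c::metric_space" and Y :: "'b \<Rightarrow> 'c"
    and XK :: "nat \<Rightarrow> nat \<Rightarrow> 'a \<Rightarrow> 'c" and YK :: "nat \<Rightarrow> 'b \<Rightarrow> 'c"
  assumes "prob_space M" "prob_space N"
    and meas: "\<And>n. X n \<in> borel_measurable M" "Y \<in> borel_measurable N"
      "\<And>K n. XK K n \<in> borel_measurable M" "\<And>K. YK K \<in> borel_measurable N"
    and conv: "\<And>K (F :: 'c \<Rightarrow> real) c. continuous_on UNIV F \<Longrightarrow> (\<And>x. \<bar>F x\<bar> \<le> c) \<Longrightarrow>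
      (\<lambda>n. \<integral>\<omega>. F (XK K n \<omega>) \<partial>M) \<longlonglongrightarrow> (\<integral>\<omega>. F (YK K \<omega>) \<partial>N)"
    and approx: "\<And>e. e > 0 \<Longrightarrow> \<exists>K.
      (\<forall>\<^sub>F n in sequentially. (\<integral>\<^sup>+\<omega>. ennreal (dist (X n \<omega>) (XK K n \<omega>)) \<partial>M) \<le> ennreal e) \<and>
      (\<integral>\<^sup>+\<omega>. ennreal (dist (Y \<omega>) (YK K \<omega>)) \<partial>N) \<le> ennreal e"
    and F: "continuous_on UNIV F" "\<And>x. \<bar>F x\<bar> \<le> (c::real)"
  shows "(\<lambda>n. \<integral>\<omega>. F (X n \<omega>) \<partial>M) \<longlonglongrightarrow> (\<integral>\<omega>. F (Y \<omega>) \<partial>N)"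
proof (rule weak_limit_from_lipschitz[OF assms(1,2) meas(1,2) _ F])
  fix F :: "'c \<Rightarrow> real" and c k
  assume F: "k-lipschitz_on UNIV F" "\<And>x. \<bar>F x\<bar> \<le> c"
  have k: "0 \<le> k" using F(1) by (rule lipschitz_on_nonneg)
  show "(\<lambda>n. \<integral>\<omega>. F (X n \<omega>) \<partial>M) \<longlonglongrightarrow> (\<integral>\<omega>. F (Y \<omega>) \<partial>N)"
  proof (rule tendstoI)
    fix r :: real assume r: "r > 0"
    \<comment> \<open>the shift to \<open>k + 1\<close> allows for constant test functions, where \<open>k = 0\<close>\<close>
    define e where "e = r / (3 * (k + 1))"
    have e: "e > 0" using r k by (simp add: e_def)
    have ke: "k * e < r / 3" using r k by (simp add: e_def field_simps)
    obtain K where K: "\<forall>\<^sub>F n in sequentially. (\<integral>\<^sup>+\<omega>. ennreal (dist (X n \<omega>) (XK K n \<omega>)) \<partial>M) \<le> ennreal e"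
      "(\<integral>\<^sup>+\<omega>. ennreal (dist (Y \<omega>) (YK K \<omega>)) \<partial>N) \<le> ennreal e"
      using approx[OF e] by blast
    have 1: "\<bar>(\<integral>\<omega>. F (Y \<omega>) \<partial>N) - (\<integral>\<omega>. F (YK K \<omega>) \<partial>N)\<bar> \<le> k * e"
      by (rule expectation_lipschitz_dist_le[OF assms(2) meas(2,4) F K(2)]) (use e in simp)
    have 2: "\<forall>\<^sub>F n in sequentially. dist (\<integral>\<omega>. F (XK K n \<omega>) \<partial>M) (\<integral>\<omega>. F (YK K \<omega>) \<partial>N) < r/3"
      by (rule tendstoD[OF conv[OF lipschitz_on_continuous_on[OF F(1)] F(2)]]) (use r in simp)
    show "\<forall>\<^sub>F n in sequentially. dist (\<integral>\<omega>. F (X n \<omega>) \<partial>M) (\<integral>\<omega>. F (Y \<omega>) \<partial>N) < r"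
      using K(1) 2
    proof eventually_elim
      case (elim n)
      have "\<bar>(\<integral>\<omega>. F (X n \<omega>) \<partial>M) - (\<integral>\<omega>. F (XK K n \<omega>) \<partial>M)\<bar> \<le> k * e"
        by (rule expectation_lipschitz_dist_le[OF assms(1) meas(1,3) F elim(1)]) (use e in simp)
      then show ?case using 1 ke elim(2) unfolding dist_real_def by linarith
    qed
  qed
qed

section \<open>Continuous paths as elements of a metric space\<close>

text \<open>The space \<open>C[0,1]\<close> is embedded isometrically into the bounded continuous functions on the line
  by constant extension to both sides. Those form a type, so that random paths become ordinary Borel
  measurable functions.\<close>

definition extend01 :: "(real \<Rightarrow> real) \<Rightarrow> (real \<Rightarrow>\<^sub>C real)" where
  "extend01 f = Bcontfun (\<lambda>t. f (max 0 (min 1 t)))"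

lemma apply_extend01:
  assumes "continuous_on {0..1} f"
  shows "apply_bcontfun (extend01 f) t = f (max 0 (min 1 t))"
proof -
  have "(\<lambda>t. f (max 0 (min 1 t))) \<in> bcontfun"
    unfolding bcontfun_def
  proof (intro CollectI conjI)
    show "continuous_on UNIV (\<lambda>t. f (max 0 (min 1 t)))"
      by (rule continuous_on_compose2[OF assms]) (auto intro!: continuous_intros)
    have "bounded (f ` {0..1})"
      using assms by (intro compact_imp_bounded compact_continuous_image) auto
    then show "bounded (range (\<lambda>t. f (max 0 (min 1 t))))"
      by (rule bounded_subset) auto
  qed
  then show ?thesis unfolding extend01_def by (simp add: Bcontfun_inverse)
qed

lemma dist_extend01:
  assumes "continuous_on {0..1} f" "continuous_on {0..1} g"
  shows "ennreal (dist (extend01 f) (extend01 g)) \<le> (SUP t\<in>{0..1}. ennreal \<bar>f t - g t\<bar>)"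
proof (cases "(SUP t\<in>{0..1}. ennreal \<bar>f t - g t\<bar>)")
  case (real r)
  have "\<bar>f t - g t\<bar> \<le> r" if "t \<in> {0..1}" for t
  proof -
    have "ennreal \<bar>f t - g t\<bar> \<le> ennreal r"
      unfolding real(2)[symmetric] using that by (rule SUP_upper)
    then show ?thesis using real(1) by simp
  qed
  then have "dist (extend01 f) (extend01 g) \<le> r"
    by (intro dist_bound) (simp add: apply_extend01 assms dist_real_def)
  then show ?thesis unfolding real(2) by (rule ennreal_leI)
next
  case top
  show ?thesis unfolding top by (rule top_greatest)
qed

lemma continuous_map_restrict_C01:
  "continuous_map euclidean C01 (\<lambda>g. restrict (apply_bcontfun g) {0..1})"
proof -
  let ?m = "cfunspace (top_of_set {0..1::real}) (euclidean_metric :: real metric)"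
  have in_space: "restrict (apply_bcontfun g) {0..1} \<in> mspace ?m" for g :: "real \<Rightarrow>\<^sub>C real"
  proof -
    have "bounded (range (apply_bcontfun g))" by (metis apply_bcontfun bcontfunE bcontfun_def mem_Collect_eq)
    then have "bounded (restrict (apply_bcontfun g) {0..1} ` {0..1})"
      by (rule bounded_subset) auto
    moreover have "continuous_map (top_of_set {0..1}) euclidean (restrict (apply_bcontfun g) {0..1})"
      by (auto simp: continuous_map_iff_continuous2 intro: continuous_on_eq[where f = "apply_bcontfun g"])
    ultimately show ?thesis by (simp add: mbounded_iff_bounded)
  qed
  have "continuous_map (mtopology_of euclidean_metric) (mtopology_of ?m) (\<lambda>g::real \<Rightarrow>\<^sub>C real. restrict (apply_bcontfun g) {0..1})"
  proof (rule Lipschitz_continuous_imp_continuous_map)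
    show "Lipschitz_continuous_map euclidean_metric ?m (\<lambda>g::real \<Rightarrow>\<^sub>C real. restrict (apply_bcontfun g) {0..1})"
      unfolding Lipschitz_continuous_map_def
    proof (intro conjI exI[of _ 1] ballI)
      fix x y :: "real \<Rightarrow>\<^sub>C real"
      show "mdist ?m (restrict (apply_bcontfun x) {0..1}) (restrict (apply_bcontfun y) {0..1})
        \<le> 1 * mdist euclidean_metric x y"
        by (subst cfunspace_mdist_le[OF in_space in_space]) (auto simp: dist_bounded)
    qed (use in_space in auto)
  qed
  then show ?thesis by (simp add: C01_def)
qed

lemma path01_eq_restrict_extend01:
  assumes "continuous_on {0..1} (\<lambda>t. X t \<omega>)"
  shows "path01 X \<omega> = restrict (apply_bcontfun (extend01 (\<lambda>t. X t \<omega>))) {0..1}"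
  unfolding path01_def by (rule restrict_ext) (simp add: apply_extend01[OF assms])

text \<open>In a normed space that is not second countable, sums of measurable functions need not be
  measurable. A finite combination with scalar random coefficients is measurable nevertheless, as it
  factors through a continuous map on a countable power of the reals.\<close>

lemma borel_measurable_finite_combination:
  fixes v :: "'i \<Rightarrow> 'v::real_normed_vector"
  assumes "finite I" and X: "\<And>i. i \<in> I \<Longrightarrow> X i \<in> borel_measurable M"
  shows "(\<lambda>\<omega>. \<Sum>i\<in>I. X i \<omega> *\<^sub>R v i) \<in> borel_measurable M"
proof -
  obtain g where g: "bij_betw g {..<card I} I"
    using ex_bij_betw_nat_finite[OF \<open>finite I\<close>] by (auto simp: atLeast0LessThan)
  have "continuous_on UNIV (\<lambda>x :: nat \<Rightarrow> real. \<Sum>k<card I. x k *\<^sub>R v (g k))"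
    by (intro continuous_intros continuous_on_product_coordinates)
  then have 1: "(\<lambda>x :: nat \<Rightarrow> real. \<Sum>k<card I. x k *\<^sub>R v (g k)) \<in> borel_measurable borel"
    by (rule borel_measurable_continuous_onI)
  have 2: "(\<lambda>\<omega> k. if k < card I then X (g k) \<omega> else 0) \<in> borel_measurable M"
  proof (rule measurable_coordinatewise_then_product)
    fix k show "(\<lambda>\<omega>. if k < card I then X (g k) \<omega> else 0) \<in> borel_measurable M"
      using X bij_betwE[OF g] by (cases "k < card I") auto
  qed
  have "(\<lambda>\<omega>. \<Sum>i\<in>I. X i \<omega> *\<^sub>R v i) = (\<lambda>\<omega>. \<Sum>k<card I. X (g k) \<omega> *\<^sub>R v (g k))"
    by (intro ext sum.reindex_bij_betw[OF g, symmetric])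
  then show ?thesis using measurable_compose[OF 2 1] by simp
qed

text \<open>Bernstein polynomials write a continuous path as a uniform limit of combinations of fixed
  functions with coefficients \<open>U (k/n)\<close>, which are measurable.\<close>

lemma measurable_extend01:
  fixes U :: "real \<Rightarrow> 'a \<Rightarrow> real"
  assumes meas: "\<And>t. t \<in> {0..1} \<Longrightarrow> U t \<in> borel_measurable M"
    and cont: "\<And>\<omega>. \<omega> \<in> space M \<Longrightarrow> continuous_on {0..1} (\<lambda>t. U t \<omega>)"
  shows "(\<lambda>\<omega>. extend01 (\<lambda>t. U t \<omega>)) \<in> borel_measurable M"
proof (rule borel_measurable_LIMSEQ_metric)
  fix n
  show "(\<lambda>\<omega>. \<Sum>k\<le>n. U (k/n) \<omega> *\<^sub>R extend01 (Bernstein n k)) \<in> borel_measurable M"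
    by (intro borel_measurable_finite_combination meas) (auto simp: divide_le_eq_1)
next
  fix \<omega> assume w: "\<omega> \<in> space M"
  have bern: "continuous_on {0..1} (Bernstein n k)" for n k
    unfolding Bernstein_def by (intro continuous_intros)
  have app: "apply_bcontfun (\<Sum>k\<le>n. U (k/n) \<omega> *\<^sub>R extend01 (Bernstein n k)) t
      = (\<Sum>k\<le>n. U (k/n) \<omega> * Bernstein n k (max 0 (min 1 t)))" for n t
  proof -
    have "apply_bcontfun (\<Sum>k\<in>A. U (k/n) \<omega> *\<^sub>R extend01 (Bernstein n k)) t
      = (\<Sum>k\<in>A. U (k/n) \<omega> * Bernstein n k (max 0 (min 1 t)))" if "finite A" for A :: "nat set"
      using that by induction (simp_all add: apply_extend01[OF bern])
    then show ?thesis by simp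
  qed
  show "(\<lambda>n. \<Sum>k\<le>n. U (k/n) \<omega> *\<^sub>R extend01 (Bernstein n k)) \<longlonglongrightarrow> extend01 (\<lambda>t. U t \<omega>)"
  proof (rule LIMSEQ_I)
    fix e :: real assume e: "e > 0"
    obtain N where N: "\<And>n x. N \<le> n \<Longrightarrow> x \<in> {0..1} \<Longrightarrow> \<bar>U x \<omega> - (\<Sum>k\<le>n. U (k/n) \<omega> * Bernstein n k x)\<bar> < e/2"
      using Bernstein_Weierstrass[OF cont[OF w], of "e/2"] e by auto
    show "\<exists>no. \<forall>n\<ge>no. norm ((\<Sum>k\<le>n. U (k/n) \<omega> *\<^sub>R extend01 (Bernstein n k)) - extend01 (\<lambda>t. U t \<omega>)) < e"
    proof (intro exI allI impI)
      fix n assume n: "N \<le> n"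
      have "dist (\<Sum>k\<le>n. U (k/n) \<omega> *\<^sub>R extend01 (Bernstein n k)) (extend01 (\<lambda>t. U t \<omega>)) \<le> e/2"
      proof (rule dist_bound)
        fix t :: real
        show "dist (apply_bcontfun (\<Sum>k\<le>n. U (k/n) \<omega> *\<^sub>R extend01 (Bernstein n k)) t)
          (apply_bcontfun (extend01 (\<lambda>t. U t \<omega>)) t) \<le> e/2"
          using N[OF n, of "max 0 (min 1 t)"] unfolding app
          by (simp add: apply_extend01[OF cont[OF w]] dist_real_def abs_minus_commute less_imp_le)
      qed
      then show "norm ((\<Sum>k\<le>n. U (k/n) \<omega> *\<^sub>R extend01 (Bernstein n k)) - extend01 (\<lambda>t. U t \<omega>)) < e"
        using e by (simp add: dist_norm)
    qed
  qed
qed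

lemma extend01_combination:
  assumes "\<And>i. i \<in> I \<Longrightarrow> continuous_on {0..1} (f i)"
  shows "extend01 (\<lambda>t. \<Sum>i\<in>I. x i * f i t) = (\<Sum>i\<in>I. x i *\<^sub>R extend01 (f i))"
proof (rule bcontfun_eqI)
  fix t
  have cont: "continuous_on {0..1} (\<lambda>t. \<Sum>i\<in>I. x i * f i t)"
    by (intro continuous_intros assms)
  have "apply_bcontfun (\<Sum>i\<in>A. x i *\<^sub>R extend01 (f i)) t = (\<Sum>i\<in>A. x i * f i (max 0 (min 1 t)))" if "A \<subseteq> I" for A
    using that
  proof (induction A rule: infinite_finite_induct)
    case (insert i A)
    then have "apply_bcontfun (extend01 (f i)) t = f i (max 0 (min 1 t))" by (intro apply_extend01 assms) auto
    then show ?case using insert by simp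
  qed auto
  then show "apply_bcontfun (extend01 (\<lambda>t. \<Sum>i\<in>I. x i * f i t)) t = apply_bcontfun (\<Sum>i\<in>I. x i *\<^sub>R extend01 (f i)) t"
    by (simp add: apply_extend01[OF cont])
qed

text \<open>Restriction to \<open>[0,1]\<close> is continuous into \<open>C01\<close>, so weak convergence of the extended paths
  is enough.\<close>

lemma converges_weakly_C01I:
  fixes Y :: "nat \<Rightarrow> real \<Rightarrow> 'a \<Rightarrow> real" and W :: "real \<Rightarrow> 'b \<Rightarrow> real"
  assumes Ymeas: "\<And>n. (\<lambda>\<omega>. extend01 (\<lambda>t. Y n t \<omega>)) \<in> borel_measurable M"
    and Wmeas: "(\<lambda>\<omega>. extend01 (\<lambda>t. W t \<omega>)) \<in> borel_measurable N"
    and Ycont: "\<And>n \<omega>. \<omega> \<in> space M \<Longrightarrow> continuous_on {0..1} (\<lambda>t. Y n t \<omega>)"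
    and Wcont: "\<And>\<omega>. \<omega> \<in> space N \<Longrightarrow> continuous_on {0..1} (\<lambda>t. W t \<omega>)"
    and conv: "\<And>F c. continuous_on UNIV F \<Longrightarrow> (\<And>x. \<bar>F x\<bar> \<le> (c::real)) \<Longrightarrow>
      (\<lambda>n. \<integral>\<omega>. F (extend01 (\<lambda>t. Y n t \<omega>)) \<partial>M) \<longlonglongrightarrow> (\<integral>\<omega>. F (extend01 (\<lambda>t. W t \<omega>)) \<partial>N)"
  shows "converges_weakly C01 M (\<lambda>n. path01 (Y n)) N (path01 W)"
proof -
  let ?R = "\<lambda>g::real \<Rightarrow>\<^sub>C real. restrict (apply_bcontfun g) {0..1}"
  have R_in: "?R g \<in> topspace C01" for g
    using continuous_map_restrict_C01 by (auto simp: continuous_map_def)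
  have R: "?R \<in> measurable borel (borel_in C01)"
    unfolding borel_in_def
  proof (rule measurable_measure_of)
    show "{U. openin C01 U} \<subseteq> Pow (topspace C01)" by (auto dest: openin_subset)
    show "?R \<in> space borel \<rightarrow> topspace C01" using R_in by auto
    fix U assume "U \<in> {U. openin C01 U}"
    then have "openin euclidean {x \<in> topspace euclidean. ?R x \<in> U}"
      using continuous_map_restrict_C01 unfolding continuous_map_def by blast
    then have "open (?R -` U)" by (simp add: vimage_def)
    then show "?R -` U \<inter> space borel \<in> sets borel" by simp
  qed
  have Yeq: "path01 (Y n) \<omega> = ?R (extend01 (\<lambda>t. Y n t \<omega>))" if "\<omega> \<in> space M" for n \<omega>
    by (rule path01_eq_restrict_extend01[where X = "Y n", OF Ycont[OF that]])
  have Weq: "path01 W \<omega> = ?R (extend01 (\<lambda>t. W t \<omega>))" if "\<omega> \<in> space N" for \<omega>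
    by (rule path01_eq_restrict_extend01[where X = W, OF Wcont[OF that]])
  show ?thesis
    unfolding converges_weakly_def
  proof (intro conjI allI impI)
    show "path01 (Y n) \<in> measurable M (borel_in C01)" for n
      using measurable_compose[OF Ymeas R] by (rule measurable_cong[THEN iffD2, rotated]) (rule Yeq)
    show "path01 W \<in> measurable N (borel_in C01)"
      using measurable_compose[OF Wmeas R] by (rule measurable_cong[THEN iffD2, rotated]) (rule Weq)
    fix F assume F: "continuous_map C01 euclideanreal F \<and> bounded (F ` topspace C01)"
    have cont: "continuous_on UNIV (F \<circ> ?R)"
      using continuous_map_compose[OF continuous_map_restrict_C01 conjunct1[OF F]] by simp
    obtain c where "\<And>x. x \<in> topspace C01 \<Longrightarrow> \<bar>F x\<bar> \<le> c"
      using F unfolding bounded_iff by auto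
    then have "\<bar>(F \<circ> ?R) x\<bar> \<le> c" for x using R_in by simp
    from conv[OF cont this]
    have "(\<lambda>n. \<integral>\<omega>. (F \<circ> ?R) (extend01 (\<lambda>t. Y n t \<omega>)) \<partial>M) \<longlonglongrightarrow> (\<integral>\<omega>. (F \<circ> ?R) (extend01 (\<lambda>t. W t \<omega>)) \<partial>N)" .
    moreover have "(\<integral>\<omega>. (F \<circ> ?R) (extend01 (\<lambda>t. Y n t \<omega>)) \<partial>M) = (\<integral>\<omega>. F (path01 (Y n) \<omega>) \<partial>M)" for n
      by (rule Bochner_Integration.integral_cong) (simp_all add: Yeq)
    moreover have "(\<integral>\<omega>. (F \<circ> ?R) (extend01 (\<lambda>t. W t \<omega>)) \<partial>N) = (\<integral>\<omega>. F (path01 W \<omega>) \<partial>N)"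
      by (rule Bochner_Integration.integral_cong) (simp_all add: Weq)
    ultimately show "(\<lambda>n. \<integral>\<omega>. F (path01 (Y n) \<omega>) \<partial>M) \<longlonglongrightarrow> (\<integral>\<omega>. F (path01 W \<omega>) \<partial>N)" by simp
  qed
qed

section \<open>Mean squares\<close>

abbreviation mean_square :: "'c measure \<Rightarrow> ('c \<Rightarrow> real) \<Rightarrow> ennreal" where
  "mean_square M f \<equiv> (\<integral>\<^sup>+x. ennreal ((f x)\<^sup>2) \<partial>M)"

abbreviation sup01 :: "(real \<Rightarrow> real) \<Rightarrow> ennreal" where
  "sup01 f \<equiv> (SUP t\<in>{0..1}. ennreal \<bar>f t\<bar>)"

lemma numeral_times_ennreal: "0 \<le> x \<Longrightarrow> numeral k * ennreal x = ennreal (numeral k * x)"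
  by (simp add: ennreal_mult)

lemma four_times_double_sum: "4 * (s * (2 * x + 2 * y)) = 8 * (s * x) + 8 * (s * y)" for s x y :: ennreal
proof -
  have "4 * (s * (2 * x + 2 * y)) = (4 * 2) * (s * x) + (4 * 2) * (s * y)"
    by (simp only: distrib_left mult_ac)
  then show ?thesis by simp
qed

lemma scaled_variance_le:
  assumes "C' \<ge> 0"
  shows "ennreal (s\<^sup>2) * (4 * ennreal (C' * d powr g)) \<le> ennreal (4 * s\<^sup>2 * C' * d powr g)"
proof -
  define q where "q = s\<^sup>2 * (C' * d powr g)"
  have q: "q \<ge> 0" using assms by (simp add: q_def)
  note numeral_times_ennreal
  then have "ennreal (s\<^sup>2) * (4 * ennreal (C' * d powr g)) = ennreal (s\<^sup>2) * ennreal (4 * (C' * d powr g))"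
    using assms by simp
  also have "\<dots> = ennreal (4 * q)" using assms by (subst ennreal_mult[symmetric]) (simp_all add: q_def)
  finally show ?thesis by (simp add: q_def mult.assoc)
qed

lemma ennreal_abs_diff_le_double:
  assumes "ennreal \<bar>a\<bar> \<le> w" "ennreal \<bar>b\<bar> \<le> w"
  shows "ennreal \<bar>a - b\<bar> \<le> 2 * w"
proof -
  have "ennreal \<bar>a - b\<bar> \<le> ennreal (\<bar>a\<bar> + \<bar>b\<bar>)" by (intro ennreal_leI) auto
  also have "\<dots> = ennreal \<bar>a\<bar> + ennreal \<bar>b\<bar>" by simp
  also have "\<dots> \<le> w + w" by (intro add_mono assms)
  finally show ?thesis by (simp add: mult_2)
qed

lemma square_diff_bound: "ennreal ((a + b)\<^sup>2) \<le> 2 * ennreal (a\<^sup>2) + 2 * ennreal (b\<^sup>2)" for a b :: real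
proof -
  have "(a + b)\<^sup>2 \<le> 2 * a\<^sup>2 + 2 * b\<^sup>2" using sum_squares_bound[of a b] by (simp add: power2_sum)
  then have "ennreal ((a + b)\<^sup>2) \<le> ennreal (2 * a\<^sup>2 + 2 * b\<^sup>2)" by (rule ennreal_leI)
  also have "\<dots> = 2 * ennreal (a\<^sup>2) + 2 * ennreal (b\<^sup>2)"
    by (simp add: ennreal_plus ennreal_mult)
  finally show ?thesis .
qed

lemma nn_integral_square_sum:
  assumes [measurable]: "f \<in> borel_measurable M" "g \<in> borel_measurable M" and "\<And>x. x \<in> space M \<Longrightarrow> h x = f x + (g x :: real)"
  shows "mean_square M h \<le> 2 * mean_square M f + 2 * mean_square M g"
proof -
  have "mean_square M h \<le> (\<integral>\<^sup>+x. 2 * ennreal ((f x)\<^sup>2) + 2 * ennreal ((g x)\<^sup>2) \<partial>M)"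
    by (intro nn_integral_mono) (simp only: assms(3) square_diff_bound)
  also have "\<dots> = 2 * mean_square M f + 2 * mean_square M g"
    by (subst nn_integral_add) (auto simp: nn_integral_cmult)
  finally show ?thesis .
qed

lemma tendsto_0_squeeze_double:
  fixes f g h :: "nat \<Rightarrow> ennreal"
  assumes "f \<longlonglongrightarrow> 0" "g \<longlonglongrightarrow> 0" "\<And>m. h m \<le> 2 * f m + 2 * g m"
  shows "h \<longlonglongrightarrow> 0"
proof (rule tendsto_sandwich[OF _ _ tendsto_const])
  have "(\<lambda>m. 2 * f m + 2 * g m) \<longlonglongrightarrow> 2 * 0 + 2 * 0"
    by (intro tendsto_add ennreal_tendsto_cmult assms) auto
  then show "(\<lambda>m. 2 * f m + 2 * g m) \<longlonglongrightarrow> 0" by simp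
qed (use assms in auto)

text \<open>Dominated convergence in \<open>L\<^sup>2\<close>, for a dominating function that may be infinite at some
  points.\<close>

lemma nn_integral_square_dominated:
  fixes u :: "nat \<Rightarrow> 'c \<Rightarrow> real"
  assumes [measurable]: "\<And>n. u n \<in> borel_measurable M" "v \<in> borel_measurable M" "w \<in> borel_measurable M"
    and bd: "\<forall>\<^sub>F n in sequentially. \<forall>y. ennreal \<bar>u n y\<bar> \<le> w y"
    and fin: "(\<integral>\<^sup>+y. (w y)\<^sup>2 \<partial>M) < \<infinity>"
    and lim: "AE y in M. (\<lambda>n. u n y) \<longlonglongrightarrow> v y"
  shows "(\<lambda>n. mean_square M (\<lambda>y. u n y)) \<longlonglongrightarrow> mean_square M v"
proof -
  obtain n0 where n0: "\<And>n y. n \<ge> n0 \<Longrightarrow> ennreal \<bar>u n y\<bar> \<le> w y" using bd unfolding eventually_sequentially by auto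
  have "(\<lambda>n. mean_square M (\<lambda>y. u (n + n0) y)) \<longlonglongrightarrow> mean_square M v"
  proof (rule nn_integral_dominated_convergence[where w = "\<lambda>y. (w y)\<^sup>2"])
    show "AE y in M. ennreal ((u (n + n0) y)\<^sup>2) \<le> (w y)\<^sup>2" for n
    proof (rule AE_I2)
      fix y
      have "ennreal ((u (n + n0) y)\<^sup>2) = (ennreal \<bar>u (n + n0) y\<bar>)\<^sup>2" by (simp add: ennreal_power)
      also have "\<dots> \<le> (w y)\<^sup>2" by (intro power_mono n0) auto
      finally show "ennreal ((u (n + n0) y)\<^sup>2) \<le> (w y)\<^sup>2" .
    qed
    show "AE y in M. (\<lambda>n. ennreal ((u (n + n0) y)\<^sup>2)) \<longlonglongrightarrow> ennreal ((v y)\<^sup>2)"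
      using lim by eventually_elim (intro tendsto_ennrealI tendsto_power LIMSEQ_ignore_initial_segment)
  qed (use fin in auto)
  then show ?thesis by (rule LIMSEQ_offset)
qed

section \<open>Chaining with second moments\<close>

lemma dyadic_in_unit: "j \<le> 2 ^ m \<Longrightarrow> real j / 2 ^ m \<in> {0..1}"
proof -
  assume "j \<le> 2 ^ m"
  then have "real j \<le> real (2 ^ m)" by (simp only: of_nat_le_iff)
  then show ?thesis by simp
qed

text \<open>A point \<open>t\<close> is reached along its dyadic truncations \<open>\<lfloor>2\<^sup>k t\<rfloor> / 2\<^sup>k\<close>, consecutive ones of which are
  equal or neighbours on the finer grid.\<close>

lemma dyadic_chaining:
  fixes f :: "real \<Rightarrow> real"
  assumes cont: "continuous_on {0..1} f" and t: "t \<in> {0..1}"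
    and D: "\<And>k j. k \<ge> m \<Longrightarrow> j < 2 ^ k \<Longrightarrow> \<bar>f (real (Suc j) / 2 ^ k) - f (real j / 2 ^ k)\<bar> \<le> d k"
    and A: "\<And>j. j \<le> 2 ^ m \<Longrightarrow> \<bar>f (real j / 2 ^ m)\<bar> \<le> a"
    and d0: "\<And>k. 0 \<le> d k" 
  shows "ennreal \<bar>f t\<bar> \<le> ennreal a + (\<Sum>k. ennreal (d (Suc m + k)))"
proof -
  define j where "j k = nat \<lfloor>2 ^ k * t\<rfloor>" for k
  define u where "u k = real (j k) / 2 ^ k" for k
  have t01: "0 \<le> t" "t \<le> 1" using t by auto
  have j_le: "real (j k) \<le> 2 ^ k * t" "2 ^ k * t < real (j k) + 1" for k
    using t01 by (auto simp: j_def)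
  have j_bd: "j k \<le> 2 ^ k" for k
  proof -
    have "real (j k) \<le> 2 ^ k * t" by (rule j_le)
    also have "\<dots> \<le> 2 ^ k" using t01 by simp
    finally have "real (j k) \<le> real (2 ^ k)" by simp
    then show ?thesis by (simp only: of_nat_le_iff)
  qed
  have u01: "u k \<in> {0..1}" for k
  proof -
    have "real (j k) \<le> real (2 ^ k)" using j_bd by (simp only: of_nat_le_iff)
    then show ?thesis by (simp add: u_def)
  qed
  have ut: "\<bar>u k - t\<bar> \<le> (1/2) ^ k" for k
  proof -
    have "u k - t = (real (j k) - 2 ^ k * t) / 2 ^ k" by (simp add: u_def field_simps)
    then have "\<bar>u k - t\<bar> = \<bar>real (j k) - 2 ^ k * t\<bar> / 2 ^ k" by simp
    also have "\<dots> \<le> 1 / 2 ^ k" using j_le[of k] by (intro divide_right_mono) auto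
    finally show ?thesis by (simp add: power_divide)
  qed
  have "u \<longlonglongrightarrow> t"
  proof (rule LIM_zero_cancel, rule Lim_null_comparison)
    show "\<forall>\<^sub>F k in sequentially. norm (u k - t) \<le> (1/2) ^ k" using ut by auto
  qed (auto intro: LIMSEQ_power_zero)
  then have lim: "(\<lambda>k. f (u k)) \<longlonglongrightarrow> f t"
    by (rule continuous_on_tendsto_compose[OF cont]) (use t u01 in auto)
  have step: "\<bar>f (u (Suc k)) - f (u k)\<bar> \<le> d (Suc k)" if "k \<ge> m" for k
  proof -
    have "real (j (Suc k)) < 2 * real (j k) + 2" "2 * real (j k) < real (j (Suc k)) + 1"
      using j_le[of k] j_le[of "Suc k"] by auto
    then have "j (Suc k) = 2 * j k \<or> j (Suc k) = 2 * j k + 1" by linarith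
    then show ?thesis
    proof
      assume "j (Suc k) = 2 * j k"
      then have "u (Suc k) = u k" by (simp add: u_def)
      then show ?thesis using d0 by simp
    next
      assume *: "j (Suc k) = 2 * j k + 1"
      have "real (2 * j k) / 2 ^ Suc k = u k" by (simp add: u_def)
      moreover have "2 * j k < 2 ^ Suc k" using j_bd[of "Suc k"] * by simp
      ultimately show ?thesis
        using D[of "Suc k" "2 * j k"] that * by (simp add: u_def)
    qed
  qed
  have bd: "ennreal \<bar>f (u (m + k))\<bar> \<le> ennreal a + (\<Sum>i<k. ennreal (d (Suc m + i)))" for k
  proof (induction k)
    case 0
    then show ?case using A[OF j_bd] by (simp add: u_def)
  next
    case (Suc k)
    have "\<bar>f (u (m + Suc k))\<bar> \<le> \<bar>f (u (m + k))\<bar> + d (Suc m + k)"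
      using step[of "m + k"] by auto
    then have "ennreal \<bar>f (u (m + Suc k))\<bar> \<le> ennreal (\<bar>f (u (m + k))\<bar> + d (Suc m + k))"
      by (rule ennreal_leI)
    also have "\<dots> = ennreal \<bar>f (u (m + k))\<bar> + ennreal (d (Suc m + k))"
      using d0 by (simp add: ennreal_plus)
    also have "\<dots> \<le> (ennreal a + (\<Sum>i<k. ennreal (d (Suc m + i)))) + ennreal (d (Suc m + k))"
      by (intro add_right_mono Suc)
    finally show ?case by (simp add: add.assoc)
  qed
  have "(\<lambda>k. ennreal \<bar>f (u (m + k))\<bar>) \<longlonglongrightarrow> ennreal \<bar>f t\<bar>"
    using LIMSEQ_ignore_initial_segment[OF lim, of m]
    by (intro tendsto_ennrealI tendsto_rabs) (simp add: add.commute)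
  then show ?thesis
  proof (rule tendsto_upperbound)
    show "\<forall>\<^sub>F k in sequentially. ennreal \<bar>f (u (m + k))\<bar> \<le> ennreal a + (\<Sum>k. ennreal (d (Suc m + k)))"
      by (intro always_eventually allI order_trans[OF bd] add_left_mono sum_le_suminf) auto
  qed simp
qed

text \<open>A bound for the expected contribution of all levels finer than \<open>2\<^bsup>-m\<^esup>\<close> to the chaining sum, if
  the increments over \<open>[s,t]\<close> have second moment at most \<open>C (t-s)\<^sup>g\<close>.\<close>

definition chaining_tail :: "real \<Rightarrow> real \<Rightarrow> nat \<Rightarrow> ennreal" where
  "chaining_tail C g m = (\<Sum>k. ennreal ((1 + C) * 2 powr (- (g - 1) / 2 * real (Suc m + k))))"

lemma chaining_tail_tendsto_0:
  assumes "g > 1" "C \<ge> 0"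
  shows "chaining_tail C g \<longlonglongrightarrow> 0"
proof -
  define q where "q = 2 powr (- (g - 1) / 2)"
  have q: "0 < q" "q < 1" using assms by (auto simp: q_def powr_less_one)
  have summand: "(1 + C) * 2 powr (- (g - 1) / 2 * real (Suc m + k)) = ((1 + C) * q ^ Suc m) * q ^ k" for m k
  proof -
    have "2 powr (- (g - 1) / 2 * real (Suc m + k)) = q powr real (Suc m + k)"
      unfolding q_def by (rule powr_powr[symmetric])
    also have "\<dots> = q ^ (Suc m + k)" using q by (intro powr_realpow) simp
    also have "\<dots> = q ^ Suc m * q ^ k" by (rule power_add)
    finally show ?thesis by (simp only: mult.assoc)
  qed
  have "(\<lambda>k. ((1 + C) * q ^ Suc m) * q ^ k) sums (((1 + C) * q ^ Suc m) * (1 / (1 - q)))" for m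
    by (intro sums_mult geometric_sums) (use q in auto)
  then have eq: "chaining_tail C g m = ennreal (((1 + C) * q ^ Suc m) * (1 / (1 - q)))" for m
    unfolding chaining_tail_def summand
    by (intro suminf_ennreal_eq) (use q assms in auto)
  have "(\<lambda>m. q ^ Suc m) \<longlonglongrightarrow> 0"
    by (rule LIMSEQ_Suc, rule LIMSEQ_realpow_zero) (use q in auto)
  then have "(\<lambda>m. ((1 + C) * q ^ Suc m) * (1 / (1 - q))) \<longlonglongrightarrow> ((1 + C) * 0) * (1 / (1 - q))"
    by (intro tendsto_intros)
  then have "(\<lambda>m. ((1 + C) * q ^ Suc m) * (1 / (1 - q))) \<longlonglongrightarrow> 0" by simp
  then show ?thesis unfolding eq[abs_def] using tendsto_ennrealI by fastforce
qed

text \<open>On level \<open>k\<close> there are \<open>2\<^sup>k\<close> increments with second moment at most \<open>C 2\<^bsup>-kg\<^esup>\<close>, so their maximum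
  has second moment at most \<open>C 2\<^bsup>-k(g-1)\<^esup>\<close>, which is summable after taking roots as \<open>g > 1\<close>. Roots
  are avoided by the inequality \<open>|x| \<le> b + x\<^sup>2/b\<close>, with \<open>b\<close> of the size expected for \<open>|x|\<close>; on the
  coarsest grid \<open>b = \<tau>\<close> is left free.\<close>

lemma expected_supremum_le:
  fixes U :: "real \<Rightarrow> 'a \<Rightarrow> real"
  assumes "prob_space M"
    and [measurable]: "\<And>t. t \<in> {0..1} \<Longrightarrow> U t \<in> borel_measurable M"
    and cont: "\<And>\<omega>. \<omega> \<in> space M \<Longrightarrow> continuous_on {0..1} (\<lambda>t. U t \<omega>)"
    and incr: "\<And>s t. 0 \<le> s \<Longrightarrow> s \<le> t \<Longrightarrow> t \<le> 1 \<Longrightarrow>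
       mean_square M (\<lambda>\<omega>. U t \<omega> - U s \<omega>) \<le> ennreal (C * (t - s) powr g)"
    and C: "C \<ge> 0" and tau: "\<tau> > 0"
    and grid: "\<And>j. j \<le> 2 ^ m \<Longrightarrow> mean_square M (\<lambda>\<omega>. U (real j / 2 ^ m) \<omega>) \<le> ennreal \<eta>"
    and eta: "\<eta> \<ge> 0"
  shows "(\<integral>\<^sup>+\<omega>. sup01 (\<lambda>t. U t \<omega>) \<partial>M)
    \<le> ennreal (real (2 ^ m + 1) * (\<tau> + \<eta> / \<tau>)) + chaining_tail C g m"
proof -
  interpret prob_space M by fact
  define a where "a \<omega> = (\<Sum>j\<le>2^m. \<tau> + (U (real j / 2 ^ m) \<omega>)\<^sup>2 / \<tau>)" for \<omega>
  \<comment> \<open>the root of \<open>2\<^bsup>-k(g-1)\<^esup>\<close>, the order of the maximal increment on level \<open>k\<close>\<close>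
  define h where "h k = 2 powr (- (g - 1) / 2 * real k)" for k :: nat
  define d where "d k \<omega> = h k + (\<Sum>j<2^k. (U (real (Suc j) / 2 ^ k) \<omega> - U (real j / 2 ^ k) \<omega>)\<^sup>2) / h k" for k \<omega>
  have h: "h k > 0" for k by (simp add: h_def)
  have dy: "real j / 2 ^ k \<in> {0..1}" if "j \<le> 2 ^ k" for j k :: nat
    by (rule dyadic_in_unit[OF that])
  have [measurable]: "U (real j / 2 ^ k) \<in> borel_measurable M" if "j \<le> 2 ^ k" for j k
    using dy[OF that] by measurable
  have meas_U: "U (real j / 2 ^ k) \<in> borel_measurable M" if "j \<le> 2 ^ k" for j k
    using that by simp
  have [measurable]: "a \<in> borel_measurable M"
    unfolding a_def by (intro borel_measurable_sum borel_measurable_add borel_measurable_divide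
      borel_measurable_power borel_measurable_const meas_U) auto
  have [measurable]: "d k \<in> borel_measurable M" for k
    unfolding d_def by (intro borel_measurable_sum borel_measurable_add borel_measurable_divide
      borel_measurable_power borel_measurable_const borel_measurable_diff meas_U) auto
  have young: "\<bar>x\<bar> \<le> b + x\<^sup>2 / b" if "b > 0" for x b :: real
  proof -
    have "b * \<bar>x\<bar> \<le> b\<^sup>2 + x\<^sup>2"
    proof -
      have "2 * (b * \<bar>x\<bar>) \<le> b\<^sup>2 + x\<^sup>2"
        using sum_squares_bound[of b "\<bar>x\<bar>"] by (simp add: mult.assoc)
      moreover have "0 \<le> b * \<bar>x\<bar>" using that by simp
      ultimately show ?thesis by linarith
    qed
    then show ?thesis using that by (simp add: field_simps power2_eq_square)
  qed
  have "sup01 (\<lambda>t. U t \<omega>) \<le> ennreal (a \<omega>) + (\<Sum>k. ennreal (d (Suc m + k) \<omega>))"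
    if w: "\<omega> \<in> space M" for \<omega>
  proof (rule SUP_least, rule dyadic_chaining[OF cont[OF w]])
    fix k j :: nat assume "j < 2 ^ k"
    have "\<bar>U (real (Suc j) / 2 ^ k) \<omega> - U (real j / 2 ^ k) \<omega>\<bar>
      \<le> h k + (U (real (Suc j) / 2 ^ k) \<omega> - U (real j / 2 ^ k) \<omega>)\<^sup>2 / h k" by (rule young[OF h])
    also have "\<dots> \<le> d k \<omega>"
      unfolding d_def using h[of k] \<open>j < 2 ^ k\<close>
      by (intro add_left_mono divide_right_mono member_le_sum[of j "{..<2^k}"]) auto
    finally show "\<bar>U (real (Suc j) / 2 ^ k) \<omega> - U (real j / 2 ^ k) \<omega>\<bar> \<le> d k \<omega>" .
  next
    fix j :: nat assume "j \<le> 2 ^ m"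
    have "\<bar>U (real j / 2 ^ m) \<omega>\<bar> \<le> \<tau> + (U (real j / 2 ^ m) \<omega>)\<^sup>2 / \<tau>" by (rule young[OF tau])
    also have "\<dots> \<le> a \<omega>"
      unfolding a_def using tau \<open>j \<le> 2 ^ m\<close>
      by (intro member_le_sum[of j "{..2^m}" "\<lambda>j. \<tau> + (U (real j / 2 ^ m) \<omega>)\<^sup>2 / \<tau>"]) auto
    finally show "\<bar>U (real j / 2 ^ m) \<omega>\<bar> \<le> a \<omega>" .
  next
    show "0 \<le> d k \<omega>" for k using h[of k] by (auto simp: d_def intro!: add_nonneg_nonneg sum_nonneg divide_nonneg_pos)
  qed
  then have "(\<integral>\<^sup>+\<omega>. sup01 (\<lambda>t. U t \<omega>) \<partial>M)
      \<le> (\<integral>\<^sup>+\<omega>. ennreal (a \<omega>) + (\<Sum>k. ennreal (d (Suc m + k) \<omega>)) \<partial>M)"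
    by (intro nn_integral_mono)
  also have "\<dots> = (\<integral>\<^sup>+\<omega>. ennreal (a \<omega>) \<partial>M) + (\<Sum>k. \<integral>\<^sup>+\<omega>. ennreal (d (Suc m + k) \<omega>) \<partial>M)"
    by (subst nn_integral_add) (auto simp: nn_integral_suminf)
  also have "(\<integral>\<^sup>+\<omega>. ennreal (a \<omega>) \<partial>M) \<le> ennreal (real (2 ^ m + 1) * (\<tau> + \<eta> / \<tau>))"
  proof -
    have "(\<integral>\<^sup>+\<omega>. ennreal (a \<omega>) \<partial>M) = (\<integral>\<^sup>+\<omega>. (\<Sum>j\<le>2^m. ennreal \<tau> + ennreal (1/\<tau>) * ennreal ((U (real j / 2 ^ m) \<omega>)\<^sup>2)) \<partial>M)"
      unfolding a_def using tau
      by (intro nn_integral_cong, subst sum_ennreal[symmetric]) (auto simp: ennreal_plus ennreal_mult[symmetric])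
    also have "\<dots> = (\<Sum>j\<le>2^m. \<integral>\<^sup>+\<omega>. ennreal \<tau> + ennreal (1/\<tau>) * ennreal ((U (real j / 2 ^ m) \<omega>)\<^sup>2) \<partial>M)"
      by (intro nn_integral_sum) simp
    also have "\<dots> = (\<Sum>j\<le>2^m. ennreal \<tau> + ennreal (1/\<tau>) * mean_square M (\<lambda>\<omega>. U (real j / 2 ^ m) \<omega>))"
      by (intro sum.cong refl, subst nn_integral_add) (auto simp: nn_integral_cmult emeasure_space_1)
    also have "\<dots> \<le> (\<Sum>j\<le>(2::nat)^m. ennreal \<tau> + ennreal (1/\<tau>) * ennreal \<eta>)"
      by (intro sum_mono add_left_mono mult_left_mono grid) auto
    also have "\<dots> = ennreal (real (2 ^ m + 1) * (\<tau> + \<eta> / \<tau>))"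
      using tau eta
      by (simp add: ennreal_mult[symmetric] ennreal_plus[symmetric] ennreal_of_nat_eq_real_of_nat del: ennreal_plus)
    finally show ?thesis .
  qed
  also have "(\<Sum>k. \<integral>\<^sup>+\<omega>. ennreal (d (Suc m + k) \<omega>) \<partial>M) \<le> chaining_tail C g m"
    unfolding chaining_tail_def
  proof (rule suminf_le)
    fix k'
    define k where "k = Suc m + k'"
    have meas_incr: "(\<lambda>\<omega>. ennreal ((U (real (Suc j) / 2 ^ k) \<omega> - U (real j / 2 ^ k) \<omega>)\<^sup>2)) \<in> borel_measurable M"
      if "j \<in> {..<2 ^ k}" for j
      using that meas_U[of j k] meas_U[of "Suc j" k] by simp
    have "(\<integral>\<^sup>+\<omega>. ennreal (d k \<omega>) \<partial>M) = (\<integral>\<^sup>+\<omega>. ennreal (h k) + ennreal (1 / h k) * (\<Sum>j<2^k. ennreal ((U (real (Suc j) / 2 ^ k) \<omega> - U (real j / 2 ^ k) \<omega>)\<^sup>2)) \<partial>M)"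
      unfolding d_def using h[of k]
      by (intro nn_integral_cong, subst sum_ennreal)
         (auto simp: ennreal_plus[symmetric] ennreal_mult[symmetric] sum_nonneg simp del: ennreal_plus)
    also have "\<dots> = ennreal (h k) + ennreal (1 / h k) * (\<Sum>j<2^k. \<integral>\<^sup>+\<omega>. ennreal ((U (real (Suc j) / 2 ^ k) \<omega> - U (real j / 2 ^ k) \<omega>)\<^sup>2) \<partial>M)"
    proof -
      have meas_sum: "(\<lambda>\<omega>. \<Sum>j<2^k. ennreal ((U (real (Suc j) / 2 ^ k) \<omega> - U (real j / 2 ^ k) \<omega>)\<^sup>2)) \<in> borel_measurable M"
        by (intro borel_measurable_sum meas_incr)
      have 1: "(\<integral>\<^sup>+\<omega>. (\<Sum>j<2^k. ennreal ((U (real (Suc j) / 2 ^ k) \<omega> - U (real j / 2 ^ k) \<omega>)\<^sup>2)) \<partial>M)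
        = (\<Sum>j<2^k. \<integral>\<^sup>+\<omega>. ennreal ((U (real (Suc j) / 2 ^ k) \<omega> - U (real j / 2 ^ k) \<omega>)\<^sup>2) \<partial>M)"
        by (intro nn_integral_sum meas_incr)
      have 2: "(\<integral>\<^sup>+\<omega>. ennreal (h k) + ennreal (1 / h k) * q \<omega> \<partial>M)
          = ennreal (h k) + ennreal (1 / h k) * (\<integral>\<^sup>+\<omega>. q \<omega> \<partial>M)"
        if [measurable]: "q \<in> borel_measurable M" for q
        by (subst nn_integral_add, measurable, subst nn_integral_cmult, measurable)
           (simp add: emeasure_space_1)
      show ?thesis unfolding 2[OF meas_sum] 1 by (rule refl)
    qed
    also have "\<dots> \<le> ennreal (h k) + ennreal (1 / h k) * (\<Sum>j<(2::nat)^k. ennreal (C * (1 / 2 ^ k) powr g))"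
    proof (intro add_left_mono mult_left_mono sum_mono)
      fix j assume j: "j \<in> {..<(2::nat)^k}"
      have "real (Suc j) / 2 ^ k - real j / 2 ^ k = 1 / 2 ^ k" by (simp add: field_simps)
      then show "mean_square M (\<lambda>\<omega>. U (real (Suc j) / 2 ^ k) \<omega> - U (real j / 2 ^ k) \<omega>) \<le> ennreal (C * (1 / 2 ^ k) powr g)"
        using incr[of "real j / 2 ^ k" "real (Suc j) / 2 ^ k"] dy[of j k] dy[of "Suc j" k] j
        by (auto simp: divide_right_mono)
    qed auto
    also have "\<dots> = ennreal (h k + (1 / h k) * (2 ^ k * (C * (1 / 2 ^ k) powr g)))"
    proof -
      have "(\<Sum>j<(2::nat)^k. ennreal (C * (1 / 2 ^ k) powr g)) = ennreal (2 ^ k * (C * (1 / 2 ^ k) powr g))"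
        using C by (subst sum_ennreal) auto
      moreover have "ennreal (h k) + ennreal (1 / h k) * ennreal y = ennreal (h k + 1 / h k * y)" if "y \<ge> 0" for y
        using h[of k] that by (subst ennreal_mult[symmetric], simp, simp, subst ennreal_plus) auto
      ultimately show ?thesis using C by simp
    qed
    also have "h k + (1 / h k) * (2 ^ k * (C * (1 / 2 ^ k) powr g)) = (1 + C) * h k"
    proof -
      have 1: "1 / h k = 2 powr ((g - 1) / 2 * real k)"
      proof -
        have e: "(g - 1) / 2 * real k = - (- (g - 1) / 2 * real k)" by (simp add: field_simps)
        show ?thesis unfolding h_def by (subst e) (rule powr_minus_divide[symmetric])
      qed
      have 2: "(2::real) ^ k = 2 powr real k" by (simp add: powr_realpow)
      have 3: "(1 / 2 ^ k) powr g = 2 powr (- real k * g)"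
        unfolding 2 powr_minus_divide[symmetric] powr_powr by simp
      have "(1 / h k) * (2 ^ k * (1 / 2 ^ k) powr g) = h k"
        unfolding 1 3 unfolding 2 h_def powr_add[symmetric] by (simp add: field_simps)
      then have "C * ((1 / h k) * (2 ^ k * (1 / 2 ^ k) powr g)) = C * h k" by simp
      then show ?thesis by (simp add: algebra_simps)
    qed
    finally show "(\<integral>\<^sup>+\<omega>. ennreal (d (Suc m + k') \<omega>) \<partial>M) \<le> ennreal ((1 + C) * 2 powr (- (g - 1) / 2 * real (Suc m + k')))"
      by (simp add: h_def k_def)
  qed auto
  finally show ?thesis by (auto intro: add_mono)
qed

text \<open>First the grid is chosen fine enough for the tail, then \<open>\<tau>\<close> small for the number of grid points,
  and finally \<open>\<eta> = \<tau>\<^sup>2\<close>.\<close>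

lemma chaining_parameters:
  assumes "C \<ge> 0" "g > 1" "e > 0"
  obtains m :: nat and \<tau> \<eta> :: real where "\<tau> > 0" "\<eta> > 0"
    "ennreal (real (2 ^ m + 1) * (\<tau> + \<eta> / \<tau>)) + chaining_tail C g m \<le> ennreal e"
proof -
  have "\<forall>\<^sub>F m in sequentially. chaining_tail C g m < ennreal (e/2)"
    by (rule order_tendstoD(2)[OF chaining_tail_tendsto_0]) (use assms in auto)
  then obtain m where m: "chaining_tail C g m < ennreal (e/2)" by (auto simp: eventually_sequentially)
  define \<tau> where "\<tau> = e / (4 * real (2 ^ m + 1))"
  define \<eta> where "\<eta> = \<tau> * \<tau>"
  have tau: "\<tau> > 0" using assms by (simp add: \<tau>_def add_pos_pos)
  have "real (2 ^ m + 1) * (\<tau> + \<eta> / \<tau>) = real (2 ^ m + 1) * (2 * \<tau>)" using tau by (simp add: \<eta>_def)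
  also have "\<dots> = e / 2"
  proof -
    have "real (2 ^ m + 1) > 0" by (simp add: add_pos_pos)
    then show ?thesis unfolding \<tau>_def by (simp add: field_simps)
  qed
  finally have "ennreal (real (2 ^ m + 1) * (\<tau> + \<eta> / \<tau>)) + chaining_tail C g m \<le> ennreal (e/2) + ennreal (e/2)"
    using m by (intro add_mono) (auto simp: less_imp_le)
  also have "\<dots> = ennreal e" using assms by (simp add: ennreal_plus[symmetric] del: ennreal_plus)
  finally show thesis using tau by (intro that[of \<tau> \<eta> m]) (auto simp: \<eta>_def)
qed

text \<open>By continuity the supremum may be taken over rational times.\<close>

lemma measurable_path_supremum:
  fixes U :: "real \<Rightarrow> 'a \<Rightarrow> real"
  assumes meas: "\<And>t. t \<in> {0..1} \<Longrightarrow> U t \<in> borel_measurable M"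
    and cont: "\<And>\<omega>. \<omega> \<in> space M \<Longrightarrow> continuous_on {0..1} (\<lambda>t. U t \<omega>)"
  shows "(\<lambda>\<omega>. SUP t\<in>{0..1}. ennreal \<bar>U t \<omega>\<bar>) \<in> borel_measurable M"
proof -
  have eq: "sup01 (\<lambda>t. U t \<omega>) = (SUP t\<in>{0..1}\<inter>\<rat>. ennreal \<bar>U t \<omega>\<bar>)" if w: "\<omega> \<in> space M" for \<omega>
  proof (rule antisym)
    show "sup01 (\<lambda>t. U t \<omega>) \<le> (SUP t\<in>{0..1}\<inter>\<rat>. ennreal \<bar>U t \<omega>\<bar>)"
    proof (rule SUP_least)
      fix t :: real assume t: "t \<in> {0..1}"
      \<comment> \<open>a rational sequence in \<open>[0,1]\<close> that tends to \<open>t\<close>\<close>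
      define q where "q n = of_int \<lfloor>real (Suc n) * t\<rfloor> / real (Suc n)" for n
      have q: "q n \<in> {0..1} \<inter> \<rat>" for n
      proof -
        have "of_int \<lfloor>real (Suc n) * t\<rfloor> \<le> real (Suc n) * t" by linarith
        also have "\<dots> \<le> real (Suc n)" using t by (intro mult_left_le) auto
        finally have "q n \<le> 1" unfolding q_def by (subst divide_le_eq_1_pos) auto
        moreover have "0 \<le> real (Suc n) * t" using t by (intro mult_nonneg_nonneg) auto
        then have "q n \<ge> 0" unfolding q_def by (intro divide_nonneg_nonneg) auto
        moreover have "q n \<in> \<rat>" unfolding q_def by (intro Rats_divide Rats_of_int Rats_of_nat)
        ultimately show ?thesis by simp
      qed
      have "q \<longlonglongrightarrow> t"
      proof (rule LIM_zero_cancel, rule Lim_null_comparison)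
        show "\<forall>\<^sub>F n in sequentially. norm (q n - t) \<le> 1 / real (Suc n)"
        proof (rule always_eventually, rule allI)
          fix n
          have "q n - t = (of_int \<lfloor>real (Suc n) * t\<rfloor> - real (Suc n) * t) / real (Suc n)"
            unfolding q_def diff_divide_distrib by (subst nonzero_mult_div_cancel_left) auto
          moreover have "\<bar>of_int \<lfloor>real (Suc n) * t\<rfloor> - real (Suc n) * t\<bar> \<le> 1" by linarith
          ultimately show "norm (q n - t) \<le> 1 / real (Suc n)" by (simp add: divide_right_mono del: of_nat_Suc)
        qed
        show "(\<lambda>n. 1 / real (Suc n)) \<longlonglongrightarrow> 0" by (rule LIMSEQ_Suc[OF lim_1_over_n])
      qed
      then have "(\<lambda>n. U (q n) \<omega>) \<longlonglongrightarrow> U t \<omega>"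
        by (rule continuous_on_tendsto_compose[OF cont[OF w]]) (use t q in auto)
      then have "(\<lambda>n. ennreal \<bar>U (q n) \<omega>\<bar>) \<longlonglongrightarrow> ennreal \<bar>U t \<omega>\<bar>"
        by (intro tendsto_ennrealI tendsto_rabs)
      then show "ennreal \<bar>U t \<omega>\<bar> \<le> (SUP t\<in>{0..1}\<inter>\<rat>. ennreal \<bar>U t \<omega>\<bar>)"
        by (rule tendsto_upperbound) (intro always_eventually allI SUP_upper q, simp)
    qed
  qed (rule SUP_subset_mono, auto)
  have "(\<lambda>\<omega>. SUP t\<in>{0..1}\<inter>\<rat>. ennreal \<bar>U t \<omega>\<bar>) \<in> borel_measurable M"
  proof (rule borel_measurable_SUP)
    show "countable ({0..1} \<inter> \<rat> :: real set)" using countable_rat by (rule countable_subset[rotated]) auto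
    show "(\<lambda>\<omega>. ennreal \<bar>U t \<omega>\<bar>) \<in> borel_measurable M" if "t \<in> {0..1} \<inter> \<rat>" for t
    proof -
      have [measurable]: "U t \<in> borel_measurable M" using that by (intro meas) auto
      show ?thesis by measurable
    qed
  qed
  then show ?thesis by (rule measurable_cong[THEN iffD2, rotated]) (rule eq)
qed

section \<open>Integrals of step functions against a Gaussian random measure\<close>

text \<open>A list of pairs (height, set) need not be in normal form, so that linear operations on step
  functions are operations on lists, and the integral of a list is a function instead of an
  equivalence class.\<close>

definition step_fun :: "(real \<times> 'c set) list \<Rightarrow> 'c \<Rightarrow> real" where
  "step_fun l y = (\<Sum>(x, A)\<leftarrow>l. x * indicator A y)"

definition step_integral :: "('c set \<Rightarrow> 'b \<Rightarrow> real) \<Rightarrow> (real \<times> 'c set) list \<Rightarrow> 'b \<Rightarrow> real" where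
  "step_integral B l \<omega> = (\<Sum>(x, A)\<leftarrow>l. x * B A \<omega>)"

definition scale_steps :: "real \<Rightarrow> (real \<times> 'c set) list \<Rightarrow> (real \<times> 'c set) list" where
  "scale_steps a = map (\<lambda>(x, A). (a * x, A))"

lemma step_simps [simp]:
  "step_fun [] y = 0" "step_fun ((x, A) # l) y = x * indicator A y + step_fun l y"
  "step_fun (l @ l') y = step_fun l y + step_fun l' y"
  "step_integral B [] \<omega> = 0" "step_integral B ((x, A) # l) \<omega> = x * B A \<omega> + step_integral B l \<omega>"
  "step_integral B (l @ l') \<omega> = step_integral B l \<omega> + step_integral B l' \<omega>"
  by (simp_all add: step_fun_def step_integral_def)

lemma step_scale [simp]:
  "step_fun (scale_steps a l) y = a * step_fun l y"
  "step_integral B (scale_steps a l) \<omega> = a * step_integral B l \<omega>"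
  "snd ` set (scale_steps a l) = snd ` set l"
  by (induction l; auto simp: scale_steps_def algebra_simps image_image)+

locale gaussian_noise =
  fixes N :: "'b measure" and \<mu> :: "'c measure" and B :: "'c set \<Rightarrow> 'b \<Rightarrow> real"
  assumes noise: "gaussian_random_measure N \<mu> B"
begin

sublocale prob_space N
  using noise by (simp add: gaussian_random_measure_def)

lemma finite_setsI: "A \<in> sets \<mu> \<Longrightarrow> A \<subseteq> A' \<Longrightarrow> A' \<in> finite_sets \<mu> \<Longrightarrow> A \<in> finite_sets \<mu>"
  unfolding finite_sets_def by (auto intro: le_less_trans emeasure_mono)

lemma finite_setsD: "A \<in> finite_sets \<mu> \<Longrightarrow> A \<in> sets \<mu>" "A \<in> finite_sets \<mu> \<Longrightarrow> emeasure \<mu> A < \<infinity>"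
  by (auto simp: finite_sets_def)

lemma measurable_noise [measurable (raw)]: "A \<in> finite_sets \<mu> \<Longrightarrow> B A \<in> borel_measurable N"
  using noise by (auto simp: gaussian_random_measure_def centred_gaussian_def)

lemma noise_moments:
  assumes "A \<in> finite_sets \<mu>"
  shows noise_integrable: "integrable N (B A)"
    and noise_mean: "expectation (B A) = 0"
    and noise_square_integrable: "integrable N (\<lambda>\<omega>. (B A \<omega>)\<^sup>2)"
    and noise_variance: "expectation (\<lambda>\<omega>. (B A \<omega>)\<^sup>2) = measure \<mu> A"
proof -
  have "integrable N (B A) \<and> expectation (B A) = 0 \<and> integrable N (\<lambda>\<omega>. (B A \<omega>)\<^sup>2)
      \<and> expectation (\<lambda>\<omega>. (B A \<omega>)\<^sup>2) = measure \<mu> A"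
  proof (cases "measure \<mu> A = 0")
    case True
    have [measurable]: "B A \<in> borel_measurable N" using assms by (rule measurable_noise)
    have ae: "AE \<omega> in N. B A \<omega> = 0"
      using noise assms True by (auto simp: gaussian_random_measure_def centred_gaussian_def)
    have ae2: "AE \<omega> in N. (B A \<omega>)\<^sup>2 = 0" using ae by simp
    have "integrable N (B A) \<longleftrightarrow> integrable N (\<lambda>_. 0::real)"
      by (rule integrable_cong_AE[OF _ _ ae]) measurable
    moreover have "expectation (B A) = expectation (\<lambda>_. 0)"
      by (rule integral_cong_AE[OF _ _ ae]) measurable
    moreover have "integrable N (\<lambda>\<omega>. (B A \<omega>)\<^sup>2) \<longleftrightarrow> integrable N (\<lambda>_. 0::real)"
      by (rule integrable_cong_AE[OF _ _ ae2]) measurable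
    moreover have "expectation (\<lambda>\<omega>. (B A \<omega>)\<^sup>2) = expectation (\<lambda>_. 0)"
      by (rule integral_cong_AE[OF _ _ ae2]) measurable
    ultimately show ?thesis using True by simp
  next
    case False
    define s where "s = sqrt (measure \<mu> A)"
    have s: "s > 0" using False by (simp add: s_def less_le)
    have D: "distributed N lborel (B A) (\<lambda>x. ennreal (normal_density 0 s x))"
      using noise assms False by (auto simp: gaussian_random_measure_def centred_gaussian_def s_def)
    have k: "integrable N (\<lambda>\<omega>. (B A \<omega>) ^ k)" for k :: nat
      using integrable_normal_moment[OF s, of 0 k]
      by (subst distributed_integrable[OF D, symmetric]) auto
    have e: "expectation (\<lambda>\<omega>. (B A \<omega>) ^ k) = (\<integral>x. normal_density 0 s x * x ^ k \<partial>lborel)" for k :: nat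
      by (rule distributed_integral[OF D, symmetric]) auto
    show ?thesis
      using k[of 1] e[of 1] k[of 2] e[of 2] integral_normal_moment_nz_1[OF s, of 0]
        integral_normal_moment_even[OF s, of 0 1] s
      by (simp add: s_def power2_eq_square)
  qed
  then show "integrable N (B A)" "expectation (B A) = 0" "integrable N (\<lambda>\<omega>. (B A \<omega>)\<^sup>2)"
    "expectation (\<lambda>\<omega>. (B A \<omega>)\<^sup>2) = measure \<mu> A" by auto
qed

lemma noise_product_integrable:
  assumes "A \<in> finite_sets \<mu>" "A' \<in> finite_sets \<mu>"
  shows "integrable N (\<lambda>\<omega>. B A \<omega> * B A' \<omega>)"
proof (rule Bochner_Integration.integrable_bound)
  show "integrable N (\<lambda>\<omega>. (B A \<omega>)\<^sup>2 + (B A' \<omega>)\<^sup>2)"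
    using assms by (intro Bochner_Integration.integrable_add noise_square_integrable)
  show "AE \<omega> in N. norm (B A \<omega> * B A' \<omega>) \<le> norm ((B A \<omega>)\<^sup>2 + (B A' \<omega>)\<^sup>2)"
  proof (rule AE_I2)
    fix \<omega>
    have "2 * (\<bar>B A \<omega>\<bar> * \<bar>B A' \<omega>\<bar>) \<le> (B A \<omega>)\<^sup>2 + (B A' \<omega>)\<^sup>2"
      using sum_squares_bound[of "\<bar>B A \<omega>\<bar>" "\<bar>B A' \<omega>\<bar>"] by (simp add: mult.assoc)
    moreover have "0 \<le> \<bar>B A \<omega>\<bar> * \<bar>B A' \<omega>\<bar>" by simp
    ultimately show "norm (B A \<omega> * B A' \<omega>) \<le> norm ((B A \<omega>)\<^sup>2 + (B A' \<omega>)\<^sup>2)"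
      unfolding real_norm_def abs_mult by linarith
  qed
qed (use assms in measurable)

lemma noise_disjoint_uncorrelated:
  assumes A: "A \<in> finite_sets \<mu>" "A' \<in> finite_sets \<mu>" and "A \<inter> A' = {}"
  shows "expectation (\<lambda>\<omega>. B A \<omega> * B A' \<omega>) = 0"
proof -
  define F where "F i = (if i = (0::nat) then A else A')" for i
  have "disjoint_family_on F {..<2}" "F ` {..<2} \<subseteq> finite_sets \<mu>"
    using assms by (auto simp: disjoint_family_on_def F_def)
  then have "indep_vars (\<lambda>_. borel) (\<lambda>i. B (F i)) {..<2}"
    using noise by (auto simp: gaussian_random_measure_def)
  then have "expectation (\<lambda>\<omega>. \<Prod>i<2. B (F i) \<omega>) = (\<Prod>i<2. expectation (B (F i)))"
    by (intro indep_vars_lebesgue_integral) (auto simp: F_def intro: noise_integrable A)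
  then show ?thesis
    using noise_mean[OF A(1)] by (simp add: numeral_2_eq_2 F_def)
qed

lemma noise_empty: "AE \<omega> in N. B {} \<omega> = 0"
proof -
  have "{} \<in> finite_sets \<mu>" by (simp add: finite_sets_def)
  then show ?thesis
    using noise by (auto simp: gaussian_random_measure_def centred_gaussian_def)
qed

lemma noise_Un:
  assumes A: "A \<in> finite_sets \<mu>" "A' \<in> finite_sets \<mu>" and "A \<inter> A' = {}" "A \<union> A' \<in> finite_sets \<mu>"
  shows "AE \<omega> in N. B (A \<union> A') \<omega> = B A \<omega> + B A' \<omega>"
proof -
  define F where "F i = (if i = (0::nat) then A else if i = 1 then A' else {})" for i
  have un: "(\<Union>i. F i) = A \<union> A'"
  proof
    have "F 0 \<subseteq> (\<Union>i. F i)" "F 1 \<subseteq> (\<Union>i. F i)" by blast+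
    then show "A \<union> A' \<subseteq> (\<Union>i. F i)" by (simp add: F_def)
  qed (auto simp: F_def split: if_splits)
  have "{} \<in> finite_sets \<mu>" by (simp add: finite_sets_def)
  then have "disjoint_family F" "range F \<subseteq> finite_sets \<mu>"
    using assms by (auto simp: disjoint_family_on_def F_def)
  then have "AE \<omega> in N. (\<lambda>i. B (F i) \<omega>) sums B (\<Union>i. F i) \<omega>"
    using noise assms(4) un by (auto simp: gaussian_random_measure_def)
  with noise_empty show ?thesis
  proof eventually_elim
    case (elim \<omega>)
    have "(\<lambda>i. B (F i) \<omega>) sums (\<Sum>i<2. B (F i) \<omega>)"
    proof (rule sums_finite)
      show "B (F i) \<omega> = 0" if "i \<notin> {..<2}" for i
      proof -
        have "F i = {}" using that by (auto simp: F_def)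
        then show ?thesis using elim by simp
      qed
    qed simp
    then have "B (A \<union> A') \<omega> = (\<Sum>i<2. B (F i) \<omega>)" using elim(2) unfolding un by (rule sums_unique2[symmetric])
    also have "\<dots> = B A \<omega> + B A' \<omega>" by (simp add: numeral_2_eq_2 F_def)
    finally show ?case .
  qed
qed

text \<open>Splitting \<open>A\<close> and \<open>A'\<close> along their intersection reduces the covariance to variances and to
  products of independent centred variables.\<close>

lemma noise_covariance:
  assumes A: "A \<in> finite_sets \<mu>" "A' \<in> finite_sets \<mu>"
  shows "expectation (\<lambda>\<omega>. B A \<omega> * B A' \<omega>) = measure \<mu> (A \<inter> A')"
proof -
  have S: "A \<inter> A' \<in> finite_sets \<mu>" "A - A' \<in> finite_sets \<mu>" "A' - A \<in> finite_sets \<mu>"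
    using A finite_setsI[OF _ _ A(1)] finite_setsI[OF _ _ A(2)] finite_setsD(1)[OF A(1)] finite_setsD(1)[OF A(2)]
    by auto
  have "(A \<inter> A') \<union> (A - A') = A" "(A \<inter> A') \<union> (A' - A) = A'" by auto
  then have 1: "AE \<omega> in N. B A \<omega> = B (A \<inter> A') \<omega> + B (A - A') \<omega>"
    and 2: "AE \<omega> in N. B A' \<omega> = B (A \<inter> A') \<omega> + B (A' - A) \<omega>"
    using noise_Un[OF S(1,2)] noise_Un[OF S(1,3)] A by auto
  have "expectation (\<lambda>\<omega>. B A \<omega> * B A' \<omega>) = expectation (\<lambda>\<omega>. B (A \<inter> A') \<omega> * B (A \<inter> A') \<omega>
     + B (A \<inter> A') \<omega> * B (A' - A) \<omega> + B (A - A') \<omega> * B (A \<inter> A') \<omega> + B (A - A') \<omega> * B (A' - A) \<omega>)"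
  proof (rule integral_cong_AE)
    show "AE \<omega> in N. B A \<omega> * B A' \<omega> = B (A \<inter> A') \<omega> * B (A \<inter> A') \<omega>
     + B (A \<inter> A') \<omega> * B (A' - A) \<omega> + B (A - A') \<omega> * B (A \<inter> A') \<omega> + B (A - A') \<omega> * B (A' - A) \<omega>"
      using 1 2 by eventually_elim (simp add: algebra_simps)
  qed (use A S in measurable)
  also have "\<dots> = expectation (\<lambda>\<omega>. B (A \<inter> A') \<omega> * B (A \<inter> A') \<omega>)
     + expectation (\<lambda>\<omega>. B (A \<inter> A') \<omega> * B (A' - A) \<omega>) + expectation (\<lambda>\<omega>. B (A - A') \<omega> * B (A \<inter> A') \<omega>)
     + expectation (\<lambda>\<omega>. B (A - A') \<omega> * B (A' - A) \<omega>)"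
    using S by (simp add: noise_product_integrable)
  also have "\<dots> = measure \<mu> (A \<inter> A')"
  proof -
    have "expectation (\<lambda>\<omega>. B (A \<inter> A') \<omega> * B (A' - A) \<omega>) = 0" "expectation (\<lambda>\<omega>. B (A - A') \<omega> * B (A \<inter> A') \<omega>) = 0"
      "expectation (\<lambda>\<omega>. B (A - A') \<omega> * B (A' - A) \<omega>) = 0"
      by (rule noise_disjoint_uncorrelated; use S in auto)+
    then show ?thesis using noise_variance[OF S(1)] by (simp add: power2_eq_square)
  qed
  finally show ?thesis .
qed

definition steps :: "(real \<times> 'c set) list \<Rightarrow> bool" where
  "steps l \<longleftrightarrow> snd ` set l \<subseteq> finite_sets \<mu>"

lemma steps_simps [simp]:
  "steps []" "steps ((x, A) # l) \<longleftrightarrow> A \<in> finite_sets \<mu> \<and> steps l"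
  "steps (l @ l') \<longleftrightarrow> steps l \<and> steps l'" "steps (scale_steps a l) \<longleftrightarrow> steps l"
  by (auto simp: steps_def)

lemma measurable_step_fun [measurable]:
  "steps l \<Longrightarrow> step_fun l \<in> borel_measurable \<mu>"
proof (induction l)
  case (Cons p l)
  obtain x A where p: "p = (x, A)" by (cases p)
  have l: "steps l" and [measurable]: "A \<in> sets \<mu>" using Cons.prems p finite_setsD by auto
  note [measurable] = Cons.IH[OF l]
  have "(\<lambda>y. x * indicator A y + step_fun l y) \<in> borel_measurable \<mu>" by measurable
  then show ?case using p by simp
qed (simp add: step_fun_def[abs_def])

lemma measurable_step_integral [measurable]:
  "steps l \<Longrightarrow> step_integral B l \<in> borel_measurable N"
proof (induction l)
  case (Cons p l)
  obtain x A where p: "p = (x, A)" by (cases p)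
  have l: "steps l" and [measurable]: "B A \<in> borel_measurable N" using Cons.prems p measurable_noise by auto
  note [measurable] = Cons.IH[OF l]
  have "(\<lambda>y. x * B A y + step_integral B l y) \<in> borel_measurable N" by measurable
  then show ?case using p by simp
qed (simp add: step_integral_def[abs_def])

text \<open>Both sides are bilinear, and for single sets this is the covariance formula.\<close>

lemma step_inner_product:
  assumes "steps l" "steps l'"
  shows "integrable N (\<lambda>\<omega>. step_integral B l \<omega> * step_integral B l' \<omega>) \<and>
    integrable \<mu> (\<lambda>y. step_fun l y * step_fun l' y) \<and>
    expectation (\<lambda>\<omega>. step_integral B l \<omega> * step_integral B l' \<omega>) = (\<integral>y. step_fun l y * step_fun l' y \<partial>\<mu>)"
proof -
  have single: "integrable N (\<lambda>\<omega>. B A \<omega> * step_integral B l' \<omega>) \<and>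
    integrable \<mu> (\<lambda>y. indicator A y * step_fun l' y) \<and>
    expectation (\<lambda>\<omega>. B A \<omega> * step_integral B l' \<omega>) = (\<integral>y. indicator A y * step_fun l' y \<partial>\<mu>)"
    if A: "A \<in> finite_sets \<mu>" and "steps l'" for A l'
    using that(2)
  proof (induction l')
    case (Cons p l')
    obtain x A' where p: "p = (x, A')" by (cases p)
    have A': "A' \<in> finite_sets \<mu>" and l': "steps l'" using Cons.prems p by auto
    note IH = Cons.IH[OF l']
    have AA: "A \<inter> A' \<in> sets \<mu>" "emeasure \<mu> (A \<inter> A') < \<infinity>"
      using finite_setsD[OF finite_setsI[OF _ _ A, of "A \<inter> A'"]] finite_setsD(1)[OF A] finite_setsD(1)[OF A'] by auto
    have ind: "indicator A y * (indicator A' y :: real) = indicator (A \<inter> A') y" for y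
      by (auto split: split_indicator)
    have int: "integrable \<mu> (\<lambda>y. indicator A y * (indicator A' y :: real))"
      "(\<integral>y. indicator A y * (indicator A' y :: real) \<partial>\<mu>) = measure \<mu> (A \<inter> A')"
      unfolding ind using AA by (auto simp: less_top)
    have 1: "B A \<omega> * step_integral B (p # l') \<omega> = x * (B A \<omega> * B A' \<omega>) + B A \<omega> * step_integral B l' \<omega>" for \<omega>
      by (simp add: p algebra_simps)
    have 2: "indicator A y * step_fun (p # l') y = x * (indicator A y * indicator A' y) + indicator A y * step_fun l' y" for y
      by (simp add: p algebra_simps)
    show ?case
      unfolding 1 2 using IH int noise_product_integrable[OF A A'] noise_covariance[OF A A'] by simp
  qed simp
  show ?thesis
    using assms(1)
  proof (induction l)
    case (Cons p l)
    obtain x A where p: "p = (x, A)" by (cases p)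
    have A: "A \<in> finite_sets \<mu>" and l: "steps l" using Cons.prems p by auto
    note IH = Cons.IH[OF l] and S = single[OF A assms(2)]
    have 1: "step_integral B (p # l) \<omega> * step_integral B l' \<omega>
        = x * (B A \<omega> * step_integral B l' \<omega>) + step_integral B l \<omega> * step_integral B l' \<omega>" for \<omega>
      by (simp add: p algebra_simps)
    have 2: "step_fun (p # l) y * step_fun l' y
        = x * (indicator A y * step_fun l' y) + step_fun l y * step_fun l' y" for y
      by (simp add: p algebra_simps)
    show ?case unfolding 1 2 using IH S by simp
  qed simp
qed

lemma step_isometry:
  assumes "steps l"
  shows "mean_square N (\<lambda>\<omega>. step_integral B l \<omega>) = mean_square \<mu> (\<lambda>y. step_fun l y)"
  using step_inner_product[OF assms assms]
  by (simp add: nn_integral_eq_integral power2_eq_square)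

text \<open>The integral of a simple function is the one along its level sets.\<close>

lemma simple_as_steps:
  assumes "simple_L2 \<mu> s"
  obtains l where "steps l" "\<And>y. y \<in> space \<mu> \<Longrightarrow> step_fun l y = s y"
    "simple_stoch_integral \<mu> B s = step_integral B l"
proof -
  have sf: "simple_function \<mu> s" and fin: "emeasure \<mu> {y \<in> space \<mu>. s y \<noteq> 0} < \<infinity>"
    using assms by (auto simp: simple_L2_def)
  have "finite (s ` space \<mu> - {0})" using sf by (simp add: simple_function_def)
  then obtain xs where xs: "set xs = s ` space \<mu> - {0}" "distinct xs" using finite_distinct_list by blast
  define l where "l = map (\<lambda>c. (c, s -` {c} \<inter> space \<mu>)) xs"
  have [measurable]: "s \<in> borel_measurable \<mu>" using sf by (rule borel_measurable_simple_function)
  have nz: "{y \<in> space \<mu>. s y \<noteq> 0} \<in> finite_sets \<mu>" using fin by (simp add: finite_sets_def)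
  show thesis
  proof (rule that)
    have "s -` {c} \<inter> space \<mu> \<in> finite_sets \<mu>" if "c \<noteq> 0" for c
      by (rule finite_setsI[OF _ _ nz]) (use that sf in \<open>auto simp: simple_function_def\<close>)
    then show "steps l" using xs(1) by (auto simp: steps_def l_def)
    show "simple_stoch_integral \<mu> B s = step_integral B l"
      unfolding simple_stoch_integral_def step_integral_def l_def xs(1)[symmetric]
      by (simp add: fun_eq_iff sum.distinct_set_conv_list[OF xs(2)] comp_def)
    fix y assume y: "y \<in> space \<mu>"
    have "step_fun l y = (\<Sum>c\<in>set xs. c * indicator (s -` {c} \<inter> space \<mu>) y)"
      unfolding step_fun_def l_def by (simp add: sum.distinct_set_conv_list[OF xs(2)] comp_def)
    also have "\<dots> = (\<Sum>c\<in>set xs. if c = s y then c else 0)"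
      using y by (intro sum.cong) (auto split: split_indicator)
    also have "\<dots> = (if s y \<in> set xs then s y else 0)" by (rule sum.delta) simp
    also have "\<dots> = s y" using xs(1) y by auto
    finally show "step_fun l y = s y" .
  qed
qed

text \<open>The same notion as \<open>has_stoch_integral\<close>, but with arbitrary representations of the approximating
  step functions. This makes it obviously linear.\<close>

definition wiener_integral :: "('c \<Rightarrow> real) \<Rightarrow> ('b \<Rightarrow> real) \<Rightarrow> bool" where
  "wiener_integral f J \<longleftrightarrow> f \<in> borel_measurable \<mu> \<and> J \<in> borel_measurable N \<and>
     (\<exists>L. (\<forall>m. steps (L m)) \<and>
        (\<lambda>m. mean_square \<mu> (\<lambda>y. step_fun (L m) y - f y)) \<longlonglongrightarrow> 0 \<and>
        (\<lambda>m. mean_square N (\<lambda>\<omega>. step_integral B (L m) \<omega> - J \<omega>)) \<longlonglongrightarrow> 0)"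

lemma wiener_integral_stoch:
  assumes "has_stoch_integral N \<mu> B f J"
  shows "wiener_integral f J"
proof -
  obtain s where s: "\<And>m. simple_L2 \<mu> (s m)"
      "(\<lambda>m. mean_square \<mu> (\<lambda>y. s m y - f y)) \<longlonglongrightarrow> 0"
      "(\<lambda>m. mean_square N (\<lambda>\<omega>. simple_stoch_integral \<mu> B (s m) \<omega> - J \<omega>)) \<longlonglongrightarrow> 0"
    using assms unfolding has_stoch_integral_def by blast
  have "\<forall>m. \<exists>l. steps l \<and> (\<forall>y\<in>space \<mu>. step_fun l y = s m y) \<and> simple_stoch_integral \<mu> B (s m) = step_integral B l"
    using simple_as_steps[OF s(1)] by metis
  then obtain L where L: "\<And>m. steps (L m)" "\<And>m y. y \<in> space \<mu> \<Longrightarrow> step_fun (L m) y = s m y"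
      "\<And>m. simple_stoch_integral \<mu> B (s m) = step_integral B (L m)"
    by metis
  have "mean_square \<mu> (\<lambda>y. step_fun (L m) y - f y) = mean_square \<mu> (\<lambda>y. s m y - f y)" for m
    by (rule nn_integral_cong) (simp add: L(2))
  then show ?thesis
    using assms s L(1,3) unfolding wiener_integral_def has_stoch_integral_def
    by (auto intro!: exI[of _ L])
qed

lemma wiener_integral_step: "steps l \<Longrightarrow> wiener_integral (step_fun l) (step_integral B l)"
  unfolding wiener_integral_def by (auto intro!: exI[of _ "\<lambda>_. l"])

lemma wiener_integral_diff:
  assumes "wiener_integral f J" "wiener_integral g K"
  shows "wiener_integral (\<lambda>y. f y - g y) (\<lambda>\<omega>. J \<omega> - K \<omega>)"
proof -
  obtain L where L: "\<And>m. steps (L m)"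
        "(\<lambda>m. mean_square \<mu> (\<lambda>y. step_fun (L m) y - f y)) \<longlonglongrightarrow> 0"
        "(\<lambda>m. mean_square N (\<lambda>\<omega>. step_integral B (L m) \<omega> - J \<omega>)) \<longlonglongrightarrow> 0"
    and [measurable]: "f \<in> borel_measurable \<mu>" "J \<in> borel_measurable N"
    using assms(1) unfolding wiener_integral_def by auto
  obtain L' where L': "\<And>m. steps (L' m)"
        "(\<lambda>m. mean_square \<mu> (\<lambda>y. step_fun (L' m) y - g y)) \<longlonglongrightarrow> 0"
        "(\<lambda>m. mean_square N (\<lambda>\<omega>. step_integral B (L' m) \<omega> - K \<omega>)) \<longlonglongrightarrow> 0"
    and [measurable]: "g \<in> borel_measurable \<mu>" "K \<in> borel_measurable N"
    using assms(2) unfolding wiener_integral_def by auto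
  note [measurable] = measurable_step_fun[OF L(1)] measurable_step_fun[OF L'(1)]
    measurable_step_integral[OF L(1)] measurable_step_integral[OF L'(1)]
  have flip: "((a::real) - b)\<^sup>2 = (b - a)\<^sup>2" for a b by (rule power2_commute)
  show ?thesis
    unfolding wiener_integral_def
  proof (intro conjI exI[of _ "\<lambda>m. L m @ scale_steps (-1) (L' m)"] allI)
    show "(\<lambda>m. mean_square \<mu> (\<lambda>y. step_fun (L m @ scale_steps (- 1) (L' m)) y - (f y - g y))) \<longlonglongrightarrow> 0"
    proof (rule tendsto_0_squeeze_double[OF L(2) L'(2)])
      fix m
      show "mean_square \<mu> (\<lambda>y. step_fun (L m @ scale_steps (- 1) (L' m)) y - (f y - g y))
        \<le> 2 * mean_square \<mu> (\<lambda>y. step_fun (L m) y - f y) + 2 * mean_square \<mu> (\<lambda>y. step_fun (L' m) y - g y)"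
        unfolding flip[of "step_fun (L' m) _"] by (rule nn_integral_square_sum) auto
    qed
    show "(\<lambda>m. mean_square N (\<lambda>y. step_integral B (L m @ scale_steps (- 1) (L' m)) y - (J y - K y))) \<longlonglongrightarrow> 0"
    proof (rule tendsto_0_squeeze_double[OF L(3) L'(3)])
      fix m
      show "mean_square N (\<lambda>y. step_integral B (L m @ scale_steps (- 1) (L' m)) y - (J y - K y))
        \<le> 2 * mean_square N (\<lambda>y. step_integral B (L m) y - J y) + 2 * mean_square N (\<lambda>y. step_integral B (L' m) y - K y)"
        unfolding flip[of "step_integral B (L' m) _"] by (rule nn_integral_square_sum) auto
    qed
  qed (use L(1) L'(1) in auto)
qed

lemma wiener_integral_scale:
  assumes "wiener_integral f J"
  shows "wiener_integral (\<lambda>y. a * f y) (\<lambda>\<omega>. a * J \<omega>)"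
proof -
  obtain L where L: "\<And>m. steps (L m)"
        "(\<lambda>m. mean_square \<mu> (\<lambda>y. step_fun (L m) y - f y)) \<longlonglongrightarrow> 0"
        "(\<lambda>m. mean_square N (\<lambda>\<omega>. step_integral B (L m) \<omega> - J \<omega>)) \<longlonglongrightarrow> 0"
    and [measurable]: "f \<in> borel_measurable \<mu>" "J \<in> borel_measurable N"
    using assms unfolding wiener_integral_def by auto
  note [measurable] = measurable_step_fun[OF L(1)] measurable_step_integral[OF L(1)]
  have eq: "ennreal ((a * x - a * y)\<^sup>2) = ennreal (a\<^sup>2) * ennreal ((x - y)\<^sup>2)" for x y :: real
    by (simp add: ennreal_mult[symmetric] power_mult_distrib[symmetric] right_diff_distrib)
  have "(\<lambda>m. ennreal (a\<^sup>2) * mean_square \<mu> (\<lambda>y. step_fun (L m) y - f y)) \<longlonglongrightarrow> ennreal (a\<^sup>2) * 0"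
    "(\<lambda>m. ennreal (a\<^sup>2) * mean_square N (\<lambda>\<omega>. step_integral B (L m) \<omega> - J \<omega>)) \<longlonglongrightarrow> ennreal (a\<^sup>2) * 0"
    by (intro ennreal_tendsto_cmult L; simp)+
  then show ?thesis
    unfolding wiener_integral_def
    by (intro conjI exI[of _ "\<lambda>m. scale_steps a (L m)"] allI) (auto simp: eq nn_integral_cmult L(1))
qed

text \<open>The isometry, up to a constant. The factor \<open>4\<close> comes from passing to the limit with the
  elementary inequality \<open>(a+b)\<^sup>2 \<le> 2a\<^sup>2 + 2b\<^sup>2\<close> and is harmless in all estimates below.\<close>

lemma wiener_integral_bound:
  assumes "wiener_integral f J"
  shows "mean_square N J \<le> 4 * mean_square \<mu> f"
proof -
  obtain L where L: "\<And>m. steps (L m)"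
        "(\<lambda>m. mean_square \<mu> (\<lambda>y. step_fun (L m) y - f y)) \<longlonglongrightarrow> 0"
        "(\<lambda>m. mean_square N (\<lambda>\<omega>. step_integral B (L m) \<omega> - J \<omega>)) \<longlonglongrightarrow> 0"
    and [measurable]: "f \<in> borel_measurable \<mu>" "J \<in> borel_measurable N"
    using assms unfolding wiener_integral_def by auto
  note [measurable] = measurable_step_fun[OF L(1)] measurable_step_integral[OF L(1)]
  define p where "p m = mean_square \<mu> (\<lambda>y. step_fun (L m) y - f y)" for m
  define q where "q m = mean_square N (\<lambda>\<omega>. step_integral B (L m) \<omega> - J \<omega>)" for m
  define F where "F = mean_square \<mu> f"
  have "mean_square N J \<le> 2 * q m + 2 * (2 * p m + 2 * F)" for m
  proof -
    have "mean_square N J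
      \<le> 2 * mean_square N (\<lambda>\<omega>. J \<omega> - step_integral B (L m) \<omega>) + 2 * mean_square N (\<lambda>\<omega>. step_integral B (L m) \<omega>)"
      by (rule nn_integral_square_sum) auto
    also have "mean_square N (\<lambda>\<omega>. J \<omega> - step_integral B (L m) \<omega>) = q m"
      unfolding q_def by (simp add: power2_commute)
    also have "mean_square N (\<lambda>\<omega>. step_integral B (L m) \<omega>) = mean_square \<mu> (\<lambda>y. step_fun (L m) y)"
      by (rule step_isometry[OF L(1)])
    also have "\<dots> \<le> 2 * p m + 2 * F"
      unfolding p_def F_def by (rule nn_integral_square_sum) auto
    finally show ?thesis by (simp add: mult_left_mono add_left_mono)
  qed
  moreover have "(\<lambda>m. 2 * q m + 2 * (2 * p m + 2 * F)) \<longlonglongrightarrow> 2 * 0 + 2 * (2 * 0 + 2 * F)"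
    by (intro tendsto_add ennreal_tendsto_cmult tendsto_const L(2,3)[folded p_def q_def]) auto
  ultimately have "mean_square N J \<le> 2 * 0 + 2 * (2 * 0 + 2 * F)"
    by (intro tendsto_lowerbound[where F=sequentially and f="\<lambda>m. 2 * q m + 2 * (2 * p m + 2 * F)"]) auto
  also have "\<dots> = 4 * F" by (simp add: mult.assoc[symmetric])
  finally show ?thesis by (simp add: F_def)
qed

text \<open>The two ways to integrate a step function, along a given representation and along its level
  sets, agree almost surely by the isometry.\<close>

lemma simple_L2_step_fun:
  assumes "steps l"
  shows "simple_L2 \<mu> (step_fun l)"
    and "mean_square N (\<lambda>\<omega>. simple_stoch_integral \<mu> B (step_fun l) \<omega> - step_integral B l \<omega>) = 0"
proof -
  have "simple_function \<mu> (step_fun l) \<and> emeasure \<mu> {y \<in> space \<mu>. step_fun l y \<noteq> 0} < \<infinity>"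
    using assms
  proof (induction l)
    case (Cons p l)
    obtain x A where p: "p = (x, A)" by (cases p)
    have A: "A \<in> sets \<mu>" "emeasure \<mu> A < \<infinity>" and l: "steps l" using Cons.prems p finite_setsD by auto
    note [measurable] = measurable_step_fun[OF l] A(1)
    have "simple_function \<mu> (\<lambda>y. x * indicator A y + step_fun l y)"
      using Cons.IH[OF l] A by (intro simple_function_add simple_function_mult simple_function_const) auto
    moreover have "emeasure \<mu> {y \<in> space \<mu>. step_fun (p # l) y \<noteq> 0} < \<infinity>"
    proof -
      have "emeasure \<mu> {y \<in> space \<mu>. step_fun (p # l) y \<noteq> 0} \<le> emeasure \<mu> (A \<union> {y \<in> space \<mu>. step_fun l y \<noteq> 0})"
        by (intro emeasure_mono) (auto simp: p split: split_indicator_asm)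
      also have "\<dots> \<le> emeasure \<mu> A + emeasure \<mu> {y \<in> space \<mu>. step_fun l y \<noteq> 0}"
        by (rule emeasure_subadditive) auto
      also have "\<dots> < \<infinity>" using A Cons.IH[OF l] by simp
      finally show ?thesis .
    qed
    moreover have "step_fun (p # l) = (\<lambda>y. x * indicator A y + step_fun l y)" by (auto simp: p)
    ultimately show ?case by simp
  qed (simp add: step_fun_def[abs_def])
  then show s: "simple_L2 \<mu> (step_fun l)" by (simp add: simple_L2_def)
  obtain l' where l': "steps l'" "\<And>y. y \<in> space \<mu> \<Longrightarrow> step_fun l' y = step_fun l y"
    "simple_stoch_integral \<mu> B (step_fun l) = step_integral B l'"
    using simple_as_steps[OF s] by blast
  have "mean_square N (\<lambda>\<omega>. simple_stoch_integral \<mu> B (step_fun l) \<omega> - step_integral B l \<omega>)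
    = mean_square N (\<lambda>\<omega>. step_integral B (l' @ scale_steps (-1) l) \<omega>)"
    by (simp add: l'(3))
  also have "\<dots> = mean_square \<mu> (\<lambda>y. step_fun (l' @ scale_steps (-1) l) y)"
    by (rule step_isometry) (use l' assms in simp)
  also have "\<dots> = (\<integral>\<^sup>+y. 0 \<partial>\<mu>)" by (rule nn_integral_cong) (simp add: l'(2))
  finally show "mean_square N (\<lambda>\<omega>. simple_stoch_integral \<mu> B (step_fun l) \<omega> - step_integral B l \<omega>) = 0" by simp
qed

lemma has_stoch_integral_wiener:
  assumes "wiener_integral f J"
  shows "has_stoch_integral N \<mu> B f J"
proof -
  obtain L where L: "\<And>m. steps (L m)"
        "(\<lambda>m. mean_square \<mu> (\<lambda>y. step_fun (L m) y - f y)) \<longlonglongrightarrow> 0"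
        "(\<lambda>m. mean_square N (\<lambda>\<omega>. step_integral B (L m) \<omega> - J \<omega>)) \<longlonglongrightarrow> 0"
    and [measurable]: "f \<in> borel_measurable \<mu>" "J \<in> borel_measurable N"
    using assms unfolding wiener_integral_def by auto
  have [measurable]: "simple_stoch_integral \<mu> B (step_fun (L m)) \<in> borel_measurable N" for m
    by (rule simple_as_steps[OF simple_L2_step_fun(1)[OF L(1)[of m]]]) (simp add: measurable_step_integral)
  note [measurable] = measurable_step_fun[OF L(1)] measurable_step_integral[OF L(1)]
  show ?thesis
    unfolding has_stoch_integral_def
  proof (intro conjI exI[of _ "\<lambda>m. step_fun (L m)"] allI)
    show "(\<lambda>m. mean_square N (\<lambda>\<omega>. simple_stoch_integral \<mu> B (step_fun (L m)) \<omega> - J \<omega>)) \<longlonglongrightarrow> 0"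
    proof (rule tendsto_0_squeeze_double[OF tendsto_const L(3)])
      fix m
      have "mean_square N (\<lambda>\<omega>. simple_stoch_integral \<mu> B (step_fun (L m)) \<omega> - J \<omega>)
        \<le> 2 * mean_square N (\<lambda>\<omega>. simple_stoch_integral \<mu> B (step_fun (L m)) \<omega> - step_integral B (L m) \<omega>)
         + 2 * mean_square N (\<lambda>\<omega>. step_integral B (L m) \<omega> - J \<omega>)"
        by (rule nn_integral_square_sum) auto
      then show "mean_square N (\<lambda>\<omega>. simple_stoch_integral \<mu> B (step_fun (L m)) \<omega> - J \<omega>)
        \<le> 2 * 0 + 2 * mean_square N (\<lambda>\<omega>. step_integral B (L m) \<omega> - J \<omega>)"
        by (simp only: simple_L2_step_fun(2)[OF L(1)])
    qed
  qed (use L simple_L2_step_fun(1) in auto)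
qed

end

section \<open>A central limit theorem for disjoint blocks\<close>

locale iid_noise = prob_space M for M :: "'a measure" +
  fixes Z :: "int \<Rightarrow> 'a \<Rightarrow> real" and \<sigma> :: real
  assumes indep: "indep_vars (\<lambda>_. borel) Z UNIV"
    and identical: "\<And>j. distr M borel (Z j) = distr M borel (Z 0)"
    and square_integrable: "integrable M (\<lambda>\<omega>. (Z 0 \<omega>)\<^sup>2)"
    and mean_zero: "expectation (Z 0) = 0"
    and var: "variance (Z 0) = \<sigma>\<^sup>2"
begin

lemma measurable_Z [measurable]: "Z j \<in> borel_measurable M"
  using indep unfolding indep_vars_def2 by simp

lemma transfer_Z:
  assumes [measurable]: "f \<in> borel_measurable borel"
  shows "integrable M (\<lambda>\<omega>. f (Z j \<omega>)) \<longleftrightarrow> integrable M (\<lambda>\<omega>. f (Z 0 \<omega>))"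
    and "expectation (\<lambda>\<omega>. f (Z j \<omega>)) = expectation (\<lambda>\<omega>. f (Z 0 \<omega>) :: real)"
proof -
  have "integrable M (\<lambda>\<omega>. f (Z j \<omega>)) \<longleftrightarrow> integrable (distr M borel (Z j)) f" for j
    by (rule integrable_distr_eq[symmetric]) auto
  moreover have "expectation (\<lambda>\<omega>. f (Z j \<omega>)) = (\<integral>x. f x \<partial>distr M borel (Z j))" for j
    by (rule integral_distr[symmetric]) auto
  ultimately show "integrable M (\<lambda>\<omega>. f (Z j \<omega>)) \<longleftrightarrow> integrable M (\<lambda>\<omega>. f (Z 0 \<omega>))"
    "expectation (\<lambda>\<omega>. f (Z j \<omega>)) = expectation (\<lambda>\<omega>. f (Z 0 \<omega>))"
    by (metis identical)+
qed

lemma Z_moments: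
  "integrable M (Z j)" "expectation (Z j) = 0" "integrable M (\<lambda>\<omega>. (Z j \<omega>)\<^sup>2)" "expectation (\<lambda>\<omega>. (Z j \<omega>)\<^sup>2) = \<sigma>\<^sup>2"
proof -
  have "integrable M (Z 0)"
    by (rule square_integrable_imp_integrable[OF _ square_integrable]) simp
  then show "integrable M (Z j)" using transfer_Z(1)[where j=j and f="\<lambda>x. x"] by simp
  show "expectation (Z j) = 0" using transfer_Z(2)[where j=j and f="\<lambda>x. x"] mean_zero by simp
  show "integrable M (\<lambda>\<omega>. (Z j \<omega>)\<^sup>2)" using transfer_Z(1)[where j=j and f="\<lambda>x. x\<^sup>2"] square_integrable by simp
  show "expectation (\<lambda>\<omega>. (Z j \<omega>)\<^sup>2) = \<sigma>\<^sup>2" using transfer_Z(2)[where j=j and f="\<lambda>x. x\<^sup>2"] var mean_zero by simp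
qed

text \<open>The characteristic function of a sum over \<open>J\<close> is a power with exponent \<open>card J\<close>.\<close>

lemma distr_sum_eq:
  assumes "finite J" "finite J'" "card J = card J'"
  shows "distr M borel (\<lambda>\<omega>. \<Sum>j\<in>J. Z j \<omega>) = distr M borel (\<lambda>\<omega>. \<Sum>j\<in>J'. Z j \<omega>)"
proof (rule Levy_uniqueness)
  have "char (distr M borel (\<lambda>\<omega>. \<Sum>j\<in>J. Z j \<omega>)) t = char (distr M borel (Z 0)) t ^ card J" for J t
  proof -
    have "char (distr M borel (\<lambda>\<omega>. \<Sum>j\<in>J. Z j \<omega>)) t = (\<Prod>j\<in>J. char (distr M borel (Z j)) t)"
      by (rule char_distr_sum) (rule indep_vars_subset[OF indep], simp)
    also have "\<dots> = (\<Prod>j\<in>J. char (distr M borel (Z 0)) t)"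
      by (intro prod.cong refl) (metis identical)
    finally show ?thesis by simp
  qed
  then show "char (distr M borel (\<lambda>\<omega>. \<Sum>j\<in>J. Z j \<omega>)) = char (distr M borel (\<lambda>\<omega>. \<Sum>j\<in>J'. Z j \<omega>))"
    using assms by (simp add: fun_eq_iff)
qed auto

text \<open>The central limit theorem in almost sure form. The limit is stated through
  \<open>centred_gaussian\<close>, which for \<open>\<sigma> = 0\<close> covers the degenerate case where all variables vanish.\<close>

lemma skorohod_normalized_sums:
  obtains \<Omega> :: "real measure" and Y :: "nat \<Rightarrow> real \<Rightarrow> real" and Yl :: "real \<Rightarrow> real" where
    "prob_space \<Omega>" "\<And>k. Y k \<in> borel_measurable \<Omega>" "Yl \<in> borel_measurable \<Omega>"
    "\<And>\<omega>. \<omega> \<in> space \<Omega> \<Longrightarrow> (\<lambda>k. Y k \<omega>) \<longlonglongrightarrow> Yl \<omega>"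
    "\<And>k. distr \<Omega> borel (Y k) = distr M borel (\<lambda>\<omega>. (\<Sum>j<k. Z (int j) \<omega>) / sqrt (real k))"
    "\<And>w. w \<ge> 0 \<Longrightarrow> centred_gaussian \<Omega> (\<lambda>\<omega>. sqrt w * Yl \<omega>) (\<sigma>\<^sup>2 * w)"
proof (cases "\<sigma> = 0")
  case True
  have "AE \<omega> in M. Z j \<omega> = 0" for j
  proof -
    have "AE \<omega> in M. (Z j \<omega>)\<^sup>2 = 0"
      using integral_nonneg_eq_0_iff_AE[of M "\<lambda>\<omega>. (Z j \<omega>)\<^sup>2"] Z_moments(3,4)[of j] True by simp
    then show ?thesis by simp
  qed
  then have "AE \<omega> in M. \<forall>j. Z (int j) \<omega> = 0" by (simp add: AE_all_countable)
  then have ae: "AE \<omega> in M. (\<Sum>j<k. Z (int j) \<omega>) / sqrt (real k) = 0" for k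
    by (rule AE_mp) simp
  have "distr M borel (\<lambda>\<omega>. (\<Sum>j<k. Z (int j) \<omega>) / sqrt (real k)) = return borel 0" for k
  proof -
    have "distr M borel (\<lambda>\<omega>. (\<Sum>j<k. Z (int j) \<omega>) / sqrt (real k)) = distr M borel (\<lambda>_. 0)"
      by (rule distr_cong_AE) (use ae in auto)
    then show ?thesis by simp
  qed
  moreover have "prob_space (return borel (0::real))" by (rule prob_space_return) simp
  moreover have "distr (return borel (0::real)) borel (\<lambda>_. 0 :: real) = return borel 0"
    using \<open>prob_space (return borel (0::real))\<close> by (simp add: prob_space.distr_const)
  ultimately show thesis
    by (intro that[of "return borel 0" "\<lambda>_ _. 0" "\<lambda>_. 0"]) (auto simp: centred_gaussian_def True)
next
  case False
  define s where "s = \<bar>\<sigma>\<bar>"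
  have s: "s > 0" "s\<^sup>2 = \<sigma>\<^sup>2" using False by (auto simp: s_def)
  define S where "S k \<omega> = (\<Sum>j<k. Z (int j) \<omega>)" for k \<omega>
  have [measurable]: "S k \<in> borel_measurable M" for k unfolding S_def by measurable
  have ind: "indep_vars (\<lambda>_. borel) (\<lambda>j. Z (int j)) UNIV"
  proof -
    have "indep_vars (\<lambda>i. PiM {int i} (\<lambda>_. borel)) (\<lambda>i \<omega>. restrict (\<lambda>j. Z j \<omega>) {int i}) UNIV"
      by (rule indep_vars_restrict[OF indep]) (auto simp: disjoint_family_on_def)
    then have "indep_vars (\<lambda>_. borel) (\<lambda>i \<omega>. restrict (\<lambda>j. Z j \<omega>) {int i} (int i)) UNIV"
      by (rule indep_vars_compose2[where Y = "\<lambda>i x. x (int i)"]) measurable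
    then show ?thesis by simp
  qed
  have weak: "weak_conv_m (\<lambda>k. distr M borel (\<lambda>\<omega>. S k \<omega> / sqrt (real k * s\<^sup>2))) std_normal_distribution"
    unfolding S_def
    by (rule central_limit_theorem_zero_mean[where X = "\<lambda>j. Z (int j)" and \<mu> = "distr M borel (Z 0)"])
       (use ind Z_moments s identical in auto)
  have rd: "real_distribution (distr M borel (\<lambda>\<omega>. S k \<omega> / sqrt (real k * s\<^sup>2)))" for k
    by (rule real_distribution_distr) measurable
  obtain \<Omega> :: "real measure" and Y :: "nat \<Rightarrow> real \<Rightarrow> real" and Yl :: "real \<Rightarrow> real" where
    Om: "prob_space \<Omega>" and meas [measurable]: "\<And>k. Y k \<in> borel_measurable \<Omega>" "Yl \<in> measurable \<Omega> lborel"
    and dY: "\<And>k. distr \<Omega> borel (Y k) = distr M borel (\<lambda>\<omega>. S k \<omega> / sqrt (real k * s\<^sup>2))"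
    and dlim: "distr \<Omega> borel Yl = std_normal_distribution"
    and conv: "\<And>\<omega>. \<omega> \<in> space \<Omega> \<Longrightarrow> (\<lambda>k. Y k \<omega>) \<longlonglongrightarrow> Yl \<omega>"
    using Skorohod[OF rd real_dist_normal_dist weak] by metis
  interpret Om: prob_space \<Omega> by (rule Om)
  have [measurable]: "Yl \<in> borel_measurable \<Omega>" using meas(2) by simp
  show thesis
  proof (rule that[of \<Omega> "\<lambda>k \<omega>. s * Y k \<omega>" "\<lambda>\<omega>. s * Yl \<omega>", OF Om])
    show "(\<lambda>k. s * Y k \<omega>) \<longlonglongrightarrow> s * Yl \<omega>" if "\<omega> \<in> space \<Omega>" for \<omega>
      by (intro tendsto_mult tendsto_const conv that)
    show "distr \<Omega> borel (\<lambda>\<omega>. s * Y k \<omega>) = distr M borel (\<lambda>\<omega>. (\<Sum>j<k. Z (int j) \<omega>) / sqrt (real k))" for k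
    proof -
      have "distr \<Omega> borel (\<lambda>\<omega>. s * Y k \<omega>) = distr (distr \<Omega> borel (Y k)) borel (\<lambda>x. s * x)"
        by (subst distr_distr) (auto simp: comp_def)
      also have "\<dots> = distr M borel (\<lambda>\<omega>. s * (S k \<omega> / sqrt (real k * s\<^sup>2)))"
        unfolding dY by (subst distr_distr) (auto simp: comp_def)
      also have "(\<lambda>\<omega>. s * (S k \<omega> / sqrt (real k * s\<^sup>2))) = (\<lambda>\<omega>. S k \<omega> / sqrt (real k))"
        using s(1) by (simp add: real_sqrt_mult fun_eq_iff)
      finally show ?thesis unfolding S_def .
    qed
    show "centred_gaussian \<Omega> (\<lambda>\<omega>. sqrt w * (s * Yl \<omega>)) (\<sigma>\<^sup>2 * w)" if w: "w \<ge> 0" for w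
    proof (cases "w = 0")
      case False
      then have w': "w > 0" using w by simp
      have "distributed \<Omega> lborel Yl std_normal_density"
        unfolding distributed_def using dlim by (auto cong: distr_cong simp: distr_def)
      then have "distributed \<Omega> lborel (\<lambda>\<omega>. 0 + (sqrt w * s) * Yl \<omega>) (normal_density (0 + (sqrt w * s) * 0) (\<bar>sqrt w * s\<bar> * 1))"
        by (rule Om.normal_density_affine) (use w' s in auto)
      moreover have "\<bar>sqrt w * s\<bar> = sqrt (\<sigma>\<^sup>2 * w)"
        using s w' by (simp add: real_sqrt_mult abs_mult s_def)
      ultimately show ?thesis
        using w' s(1) \<open>\<sigma> \<noteq> 0\<close> by (simp add: centred_gaussian_def mult.assoc)
    qed (simp add: centred_gaussian_def)
  qed measurable
qed

end

lemma centred_gaussian_distr_unique: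
  assumes "prob_space M" "prob_space N" "centred_gaussian M X v" "centred_gaussian N Y v"
  shows "distr M borel X = distr N borel Y"
proof -
  interpret M: prob_space M by fact
  interpret N: prob_space N by fact
  have [measurable]: "X \<in> borel_measurable M" "Y \<in> borel_measurable N"
    using assms(3,4) by (simp_all add: centred_gaussian_def)
  show ?thesis
  proof (cases "v = 0")
    case True
    have "AE \<omega> in M. X \<omega> = 0" "AE \<omega> in N. Y \<omega> = 0" using assms(3,4) True by (simp_all add: centred_gaussian_def)
    then have "distr M borel X = distr M borel (\<lambda>_. 0)" "distr N borel Y = distr N borel (\<lambda>_. 0)"
      by (intro distr_cong_AE[OF refl refl]; simp)+
    then show ?thesis by (simp add: M.distr_const N.distr_const)
  next
    case False
    have "distr M lborel X = distr N lborel Y"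
      using assms(3,4) False by (simp add: centred_gaussian_def distributed_def)
    moreover have "distr M lborel X = distr M borel X" "distr N lborel Y = distr N borel Y"
      by (rule distr_cong; simp)+
    ultimately show ?thesis by simp
  qed
qed

lemma expectation_indep_eq:
  fixes X :: "'i \<Rightarrow> 'a \<Rightarrow> real" and Y :: "'i \<Rightarrow> 'b \<Rightarrow> real" and h :: "('i \<Rightarrow> real) \<Rightarrow> real"
  assumes M: "prob_space M" "prob_space.indep_vars M (\<lambda>_. borel) X I"
    and N: "prob_space N" "prob_space.indep_vars N (\<lambda>_. borel) Y I"
    and eq: "\<And>i. i \<in> I \<Longrightarrow> distr M borel (X i) = distr N borel (Y i)"
    and h: "h \<in> borel_measurable (PiM I (\<lambda>_. borel))"
  shows "(\<integral>\<omega>. h (\<lambda>i\<in>I. X i \<omega>) \<partial>M) = (\<integral>\<omega>. h (\<lambda>i\<in>I. Y i \<omega>) \<partial>N)"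
proof (cases "I = {}")
  case True
  then have "(\<lambda>i\<in>I. X i \<omega>) = (\<lambda>_. undefined)" "(\<lambda>i\<in>I. Y i \<omega>') = (\<lambda>_. undefined)" for \<omega> \<omega>'
    by (auto simp: fun_eq_iff)
  then show ?thesis
    using prob_space.prob_space[OF M(1)] prob_space.prob_space[OF N(1)] by simp
next
  case False
  interpret M: prob_space M by fact
  interpret N: prob_space N by fact
  have X: "X i \<in> borel_measurable M" if "i \<in> I" for i using M(2) that by (auto simp: M.indep_vars_def2)
  have Y: "Y i \<in> borel_measurable N" if "i \<in> I" for i using N(2) that by (auto simp: N.indep_vars_def2)
  have "distr M (\<Pi>\<^sub>M i\<in>I. borel) (\<lambda>x. \<lambda>i\<in>I. X i x) = (\<Pi>\<^sub>M i\<in>I. distr M borel (X i))"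
    using M.indep_vars_iff_distr_eq_PiM'[OF False X] M(2) by simp
  also have "\<dots> = (\<Pi>\<^sub>M i\<in>I. distr N borel (Y i))" by (intro PiM_cong refl eq)
  also have "\<dots> = distr N (\<Pi>\<^sub>M i\<in>I. borel) (\<lambda>x. \<lambda>i\<in>I. Y i x)"
    using N.indep_vars_iff_distr_eq_PiM'[OF False Y] N(2) by simp
  finally have d: "distr M (\<Pi>\<^sub>M i\<in>I. borel) (\<lambda>x. \<lambda>i\<in>I. X i x) = distr N (\<Pi>\<^sub>M i\<in>I. borel) (\<lambda>x. \<lambda>i\<in>I. Y i x)" .
  have "(\<integral>\<omega>. h (\<lambda>i\<in>I. X i \<omega>) \<partial>M) = (\<integral>x. h x \<partial>distr M (\<Pi>\<^sub>M i\<in>I. borel) (\<lambda>x. \<lambda>i\<in>I. X i x))"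
    by (rule integral_distr[OF measurable_restrict h, symmetric]) (rule X)
  also have "\<dots> = (\<integral>x. h x \<partial>distr N (\<Pi>\<^sub>M i\<in>I. borel) (\<lambda>x. \<lambda>i\<in>I. Y i x))" unfolding d ..
  also have "\<dots> = (\<integral>\<omega>. h (\<lambda>i\<in>I. Y i \<omega>) \<partial>N)"
    by (rule integral_distr[OF measurable_restrict h]) (rule Y)
  finally show ?thesis .
qed

lemma indep_vars_PiM_coordinates:
  fixes f :: "'i \<Rightarrow> 'b \<Rightarrow> real"
  assumes "prob_space \<Omega>" and f: "\<And>i. i \<in> I \<Longrightarrow> f i \<in> borel_measurable \<Omega>"
  shows "prob_space.indep_vars (PiM I (\<lambda>_. \<Omega>)) (\<lambda>_. borel) (\<lambda>i \<omega>. f i (\<omega> i)) I"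
    and "\<And>i. i \<in> I \<Longrightarrow> distr (PiM I (\<lambda>_. \<Omega>)) borel (\<lambda>\<omega>. f i (\<omega> i)) = distr \<Omega> borel (f i)"
proof -
  interpret P: prob_space "PiM I (\<lambda>_. \<Omega>)" by (rule prob_space_PiM) (rule assms(1))
  have comp: "distr (PiM I (\<lambda>_. \<Omega>)) \<Omega> (\<lambda>\<omega>. \<omega> i) = \<Omega>" if "i \<in> I" for i
    using distr_PiM_component[of I "\<lambda>_. \<Omega>" i] assms(1) that by simp
  show "P.indep_vars (\<lambda>_. borel) (\<lambda>i \<omega>. f i (\<omega> i)) I"
  proof (cases "I = {}")
    case True
    show ?thesis unfolding P.indep_vars_def P.indep_sets_def by (simp add: True)
  next
    case False
    have "distr (PiM I (\<lambda>_. \<Omega>)) (PiM I (\<lambda>_. \<Omega>)) (\<lambda>\<omega>. \<lambda>i\<in>I. \<omega> i) = distr (PiM I (\<lambda>_. \<Omega>)) (PiM I (\<lambda>_. \<Omega>)) (\<lambda>\<omega>. \<omega>)"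
      by (rule distr_cong) (auto simp: space_PiM PiE_def extensional_restrict)
    also have "\<dots> = PiM I (\<lambda>_. \<Omega>)" by (rule distr_id)
    also have "\<dots> = PiM I (\<lambda>i. distr (PiM I (\<lambda>_. \<Omega>)) \<Omega> (\<lambda>\<omega>. \<omega> i))"
      by (intro PiM_cong refl) (simp add: comp)
    finally have "P.indep_vars (\<lambda>_. \<Omega>) (\<lambda>i \<omega>. \<omega> i) I"
      using P.indep_vars_iff_distr_eq_PiM'[OF False, of "\<lambda>i \<omega>. \<omega> i" "\<lambda>_. \<Omega>"] by simp
    then show ?thesis by (rule P.indep_vars_compose2) (rule f)
  qed
  fix i assume i: "i \<in> I"
  have "distr (PiM I (\<lambda>_. \<Omega>)) borel (\<lambda>\<omega>. f i (\<omega> i)) = distr (distr (PiM I (\<lambda>_. \<Omega>)) \<Omega> (\<lambda>\<omega>. \<omega> i)) borel (f i)"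
    by (subst distr_distr) (use i f in \<open>auto simp: comp_def\<close>)
  then show "distr (PiM I (\<lambda>_. \<Omega>)) borel (\<lambda>\<omega>. f i (\<omega> i)) = distr \<Omega> borel (f i)" by (simp add: comp i)
qed

text \<open>By independence the joint law of the block sums is that of independent copies, on a product
  space, of the Skorohod versions of normalised sums. There convergence holds pointwise, and
  dominated convergence finishes the proof.\<close>

theorem (in iid_noise) joint_block_clt:
  fixes v :: "'i \<Rightarrow> 'v::real_normed_vector" and F :: "'v \<Rightarrow> real" and G :: "'i \<Rightarrow> 'b \<Rightarrow> real"
  assumes I: "finite I"
    and J: "\<And>n i. i \<in> I \<Longrightarrow> finite (J n i)" "\<And>n. disjoint_family_on (J n) I"
    and w: "\<And>i. i \<in> I \<Longrightarrow> (\<lambda>n. real (card (J n i)) / real n) \<longlonglongrightarrow> w i" "\<And>i. i \<in> I \<Longrightarrow> w i > 0"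
    and N: "prob_space N" "prob_space.indep_vars N (\<lambda>_. borel) G I"
      "\<And>i. i \<in> I \<Longrightarrow> centred_gaussian N (G i) (\<sigma>\<^sup>2 * w i)"
    and F: "continuous_on UNIV F" "\<And>x. \<bar>F x\<bar> \<le> c"
  shows "(\<lambda>n. \<integral>\<omega>. F (\<Sum>i\<in>I. ((\<Sum>j\<in>J n i. Z j \<omega>) / sqrt (real n)) *\<^sub>R v i) \<partial>M)
      \<longlonglongrightarrow> (\<integral>\<omega>. F (\<Sum>i\<in>I. G i \<omega> *\<^sub>R v i) \<partial>N)"
proof -
  obtain \<Omega> :: "real measure" and Y :: "nat \<Rightarrow> real \<Rightarrow> real" and Yl :: "real \<Rightarrow> real" where
    Om: "prob_space \<Omega>" and Y [measurable]: "\<And>k. Y k \<in> borel_measurable \<Omega>" "Yl \<in> borel_measurable \<Omega>"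
    and conv: "\<And>\<omega>. \<omega> \<in> space \<Omega> \<Longrightarrow> (\<lambda>k. Y k \<omega>) \<longlonglongrightarrow> Yl \<omega>"
    and dY: "\<And>k. distr \<Omega> borel (Y k) = distr M borel (\<lambda>\<omega>. (\<Sum>j<k. Z (int j) \<omega>) / sqrt (real k))"
    and gauss: "\<And>w. w \<ge> 0 \<Longrightarrow> centred_gaussian \<Omega> (\<lambda>\<omega>. sqrt w * Yl \<omega>) (\<sigma>\<^sup>2 * w)"
    using skorohod_normalized_sums by blast
  define P where "P = PiM I (\<lambda>_. \<Omega>)"
  interpret P: prob_space P unfolding P_def by (rule prob_space_PiM) (rule Om)
  define X where "X n i \<omega> = (\<Sum>j\<in>J n i. Z j \<omega>) / sqrt (real n)" for n i \<omega>
  define r where "r n i = sqrt (real (card (J n i)) / real n)" for n i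
  define X' where "X' n i \<omega> = r n i * Y (card (J n i)) \<omega>" for n i \<omega>
  define h where "h x = F (\<Sum>i\<in>I. x i *\<^sub>R v i)" for x :: "'i \<Rightarrow> real"
  have [measurable]: "F \<in> borel_measurable borel" by (rule borel_measurable_continuous_onI[OF F(1)])
  have h_meas [measurable]: "h \<in> borel_measurable (PiM I (\<lambda>_. borel))"
    unfolding h_def
    by (rule measurable_compose[OF borel_measurable_finite_combination[OF I]]) auto
  have X'_meas: "X' n i \<in> borel_measurable \<Omega>" for n i unfolding X'_def[abs_def] by measurable
  have Yl_meas: "(\<lambda>x. sqrt (w i) * Yl x) \<in> borel_measurable \<Omega>" for i by measurable
  have indX: "indep_vars (\<lambda>_. borel) (X n) I" for n
  proof -
    have "indep_vars (\<lambda>i. PiM (J n i) (\<lambda>_. borel)) (\<lambda>i \<omega>. restrict (\<lambda>j. Z j \<omega>) (J n i)) I"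
      by (rule indep_vars_restrict[OF indep _ J(2)]) simp
    then have "indep_vars (\<lambda>_. borel) (\<lambda>i \<omega>. (\<Sum>j\<in>J n i. restrict (\<lambda>j. Z j \<omega>) (J n i) j) / sqrt (real n)) I"
      by (rule indep_vars_compose2[where Y = "\<lambda>i x. (\<Sum>j\<in>J n i. x j) / sqrt (real n)"]) measurable
    then show ?thesis unfolding X_def by simp
  qed
  have dX: "distr M borel (X n i) = distr \<Omega> borel (X' n i)" if i: "i \<in> I" for n i
  proof -
    define k where "k = card (J n i)"
    have "distr M borel (X n i) = distr (distr M borel (\<lambda>\<omega>. \<Sum>j\<in>J n i. Z j \<omega>)) borel (\<lambda>x. x / sqrt (real n))"
      unfolding X_def by (subst distr_distr) (auto simp: comp_def)
    also have "distr M borel (\<lambda>\<omega>. \<Sum>j\<in>J n i. Z j \<omega>) = distr M borel (\<lambda>\<omega>. \<Sum>j\<in>int ` {..<k}. Z j \<omega>)"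
      by (rule distr_sum_eq) (use J(1)[OF i] in \<open>auto simp: k_def card_image\<close>)
    also have "distr \<dots> borel (\<lambda>x. x / sqrt (real n)) = distr M borel (\<lambda>\<omega>. (\<Sum>j<k. Z (int j) \<omega>) / sqrt (real n))"
      by (subst distr_distr) (auto simp: comp_def sum.reindex)
    also have "(\<lambda>\<omega>. (\<Sum>j<k. Z (int j) \<omega>) / sqrt (real n)) = (\<lambda>\<omega>. r n i * ((\<Sum>j<k. Z (int j) \<omega>) / sqrt (real k)))"
      by (cases "k = 0") (auto simp: r_def k_def[symmetric] real_sqrt_divide fun_eq_iff)
    also have "distr M borel (\<lambda>\<omega>. r n i * ((\<Sum>j<k. Z (int j) \<omega>) / sqrt (real k)))
       = distr (distr M borel (\<lambda>\<omega>. (\<Sum>j<k. Z (int j) \<omega>) / sqrt (real k))) borel (\<lambda>x. r n i * x)"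
      by (subst distr_distr) (auto simp: comp_def)
    also have "\<dots> = distr \<Omega> borel (X' n i)"
      unfolding dY[symmetric] by (subst distr_distr) (auto simp: comp_def X'_def[abs_def] k_def)
    finally show ?thesis .
  qed
  have h_restrict: "h (restrict x I) = h x" for x
    unfolding h_def by (intro arg_cong[where f=F] sum.cong) auto
  have eqn: "(\<integral>\<omega>. h (\<lambda>i. X n i \<omega>) \<partial>M) = (\<integral>\<omega>. h (\<lambda>i. X' n i (\<omega> i)) \<partial>P)" for n
  proof -
    have "(\<integral>\<omega>. h (\<lambda>i\<in>I. X n i \<omega>) \<partial>M) = (\<integral>\<omega>. h (\<lambda>i\<in>I. X' n i (\<omega> i)) \<partial>P)"
    proof (rule expectation_indep_eq[OF prob_space_axioms indX P.prob_space_axioms])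
      show "P.indep_vars (\<lambda>_. borel) (\<lambda>i \<omega>. X' n i (\<omega> i)) I"
        unfolding P_def by (rule indep_vars_PiM_coordinates(1)[OF Om]) (rule X'_meas)
      show "distr M borel (X n i) = distr P borel (\<lambda>\<omega>. X' n i (\<omega> i))" if "i \<in> I" for i
        unfolding P_def using indep_vars_PiM_coordinates(2)[where f = "X' n", OF Om X'_meas that] dX[OF that] by simp
    qed (rule h_meas)
    then show ?thesis by (simp add: h_restrict)
  qed
  have eqlim: "(\<integral>\<omega>. h (\<lambda>i. G i \<omega>) \<partial>N) = (\<integral>\<omega>. h (\<lambda>i. sqrt (w i) * Yl (\<omega> i)) \<partial>P)"
  proof -
    have "(\<integral>\<omega>. h (\<lambda>i\<in>I. G i \<omega>) \<partial>N) = (\<integral>\<omega>. h (\<lambda>i\<in>I. sqrt (w i) * Yl (\<omega> i)) \<partial>P)"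
    proof (rule expectation_indep_eq[OF N(1,2) P.prob_space_axioms])
      show "P.indep_vars (\<lambda>_. borel) (\<lambda>i \<omega>. sqrt (w i) * Yl (\<omega> i)) I"
        unfolding P_def by (rule indep_vars_PiM_coordinates(1)[OF Om, where f="\<lambda>i x. sqrt (w i) * Yl x"]) measurable
      show "distr N borel (G i) = distr P borel (\<lambda>\<omega>. sqrt (w i) * Yl (\<omega> i))" if i: "i \<in> I" for i
      proof -
        have "distr N borel (G i) = distr \<Omega> borel (\<lambda>x. sqrt (w i) * Yl x)"
          by (rule centred_gaussian_distr_unique[OF N(1) Om N(3)[OF i] gauss]) (use w(2)[OF i] in simp)
        then show ?thesis
          unfolding P_def
          using indep_vars_PiM_coordinates(2)[where f="\<lambda>i x. sqrt (w i) * Yl x", OF Om Yl_meas i] by simp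
      qed
    qed (rule h_meas)
    then show ?thesis by (simp add: h_restrict)
  qed
  have "(\<lambda>n. \<integral>\<omega>. h (\<lambda>i. X' n i (\<omega> i)) \<partial>P) \<longlonglongrightarrow> (\<integral>\<omega>. h (\<lambda>i. sqrt (w i) * Yl (\<omega> i)) \<partial>P)"
  proof (rule integral_dominated_convergence[where w = "\<lambda>_. c"])
    have coord [measurable]: "(\<lambda>\<omega>. \<omega> i) \<in> measurable P \<Omega>" if "i \<in> I" for i
      unfolding P_def using that by measurable
    show "(\<lambda>\<omega>. h (\<lambda>i. X' n i (\<omega> i))) \<in> borel_measurable P" for n
      unfolding h_def X'_def
      by (rule measurable_compose[OF borel_measurable_finite_combination[OF I]]) auto
    show "(\<lambda>\<omega>. h (\<lambda>i. sqrt (w i) * Yl (\<omega> i))) \<in> borel_measurable P"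
      unfolding h_def
      by (rule measurable_compose[OF borel_measurable_finite_combination[OF I]]) auto
    show "AE \<omega> in P. (\<lambda>n. h (\<lambda>i. X' n i (\<omega> i))) \<longlonglongrightarrow> h (\<lambda>i. sqrt (w i) * Yl (\<omega> i))"
    proof (rule AE_I2)
      fix \<omega> assume om: "\<omega> \<in> space P"
      have "(\<lambda>n. X' n i (\<omega> i)) \<longlonglongrightarrow> sqrt (w i) * Yl (\<omega> i)" if i: "i \<in> I" for i
      proof -
        have "filterlim (\<lambda>n. real (card (J n i)) / real n * real n) at_top sequentially"
          by (rule filterlim_tendsto_pos_mult_at_top[OF w(1)[OF i] w(2)[OF i] filterlim_real_sequentially])
        then have "filterlim (\<lambda>n. real (card (J n i))) at_top sequentially"
          by (rule filterlim_mono_eventually[OF _ order_refl order_refl])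
             (use eventually_gt_at_top[of 0] in eventually_elim, simp)
        then have "filterlim (\<lambda>n. card (J n i)) at_top sequentially"
          by (simp only: filterlim_sequentially_iff_filterlim_real)
        moreover have "\<omega> i \<in> space \<Omega>" using om i by (auto simp: P_def space_PiM)
        ultimately have "(\<lambda>n. Y (card (J n i)) (\<omega> i)) \<longlonglongrightarrow> Yl (\<omega> i)"
          using filterlim_compose[OF conv] by blast
        moreover have "(\<lambda>n. r n i) \<longlonglongrightarrow> sqrt (w i)"
          unfolding r_def by (intro tendsto_real_sqrt w i)
        ultimately show ?thesis unfolding X'_def by (intro tendsto_mult)
      qed
      then have "(\<lambda>n. \<Sum>i\<in>I. X' n i (\<omega> i) *\<^sub>R v i) \<longlonglongrightarrow> (\<Sum>i\<in>I. (sqrt (w i) * Yl (\<omega> i)) *\<^sub>R v i)"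
        by (intro tendsto_sum tendsto_scaleR tendsto_const)
      then show "(\<lambda>n. h (\<lambda>i. X' n i (\<omega> i))) \<longlonglongrightarrow> h (\<lambda>i. sqrt (w i) * Yl (\<omega> i))"
        unfolding h_def using F(1) by (intro continuous_on_tendsto_compose[OF F(1)]) auto
    qed
    show "AE \<omega> in P. norm (h (\<lambda>i. X' n i (\<omega> i))) \<le> c" for n
      using F(2) by (simp add: h_def)
  qed auto
  then have "(\<lambda>n. \<integral>\<omega>. h (\<lambda>i. X n i \<omega>) \<partial>M) \<longlonglongrightarrow> (\<integral>\<omega>. h (\<lambda>i. G i \<omega>) \<partial>N)"
    unfolding eqn eqlim .
  then show ?thesis unfolding h_def X_def .
qed

section \<open>Second moments of moving averages\<close>

context iid_noise
begin

lemma Z_uncorrelated: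
  shows "integrable M (\<lambda>\<omega>. Z i \<omega> * Z j \<omega>)"
    and "expectation (\<lambda>\<omega>. Z i \<omega> * Z j \<omega>) = (if i = j then \<sigma>\<^sup>2 else 0)"
proof -
  have "integrable M (\<lambda>\<omega>. Z i \<omega> * Z j \<omega>) \<and> expectation (\<lambda>\<omega>. Z i \<omega> * Z j \<omega>) = (if i = j then \<sigma>\<^sup>2 else 0)"
  proof (cases "i = j")
    case True
    then show ?thesis using Z_moments(3,4)[of j] by (simp add: power2_eq_square)
  next
    case False
    have "indep_vars (\<lambda>_. borel) Z {i, j}" by (rule indep_vars_subset[OF indep]) simp
    then show ?thesis
      using indep_vars_lebesgue_integral[of "{i, j}" Z] indep_vars_integrable[of "{i, j}" Z] Z_moments(1,2) False
      by simp
  qed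
  then show "integrable M (\<lambda>\<omega>. Z i \<omega> * Z j \<omega>)"
    "expectation (\<lambda>\<omega>. Z i \<omega> * Z j \<omega>) = (if i = j then \<sigma>\<^sup>2 else 0)" by auto
qed

lemma second_moment_linear_combination:
  assumes "finite A"
  shows "mean_square M (\<lambda>\<omega>. \<Sum>i\<in>A. e i * Z i \<omega>) = ennreal (\<sigma>\<^sup>2 * (\<Sum>i\<in>A. (e i)\<^sup>2))"
proof -
  have eq: "(\<Sum>i\<in>A. e i * Z i \<omega>)\<^sup>2 = (\<Sum>i\<in>A. \<Sum>j\<in>A. e i * e j * (Z i \<omega> * Z j \<omega>))" for \<omega>
    by (simp add: power2_eq_square sum_product algebra_simps)
  have int: "integrable M (\<lambda>\<omega>. (\<Sum>i\<in>A. e i * Z i \<omega>)\<^sup>2)"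
    unfolding eq by (intro Bochner_Integration.integrable_sum integrable_mult_right Z_uncorrelated)
  have "expectation (\<lambda>\<omega>. (\<Sum>i\<in>A. e i * Z i \<omega>)\<^sup>2) = (\<Sum>i\<in>A. \<Sum>j\<in>A. e i * e j * (if i = j then \<sigma>\<^sup>2 else 0))"
    unfolding eq
    by (subst Bochner_Integration.integral_sum, intro Bochner_Integration.integrable_sum integrable_mult_right Z_uncorrelated)
       (intro sum.cong refl, subst Bochner_Integration.integral_sum, intro integrable_mult_right Z_uncorrelated,
         simp add: Z_uncorrelated)
  also have "\<dots> = (\<Sum>i\<in>A. e i * e i * \<sigma>\<^sup>2)"
  proof (intro sum.cong refl)
    fix i assume i: "i \<in> A"
    have "(\<Sum>j\<in>A. e i * e j * (if i = j then \<sigma>\<^sup>2 else 0)) = (\<Sum>j\<in>A. if i = j then e i * e j * \<sigma>\<^sup>2 else 0)"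
      by (intro sum.cong) auto
    also have "\<dots> = e i * e i * \<sigma>\<^sup>2" using i assms by simp
    finally show "(\<Sum>j\<in>A. e i * e j * (if i = j then \<sigma>\<^sup>2 else 0)) = e i * e i * \<sigma>\<^sup>2" .
  qed
  also have "\<dots> = \<sigma>\<^sup>2 * (\<Sum>i\<in>A. (e i)\<^sup>2)"
    by (simp add: sum_distrib_left power2_eq_square algebra_simps)
  finally show ?thesis using int by (simp add: nn_integral_eq_integral)
qed

text \<open>The series converges absolutely almost surely, since \<open>\<Sum>\<^sub>j |b\<^sub>j| E|Z\<^bsub>k-j\<^esub>|\<close> is finite.\<close>

lemma AE_summable_moving_average:
  assumes b: "summable (\<lambda>j. \<bar>b j\<bar>)"
  shows "AE \<omega> in M. \<forall>k. summable (\<lambda>j. b j * Z (k - int j) \<omega>)"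
proof -
  have "AE \<omega> in M. summable (\<lambda>j. b j * Z (k - int j) \<omega>)" for k
  proof -
    have E: "(\<integral>\<^sup>+\<omega>. ennreal \<bar>Z i \<omega>\<bar> \<partial>M) = ennreal (expectation (\<lambda>\<omega>. \<bar>Z 0 \<omega>\<bar>))" for i
      using transfer_Z(2)[where f = abs and j = i] Z_moments(1)[of i]
      by (subst nn_integral_eq_integral) auto
    have "(\<integral>\<^sup>+\<omega>. (\<Sum>j. ennreal \<bar>b j * Z (k - int j) \<omega>\<bar>) \<partial>M) = (\<Sum>j. \<integral>\<^sup>+\<omega>. ennreal \<bar>b j\<bar> * ennreal \<bar>Z (k - int j) \<omega>\<bar> \<partial>M)"
      by (subst nn_integral_suminf) (auto simp: abs_mult ennreal_mult)
    also have "\<dots> = (\<Sum>j. ennreal (\<bar>b j\<bar> * expectation (\<lambda>\<omega>. \<bar>Z 0 \<omega>\<bar>)))"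
      by (intro arg_cong[where f=suminf] ext, subst nn_integral_cmult) (auto simp: E ennreal_mult)
    also have "\<dots> = ennreal (\<Sum>j. \<bar>b j\<bar> * expectation (\<lambda>\<omega>. \<bar>Z 0 \<omega>\<bar>))"
      by (intro suminf_ennreal2 summable_mult2 b) (auto intro!: mult_nonneg_nonneg)
    finally have "AE \<omega> in M. (\<Sum>j. ennreal \<bar>b j * Z (k - int j) \<omega>\<bar>) \<noteq> \<infinity>"
      by (intro nn_integral_PInf_AE) auto
    then show ?thesis
      by eventually_elim (rule summable_rabs_cancel, rule summable_suminf_not_top, auto)
  qed
  moreover have "countable (UNIV :: int set)" by simp
  ultimately show ?thesis by (simp add: AE_all_countable)
qed

text \<open>A finite combination of moving averages is formally \<open>\<Sum>\<^sub>i c\<^sub>i Z\<^sub>i\<close>. The partial sums over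
  \<open>|i| \<le> J\<close> have the second moment of finitely many uncorrelated variables, and they converge almost
  surely, because for each \<open>k\<close> they are partial sums of the series that defines the moving average.
  Fatou's lemma concludes.\<close>

lemma moving_average_second_moment:
  fixes b :: "nat \<Rightarrow> real" and w e :: "int \<Rightarrow> real" and K A :: "int set"
  defines "c \<equiv> \<lambda>i. (\<Sum>k\<in>K. w k * (if k - i < 0 then 0 else b (nat (k - i))))"
  assumes b: "summable (\<lambda>j. \<bar>b j\<bar>)" and K: "finite K" and A: "finite A" "\<And>i. i \<notin> A \<Longrightarrow> e i = 0"
    and R: "\<And>F. finite F \<Longrightarrow> ennreal (\<sigma>\<^sup>2 * (\<Sum>i\<in>F. (c i - e i)\<^sup>2)) \<le> R"
  shows "mean_square M (\<lambda>\<omega>. (\<Sum>k\<in>K. w k * (\<Sum>j. b j * Z (k - int j) \<omega>)) - (\<Sum>i\<in>A. e i * Z i \<omega>)) \<le> R"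
proof -
  define Fs where "Fs J = {- int J..int J}" for J
  define S where "S J \<omega> = (\<Sum>i\<in>Fs J. (c i - e i) * Z i \<omega>)" for J \<omega>
  define T where "T \<omega> = (\<Sum>k\<in>K. w k * (\<Sum>j. b j * Z (k - int j) \<omega>)) - (\<Sum>i\<in>A. e i * Z i \<omega>)" for \<omega>
  have [measurable]: "S J \<in> borel_measurable M" for J unfolding S_def by measurable
  have "AE \<omega> in M. (\<lambda>J. S J \<omega>) \<longlonglongrightarrow> T \<omega>"
    using AE_summable_moving_average[OF b]
  proof eventually_elim
    case (elim \<omega>)
    have X: "(\<lambda>J. \<Sum>i\<in>Fs J. (if k - i < 0 then 0 else b (nat (k - i))) * Z i \<omega>) \<longlonglongrightarrow> (\<Sum>j. b j * Z (k - int j) \<omega>)" for k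
    proof (rule Lim_transform_eventually)
      have "(\<lambda>N. \<Sum>j<N. b j * Z (k - int j) \<omega>) \<longlonglongrightarrow> (\<Sum>j. b j * Z (k - int j) \<omega>)"
        using elim by (intro summable_LIMSEQ) auto
      moreover have "filterlim (\<lambda>J. nat (k + int J + 1)) at_top sequentially"
        unfolding filterlim_at_top
      proof
        fix Z show "\<forall>\<^sub>F J in sequentially. Z \<le> nat (k + int J + 1)"
          using eventually_ge_at_top[of "Z + nat \<bar>k\<bar>"] by eventually_elim linarith
      qed
      ultimately show "(\<lambda>J. \<Sum>j<nat (k + int J + 1). b j * Z (k - int j) \<omega>) \<longlonglongrightarrow> (\<Sum>j. b j * Z (k - int j) \<omega>)"
        by (rule filterlim_compose)
      show "\<forall>\<^sub>F J in sequentially. (\<Sum>j<nat (k + int J + 1). b j * Z (k - int j) \<omega>)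
          = (\<Sum>i\<in>Fs J. (if k - i < 0 then 0 else b (nat (k - i))) * Z i \<omega>)"
        using eventually_ge_at_top[of "nat \<bar>k\<bar>"]
      proof eventually_elim
        case (elim J)
        have "(\<Sum>i\<in>Fs J. (if k - i < 0 then 0 else b (nat (k - i))) * Z i \<omega>)
          = (\<Sum>i\<in>{- int J..k}. (if k - i < 0 then 0 else b (nat (k - i))) * Z i \<omega>)"
          by (rule sum.mono_neutral_right) (use elim in \<open>auto simp: Fs_def\<close>)
        also have "\<dots> = (\<Sum>j<nat (k + int J + 1). b j * Z (k - int j) \<omega>)"
          by (rule sum.reindex_bij_witness[where i = "\<lambda>j. k - int j" and j = "\<lambda>i. nat (k - i)"]) auto
        finally show ?case ..
      qed
    qed
    have "(\<lambda>J. (\<Sum>k\<in>K. w k * (\<Sum>i\<in>Fs J. (if k - i < 0 then 0 else b (nat (k - i))) * Z i \<omega>)) - (\<Sum>i\<in>A. e i * Z i \<omega>)) \<longlonglongrightarrow> T \<omega>"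
      unfolding T_def by (intro tendsto_diff tendsto_sum tendsto_mult tendsto_const X)
    moreover have "\<forall>\<^sub>F J in sequentially. (\<Sum>k\<in>K. w k * (\<Sum>i\<in>Fs J. (if k - i < 0 then 0 else b (nat (k - i))) * Z i \<omega>)) - (\<Sum>i\<in>A. e i * Z i \<omega>) = S J \<omega>"
    proof -
      \<comment> \<open>beyond \<open>m\<close> the window \<open>|i| \<le> J\<close> contains the support of \<open>e\<close>\<close>
      define m where "m = Max (insert 0 ((\<lambda>i. nat \<bar>i\<bar>) ` A))"
      have m: "nat \<bar>i\<bar> \<le> m" if "i \<in> A" for i unfolding m_def using that A(1) by (intro Max_ge) auto
      show ?thesis
        using eventually_ge_at_top[of m]
      proof eventually_elim
        case (elim J)
        have "A \<subseteq> Fs J"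
        proof
          fix i assume "i \<in> A"
          then show "i \<in> Fs J" using m[of i] elim unfolding Fs_def by auto
        qed
        then have "(\<Sum>i\<in>A. e i * Z i \<omega>) = (\<Sum>i\<in>Fs J. e i * Z i \<omega>)"
          using A by (intro sum.mono_neutral_left) (auto simp: Fs_def)
        moreover have "(\<Sum>k\<in>K. w k * (\<Sum>i\<in>Fs J. (if k - i < 0 then 0 else b (nat (k - i))) * Z i \<omega>))
          = (\<Sum>i\<in>Fs J. c i * Z i \<omega>)"
          unfolding c_def sum_distrib_left sum_distrib_right by (subst sum.swap) (simp add: mult.assoc)
        ultimately show ?case by (simp add: S_def sum_subtractf left_diff_distrib)
      qed
    qed
    ultimately show ?case by (rule Lim_transform_eventually)
  qed
  then have "AE \<omega> in M. ennreal ((T \<omega>)\<^sup>2) = liminf (\<lambda>J. ennreal ((S J \<omega>)\<^sup>2))"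
    by eventually_elim (intro lim_imp_Liminf[symmetric] tendsto_ennrealI tendsto_power, auto)
  then have "mean_square M T = (\<integral>\<^sup>+\<omega>. liminf (\<lambda>J. ennreal ((S J \<omega>)\<^sup>2)) \<partial>M)"
    by (rule nn_integral_cong_AE)
  also have "\<dots> \<le> liminf (\<lambda>J. \<integral>\<^sup>+\<omega>. ennreal ((S J \<omega>)\<^sup>2) \<partial>M)"
    by (rule nn_integral_liminf) measurable
  also have "\<dots> \<le> R"
  proof -
    have "mean_square M (\<lambda>\<omega>. S J \<omega>) \<le> R" for J
      unfolding S_def by (subst second_moment_linear_combination) (auto simp: Fs_def intro!: R)
    then show ?thesis by (intro Liminf_le) (auto simp: eventually_sequentially intro: always_eventually)
  qed
  finally show ?thesis unfolding T_def .
qed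

end

text \<open>The length of the part of the unit interval \<open>(k-1,k]\<close> that lies to the left of \<open>nt\<close>.\<close>

definition cell_weight :: "nat \<Rightarrow> int \<Rightarrow> real \<Rightarrow> real" where
  "cell_weight n k t = max 0 (min 1 (real n * t - (of_int k - 1)))"

text \<open>The interpolated partial sum up to time \<open>nt\<close> is the integral up to \<open>nt\<close> of the step function
  with value \<open>X\<^sub>k\<close> on \<open>(k-1,k]\<close>.\<close>

lemma artfima_sum_eq_weighted_sum:
  assumes t: "0 \<le> t" "t \<le> 1"
  shows "artfima_sum \<alpha> \<mu> Z (real n * t) \<omega> = (\<Sum>k\<in>{1..int n}. cell_weight n k t * artfima \<alpha> \<mu> Z k \<omega>)"
proof -
  define x where "x = real n * t"
  define m where "m = \<lfloor>x\<rfloor>"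
  have x: "0 \<le> x" "x \<le> real n" using t by (auto simp: x_def mult_left_le)
  have m: "0 \<le> m" "of_int m \<le> x" "x < of_int m + 1" using x by (auto simp: m_def)
  have mn: "m \<le> int n" using m(2) x(2) by linarith
  have w1: "cell_weight n k t = 1" if "k \<le> m" for k
    using that m(2) unfolding cell_weight_def x_def[symmetric] by linarith
  have w0: "cell_weight n k t = 0" if "k > m + 1" for k
    using that m(3) unfolding cell_weight_def x_def[symmetric] by linarith
  have wm: "cell_weight n (m + 1) t = x - of_int m"
    using m unfolding cell_weight_def x_def[symmetric] by simp
  show ?thesis
  proof (cases "m = int n")
    case True
    then have "x = of_int m" using m(2) x(2) by simp
    then show ?thesis
      unfolding artfima_sum_def x_def[symmetric] m_def[symmetric] using True w1
      by (auto intro!: sum.cong)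
  next
    case False
    have "(\<Sum>k\<in>{1..int n}. cell_weight n k t * artfima \<alpha> \<mu> Z k \<omega>)
      = (\<Sum>k\<in>insert (m + 1) {1..m}. cell_weight n k t * artfima \<alpha> \<mu> Z k \<omega>)"
      by (rule sum.mono_neutral_right) (use False mn m(1) w0 in auto)
    also have "\<dots> = (x - of_int m) * artfima \<alpha> \<mu> Z (m + 1) \<omega> + (\<Sum>k\<in>{1..m}. artfima \<alpha> \<mu> Z k \<omega>)"
      using w1 by (subst sum.insert) (auto simp: wm intro!: sum.cong)
    finally show ?thesis
      unfolding artfima_sum_def x_def[symmetric] m_def[symmetric] by simp
  qed
qed

lemma cell_eq: "n > 0 \<Longrightarrow> \<lceil>real n * y\<rceil> = i \<longleftrightarrow> y \<in> {(of_int i - 1) / real n <.. of_int i / real n}"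
  by (auto simp: ceiling_eq_iff field_simps)

lemma sum_cells_le:
  fixes f :: "int \<Rightarrow> real"
  assumes n: "n > 0" and F: "finite F" and f: "\<And>i. f i \<ge> 0"
  shows "ennreal ((\<Sum>i\<in>F. f i) / real n) \<le> (\<integral>\<^sup>+y. ennreal (f \<lceil>real n * y\<rceil>) \<partial>lborel)"
proof -
  define C where "C i = {(of_int i - 1) / real n <.. of_int i / real n}" for i :: int
  have C: "emeasure lborel (C i) = ennreal (1 / real n)" for i
    using n unfolding C_def by (subst emeasure_lborel_Ioc) (auto simp: field_simps intro!: arg_cong[where f=ennreal])
  have "ennreal ((\<Sum>i\<in>F. f i) / real n) = (\<Sum>i\<in>F. ennreal (f i) * ennreal (1 / real n))"
    using f by (simp add: sum_divide_distrib ennreal_mult[symmetric] sum_ennreal)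
  also have "\<dots> = (\<Sum>i\<in>F. \<integral>\<^sup>+y. ennreal (f i) * indicator (C i) y \<partial>lborel)"
    by (intro sum.cong refl, subst nn_integral_cmult_indicator) (auto simp: C, simp add: C_def)
  also have "\<dots> = (\<integral>\<^sup>+y. (\<Sum>i\<in>F. ennreal (f i) * indicator (C i) y) \<partial>lborel)"
    by (rule nn_integral_sum[symmetric]) (simp add: C_def)
  also have "\<dots> \<le> (\<integral>\<^sup>+y. ennreal (f \<lceil>real n * y\<rceil>) \<partial>lborel)"
  proof (rule nn_integral_mono)
    fix y
    have "(\<Sum>i\<in>F. ennreal (f i) * indicator (C i) y) = (\<Sum>i\<in>F. if i = \<lceil>real n * y\<rceil> then ennreal (f i) else 0)"
    proof (intro sum.cong refl)
      fix i
      have "y \<in> C i \<longleftrightarrow> i = \<lceil>real n * y\<rceil>" using cell_eq[OF n, of y i] unfolding C_def by auto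
      then show "ennreal (f i) * indicator (C i) y = (if i = \<lceil>real n * y\<rceil> then ennreal (f i) else 0)"
        by (simp add: indicator_def)
    qed
    also have "\<dots> \<le> ennreal (f \<lceil>real n * y\<rceil>)" using F by (simp add: sum.delta')
    finally show "(\<Sum>i\<in>F. ennreal (f i) * indicator (C i) y) \<le> ennreal (f \<lceil>real n * y\<rceil>)" .
  qed
  finally show ?thesis .
qed

lemma integral_cells:
  fixes f :: "int \<Rightarrow> real"
  assumes n: "n > 0" and t: "0 \<le> t" "t \<le> 1"
  shows "set_integrable lborel {0..t} (\<lambda>s. f \<lceil>real n * s\<rceil>)"
    and "(LINT s:{0..t}|lborel. f \<lceil>real n * s\<rceil>) = (\<Sum>k\<in>{1..int n}. f k * cell_weight n k t) / real n"
proof -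
  define C where "C k = {(of_int k - 1) / real n <.. min t (of_int k / real n)}" for k :: int
  have C_fin: "emeasure lborel (C k) < \<infinity>" for k
    unfolding C_def by (rule le_less_trans[OF emeasure_mono[of _ "{(of_int k - 1) / real n .. min t (of_int k / real n)}"]]) (auto simp: emeasure_lborel_Icc_eq)
  have C: "measure lborel (C k) = cell_weight n k t / real n" for k
  proof (cases "(of_int k - 1) / real n \<le> min t (of_int k / real n)")
    case True
    then have "real n * t - (of_int k - 1) \<ge> 0" using n by (simp add: field_simps)
    moreover have "min t (of_int k / real n) - (of_int k - 1) / real n = min 1 (real n * t - (of_int k - 1)) / real n"
      using n by (auto simp: min_def field_simps)
    ultimately show ?thesis
      using True by (simp add: C_def cell_weight_def)
  next
    case False
    then have "real n * t - (of_int k - 1) \<le> 0" using n by (auto simp: min_le_iff_disj field_simps not_le less_imp_le)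
    moreover have "C k = {}" using False by (auto simp: C_def)
    ultimately show ?thesis by (simp add: cell_weight_def)
  qed
  have ae: "AE s in lborel. indicator {0..t} s *\<^sub>R f \<lceil>real n * s\<rceil> = (\<Sum>k\<in>{1..int n}. f k * indicator (C k) s)"
    using AE_lborel_singleton[of 0]
  proof eventually_elim
    case (elim s)
    have "(\<Sum>k\<in>{1..int n}. f k * indicator (C k) s) = (\<Sum>k\<in>{1..int n}. if k = \<lceil>real n * s\<rceil> then indicator {..t} s * f k else 0)"
    proof (intro sum.cong refl)
      fix k
      have "s \<in> C k \<longleftrightarrow> k = \<lceil>real n * s\<rceil> \<and> s \<le> t" using cell_eq[OF n, of s k] unfolding C_def by auto
      then show "f k * indicator (C k) s = (if k = \<lceil>real n * s\<rceil> then indicator {..t} s * f k else 0)"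
        by (simp add: indicator_def)
    qed
    also have "\<dots> = (if \<lceil>real n * s\<rceil> \<in> {1..int n} then indicator {..t} s * f \<lceil>real n * s\<rceil> else 0)"
      by (simp add: sum.delta)
    also have "\<dots> = indicator {0..t} s *\<^sub>R f \<lceil>real n * s\<rceil>"
    proof (cases "0 \<le> s \<and> s \<le> t")
      case True
      then have "0 < real n * s" "real n * s \<le> real n" using elim n t by (auto simp: mult_left_le)
      then have "\<lceil>real n * s\<rceil> \<in> {1..int n}" by (auto simp: ceiling_le_iff)
      then show ?thesis using True by simp
    next
      case False
      then consider "s < 0" | "s > t" by linarith
      then show ?thesis
      proof cases
        case 1
        then have "real n * s \<le> 0" using n by (simp add: mult_le_0_iff)
        then have "\<lceil>real n * s\<rceil> \<le> 0" by simp
        then have "\<lceil>real n * s\<rceil> \<notin> {1..int n}" by auto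
        then show ?thesis unfolding if_not_P[OF \<open>\<lceil>real n * s\<rceil> \<notin> {1..int n}\<close>] using 1 by simp
      qed simp
    qed
    finally show ?case ..
  qed
  have int: "integrable lborel (\<lambda>s. \<Sum>k\<in>{1..int n}. f k * indicator (C k) s)"
    using C_fin by (intro Bochner_Integration.integrable_sum integrable_mult_right integrable_real_indicator) (auto simp: C_def)
  have [measurable]: "(\<lambda>s. f \<lceil>real n * s\<rceil>) \<in> borel_measurable lborel" by measurable
  have [measurable]: "C k \<in> sets borel" for k by (simp add: C_def)
  show "set_integrable lborel {0..t} (\<lambda>s. f \<lceil>real n * s\<rceil>)"
    unfolding set_integrable_def
    by (rule integrable_cong_AE[THEN iffD2, OF _ _ ae int]) measurable
  have "(LINT s:{0..t}|lborel. f \<lceil>real n * s\<rceil>) = (\<integral>s. (\<Sum>k\<in>{1..int n}. f k * indicator (C k) s) \<partial>lborel)"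
    unfolding set_lebesgue_integral_def by (rule integral_cong_AE[OF _ _ ae]) measurable
  also have "\<dots> = (\<Sum>k\<in>{1..int n}. f k * measure lborel (C k))"
    using C_fin by (subst Bochner_Integration.integral_sum)
      (auto intro!: integrable_mult_right integrable_real_indicator)
  finally show "(LINT s:{0..t}|lborel. f \<lceil>real n * s\<rceil>) = (\<Sum>k\<in>{1..int n}. f k * cell_weight n k t) / real n"
    by (simp add: C sum_divide_distrib)
qed

section \<open>Bounds for the rescaled coefficients\<close>

text \<open>The factor \<open>n\<^bsup>1-\<alpha>\<^esup>\<close> is the inverse of the order \<open>j\<^bsup>\<alpha>-1\<^esup>\<close> of the coefficients at \<open>j \<approx> n\<close>. Extending by
  zero to negative indices encodes causality.\<close>

definition scaled_coeff :: "real \<Rightarrow> real \<Rightarrow> nat \<Rightarrow> int \<Rightarrow> real" where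
  "scaled_coeff \<alpha> lam n j = (if j < 0 then 0 else
     real n powr (1 - \<alpha>) * artfima_coeff \<alpha> (nat j) * exp (- lam / real n * of_int j))"

text \<open>The coefficient of \<open>n\<^bsup>-1/2\<^esup> Z\<^sub>i\<close> in the rescaled partial sum process at time \<open>t\<close>.\<close>

definition lattice_kernel :: "real \<Rightarrow> real \<Rightarrow> nat \<Rightarrow> real \<Rightarrow> int \<Rightarrow> real" where
  "lattice_kernel \<alpha> lam n t i = (LINT s:{0..t}|lborel. scaled_coeff \<alpha> lam n (\<lceil>real n * s\<rceil> - i))"

text \<open>Any cutoff that is finite for each \<open>K\<close> and exceeds every multiple of \<open>K\<close> eventually would do in
  place of \<open>K\<^sup>2\<close>.\<close>

definition truncated_kernel :: "real \<Rightarrow> real \<Rightarrow> nat \<Rightarrow> real \<Rightarrow> int \<Rightarrow> real" where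
  "truncated_kernel \<alpha> lam K t i = (if \<bar>i\<bar> \<le> int (K * K) then lattice_kernel \<alpha> lam K t i else 0)"

text \<open>For \<open>\<theta> < 1\<close> this has the singularity of the tempered kernel at zero; with \<open>\<theta> = 1\<close> it is bounded.\<close>

definition majorant :: "real \<Rightarrow> real \<Rightarrow> real \<Rightarrow> real \<Rightarrow> real" where
  "majorant C \<theta> \<kappa> u = C * (\<bar>u\<bar> powr (\<theta> - 1) * exp (- \<kappa> * \<bar>u\<bar>))"

lemma artfima_coeff_nonneg: "\<alpha> > 0 \<Longrightarrow> artfima_coeff \<alpha> j \<ge> 0"
  unfolding artfima_coeff_def gbinomial_pochhammer
  by (simp add: pochhammer_nonneg flip: power_mult_distrib mult.assoc)

lemma summable_artfima_coeff:
  assumes "\<alpha> > 0" "\<mu> > 0"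
  shows "summable (\<lambda>j. \<bar>artfima_coeff \<alpha> j * exp (- \<mu> * real j)\<bar>)"
proof -
  have "summable (\<lambda>j. ((- \<alpha>) gchoose j) * (- exp (- \<mu>)) ^ j)"
    using gen_binomial_real[of "- exp (- \<mu>)" "- \<alpha>"] assms by (auto intro: sums_summable)
  moreover have "((- \<alpha>) gchoose j) * (- exp (- \<mu>)) ^ j = \<bar>artfima_coeff \<alpha> j * exp (- \<mu> * real j)\<bar>" for j
  proof -
    have "((- \<alpha>) gchoose j) * (- exp (- \<mu>)) ^ j = artfima_coeff \<alpha> j * exp (- \<mu> * real j)"
      unfolding artfima_coeff_def power_minus[of "exp (- \<mu>)"]
      by (simp add: exp_of_nat_mult[symmetric] mult.commute)
    also have "\<dots> = \<bar>\<dots>\<bar>" using artfima_coeff_nonneg[OF assms(1), of j] by simp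
    finally show ?thesis .
  qed
  ultimately show ?thesis by simp
qed

text \<open>Passing from \<open>j\<close> to \<open>j+1\<close> in the asymptotics makes the quotient finite at \<open>j = 0\<close>, and a
  convergent sequence is bounded.\<close>

lemma artfima_coeff_bound:
  obtains C where "C > 0" "\<And>j. artfima_coeff \<alpha> j \<le> C * (real j + 1) powr (\<alpha> - 1)"
proof -
  have ratio: "(\<lambda>j. real j / (real j + 1)) \<longlonglongrightarrow> 1"
    using LIMSEQ_n_over_Suc_n[where 'a = real] by (simp add: add.commute)
  have "(\<lambda>j. artfima_coeff \<alpha> j / real j powr (\<alpha> - 1) * (real j / (real j + 1)) powr (\<alpha> - 1))
      \<longlonglongrightarrow> 1 / Gamma \<alpha> * 1 powr (\<alpha> - 1)"
    by (intro tendsto_mult artfima_coeff_asymptotic tendsto_powr tendsto_const ratio) auto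
  moreover have "\<forall>\<^sub>F j in sequentially. artfima_coeff \<alpha> j / real j powr (\<alpha> - 1) * (real j / (real j + 1)) powr (\<alpha> - 1)
      = artfima_coeff \<alpha> j / (real j + 1) powr (\<alpha> - 1)"
    using eventually_gt_at_top[of 0] by eventually_elim (simp add: powr_divide)
  ultimately have "(\<lambda>j. artfima_coeff \<alpha> j / (real j + 1) powr (\<alpha> - 1)) \<longlonglongrightarrow> 1 / Gamma \<alpha> * 1 powr (\<alpha> - 1)"
    by (rule Lim_transform_eventually)
  then have "Bseq (\<lambda>j. artfima_coeff \<alpha> j / (real j + 1) powr (\<alpha> - 1))"
    by (intro convergent_imp_Bseq convergentI)
  then obtain C where C: "C > 0" "\<And>j. norm (artfima_coeff \<alpha> j / (real j + 1) powr (\<alpha> - 1)) \<le> C"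
    by (auto elim: BseqE)
  show thesis
  proof (rule that[OF C(1)])
    fix j
    have "artfima_coeff \<alpha> j / (real j + 1) powr (\<alpha> - 1) \<le> C" using C(2)[of j] unfolding real_norm_def by linarith
    then show "artfima_coeff \<alpha> j \<le> C * (real j + 1) powr (\<alpha> - 1)" by (simp add: divide_le_eq)
  qed
qed

lemma powr_exp_bound:
  fixes a k x :: real
  assumes "a > 0" "k > 0" "x > 0"
  shows "x powr a * exp (- k * x) \<le> exp (- a - a * ln (k / a))"
proof -
  have "ln (x * k / a) \<le> x * k / a - 1" using assms ln_le_minus_one[of "x * k / a"] by simp
  moreover have "ln (x * k / a) = ln x + ln (k / a)" using assms by (simp add: ln_mult ln_div)
  ultimately have "a * (ln x + ln (k / a)) \<le> a * (x * k / a - 1)" using assms by (intro mult_left_mono) auto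
  then have "a * ln x - k * x \<le> - a - a * ln (k / a)" using assms by (simp add: algebra_simps)
  then show ?thesis using assms by (simp add: powr_def exp_add[symmetric])
qed

text \<open>If \<open>\<alpha> \<le> 1\<close> this is the bound on the coefficients. If \<open>\<alpha> > 1\<close> the growing power is absorbed by
  half of the exponential tempering.\<close>

lemma scaled_coeff_bound:
  assumes "\<alpha> > 0" "lam > 0"
  obtains C where "C > 0" "\<And>n j. n > 0 \<Longrightarrow> scaled_coeff \<alpha> lam n (int j)
    \<le> C * (((real j + 1) / real n) powr (min \<alpha> 1 - 1) * exp (- (lam/2) * (real j / real n)))"
proof -
  obtain C0 where C0: "C0 > 0" "\<And>j. artfima_coeff \<alpha> j \<le> C0 * (real j + 1) powr (\<alpha> - 1)"
    using artfima_coeff_bound by blast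
  \<comment> \<open>for \<open>\<alpha> > 1\<close> the maximum of \<open>x\<^bsup>\<alpha>-1\<^esup> e\<^bsup>-\<lambda>x/2\<^esup>\<close>, corrected by \<open>e\<^bsup>\<lambda>/2\<^esup>\<close> for the shift from \<open>j\<close> to \<open>j+1\<close>\<close>
  define C1 where "C1 = (if \<alpha> \<le> 1 then 1 else exp (lam/2) * exp (- (\<alpha> - 1) - (\<alpha> - 1) * ln ((lam/2) / (\<alpha> - 1))))"
  have C1: "C1 > 0" by (simp add: C1_def)
  show thesis
  proof (rule that[of "C0 * C1"])
    show "C0 * C1 > 0" using C0 C1 by simp
    fix n j :: nat assume n: "n > 0"
    define x where "x = (real j + 1) / real n"
    have x: "x > 0" using n by (simp add: x_def)
    have "scaled_coeff \<alpha> lam n (int j) = real n powr (1 - \<alpha>) * artfima_coeff \<alpha> j * exp (- lam * (real j / real n))"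
      by (simp add: scaled_coeff_def)
    also have "\<dots> \<le> real n powr (1 - \<alpha>) * (C0 * (real j + 1) powr (\<alpha> - 1)) * exp (- lam * (real j / real n))"
      by (intro mult_right_mono mult_left_mono C0) auto
    also have "\<dots> = C0 * (x powr (\<alpha> - 1) * exp (- lam * (real j / real n)))"
    proof -
      have "real n powr (1 - \<alpha>) * (real j + 1) powr (\<alpha> - 1) = x powr (\<alpha> - 1)"
        using n by (simp add: x_def powr_divide powr_diff field_simps)
      then show ?thesis by (metis mult.assoc mult.left_commute)
    qed
    also have "x powr (\<alpha> - 1) * exp (- lam * (real j / real n)) \<le> C1 * (x powr (min \<alpha> 1 - 1) * exp (- (lam/2) * (real j / real n)))"
    proof (cases "\<alpha> \<le> 1")
      case True
      have "lam / 2 * (real j / real n) \<le> lam * (real j / real n)" using assms by (intro mult_right_mono) auto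
      then show ?thesis using True by (auto simp: C1_def min_def intro!: mult_left_mono)
    next
      case False
      have e: "- lam * (real j / real n) = - (lam/2) * x + (lam/2) * (1 / real n) + - (lam/2) * (real j / real n)"
        using n by (simp add: x_def field_simps)
      have "(lam/2) * (1 / real n) \<le> (lam/2) * 1" using n assms by (intro mult_left_mono) auto
      then have "exp ((lam/2) * (1 / real n)) \<le> exp (lam/2)" by simp
      then have "(x powr (\<alpha> - 1) * exp (- (lam/2) * x)) * exp ((lam/2) * (1 / real n))
        \<le> exp (- (\<alpha> - 1) - (\<alpha> - 1) * ln ((lam/2) / (\<alpha> - 1))) * exp (lam/2)"
        by (intro mult_mono powr_exp_bound) (use False assms x in auto)
      also have "\<dots> = C1" using False by (simp add: C1_def mult.commute)
      finally have "(x powr (\<alpha> - 1) * exp (- (lam/2) * x)) * exp ((lam/2) * (1 / real n)) * exp (- (lam/2) * (real j / real n))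
        \<le> C1 * exp (- (lam/2) * (real j / real n))" by (rule mult_right_mono) simp
      moreover have "(x powr (\<alpha> - 1) * exp (- (lam/2) * x)) * exp ((lam/2) * (1 / real n)) * exp (- (lam/2) * (real j / real n))
         = x powr (\<alpha> - 1) * exp (- lam * (real j / real n))"
        unfolding e exp_add by (simp only: mult.assoc)
      moreover have "x powr (min \<alpha> 1 - 1) = 1" using False x by (simp add: min_def)
      ultimately show ?thesis by (simp only: mult_1)
    qed
    then have "C0 * (x powr (\<alpha> - 1) * exp (- lam * (real j / real n)))
      \<le> C0 * (C1 * (x powr (min \<alpha> 1 - 1) * exp (- (lam/2) * (real j / real n))))"
      using C0 by (intro mult_left_mono) auto
    finally show "scaled_coeff \<alpha> lam n (int j)
      \<le> C0 * C1 * (((real j + 1) / real n) powr (min \<alpha> 1 - 1) * exp (- (lam/2) * (real j / real n)))"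
      unfolding x_def by (simp only: mult.assoc) 
  qed
qed

lemma scaled_coeff_nonneg: "\<alpha> > 0 \<Longrightarrow> scaled_coeff \<alpha> lam n j \<ge> 0"
  by (simp add: scaled_coeff_def artfima_coeff_nonneg)

text \<open>The slack \<open>|j - nu| \<le> 3\<close> makes room for all roundings that occur later: one for \<open>ns\<close> and
  at most two for \<open>ny\<close>, in a fine and a coarse lattice.\<close>

lemma scaled_coeff_le_majorant:
  assumes "\<alpha> > 0" "lam > 0"
  obtains C where "C > 0" "\<And>n j u. n > 0 \<Longrightarrow> \<bar>of_int j - real n * u\<bar> \<le> 3 \<Longrightarrow> u \<noteq> 0 \<Longrightarrow>
     scaled_coeff \<alpha> lam n j \<le> majorant C (min \<alpha> 1) (lam/2) u"
proof -
  obtain C where C: "C > 0" "\<And>n j. n > 0 \<Longrightarrow> scaled_coeff \<alpha> lam n (int j)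
    \<le> C * (((real j + 1) / real n) powr (min \<alpha> 1 - 1) * exp (- (lam/2) * (real j / real n)))"
    using scaled_coeff_bound[OF assms] by blast
  define p where "p = min \<alpha> 1 - 1"
  have p: "-1 < p" "p \<le> 0" using assms by (auto simp: p_def)
  \<comment> \<open>one factor \<open>3\<close> from \<open>n|u| \<le> 3(j+1)\<close>, the exponential from \<open>|u| \<le> j/n + 3\<close>\<close>
  define C' where "C' = C * (3 * exp (3 * (lam/2)))"
  show thesis
  proof (rule that[of C'])
    show "C' > 0" using C by (simp add: C'_def)
    fix n :: nat and i :: int and u :: real
    assume n: "n > 0" and d: "\<bar>of_int i - real n * u\<bar> \<le> 3" and u: "u \<noteq> 0"
    show "scaled_coeff \<alpha> lam n i \<le> majorant C' (min \<alpha> 1) (lam/2) u"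
    proof (cases "i < 0")
      case True
      then show ?thesis using \<open>C' > 0\<close> by (simp add: scaled_coeff_def majorant_def)
    next
      case False
      define j where "j = nat i"
      have i: "i = int j" using False by (simp add: j_def)
      have nu: "real n * \<bar>u\<bar> \<le> real j + 3"
        using d unfolding i by (cases "u \<ge> 0") (auto simp: abs_if split: if_splits)
      have "\<bar>u\<bar> / 3 \<le> (real j + 1) / real n" using nu n by (simp add: field_simps)
      then have "((real j + 1) / real n) powr p \<le> (\<bar>u\<bar> / 3) powr p"
        using u p by (intro powr_mono2') auto
      also have "\<dots> = 3 powr (- p) * \<bar>u\<bar> powr p" by (simp add: powr_divide powr_minus field_simps)
      also have "\<dots> \<le> 3 * \<bar>u\<bar> powr p"
        using powr_mono[of "- p" 1 "3::real"] p by (intro mult_right_mono) auto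
      finally have 1: "((real j + 1) / real n) powr p \<le> 3 * \<bar>u\<bar> powr p" .
      have "real j / real n \<ge> \<bar>u\<bar> - 3"
      proof -
        have "\<bar>u\<bar> \<le> (real j + 3) / real n" using nu n by (simp add: field_simps)
        also have "\<dots> = real j / real n + 3 / real n" by (simp add: add_divide_distrib)
        also have "3 / real n \<le> 3" using n by (simp add: divide_le_eq)
        finally show ?thesis by simp
      qed
      then have "(lam/2) * (\<bar>u\<bar> - 3) \<le> (lam/2) * (real j / real n)" using assms by (intro mult_left_mono) auto
      then have 2: "exp (- (lam/2) * (real j / real n)) \<le> exp (3 * (lam/2)) * exp (- (lam/2) * \<bar>u\<bar>)"
        by (simp add: exp_add[symmetric] algebra_simps)
      have "scaled_coeff \<alpha> lam n i \<le> C * (((real j + 1) / real n) powr p * exp (- (lam/2) * (real j / real n)))"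
        unfolding i p_def by (rule C(2)[OF n])
      also have "\<dots> \<le> C * ((3 * \<bar>u\<bar> powr p) * (exp (3 * (lam/2)) * exp (- (lam/2) * \<bar>u\<bar>)))"
        using C(1) by (intro mult_left_mono mult_mono 1 2) auto
      also have "\<dots> = majorant C' (min \<alpha> 1) (lam/2) u"
        by (simp add: majorant_def C'_def p_def)
      finally show ?thesis .
    qed
  qed
qed

section \<open>Square integrals of kernel increments\<close>

lemma nn_integral_even_le:
  assumes [measurable]: "f \<in> borel_measurable borel" and even: "\<And>x::real. f (- x) = f x"
  shows "(\<integral>\<^sup>+x. f x * indicator {-h..h} x \<partial>lborel) \<le> 2 * (\<integral>\<^sup>+x. f x * indicator {0..h} x \<partial>lborel)"
proof -
  have "(\<integral>\<^sup>+x. f x * indicator {-h..h} x \<partial>lborel) \<le> (\<integral>\<^sup>+x. f x * indicator {0..h} x + f (- x) * indicator {0..h} (- x) \<partial>lborel)"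
    by (intro nn_integral_mono) (auto simp: even split: split_indicator)
  also have "\<dots> = (\<integral>\<^sup>+x. f x * indicator {0..h} x \<partial>lborel) + (\<integral>\<^sup>+x. f (- x) * indicator {0..h} (- x) \<partial>lborel)"
    by (rule nn_integral_add) measurable
  also have "(\<integral>\<^sup>+x. f (- x) * indicator {0..h} (- x) \<partial>lborel) = (\<integral>\<^sup>+x. f x * indicator {0..h} x \<partial>lborel)"
    using nn_integral_real_affine[of "\<lambda>x. f x * indicator {0..h} x" "-1" 0] by simp
  finally show ?thesis by (simp add: mult_2)
qed

lemma nn_integral_power_singularity:
  assumes "0 < \<theta>" "0 \<le> h"
  shows "(\<integral>\<^sup>+x. ennreal (\<bar>x\<bar> powr (\<theta> - 1)) * indicator {-h..h} x \<partial>lborel) \<le> ennreal (2 / \<theta> * h powr \<theta>)"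
proof -
  have "((\<lambda>x. x powr (\<theta> - 1)) has_integral (h powr \<theta> / \<theta>)) {0..h}"
    using has_integral_powr_from_0[of "\<theta> - 1" h] assms by simp
  then have hi: "((\<lambda>x. \<bar>x\<bar> powr (\<theta> - 1)) has_integral (h powr \<theta> / \<theta>)) {0..h}"
    by (rule has_integral_eq[rotated]) auto
  have *: "(\<integral>\<^sup>+x. ennreal (\<bar>x\<bar> powr (\<theta> - 1)) * indicator {0..h} x \<partial>lborel) = ennreal (h powr \<theta> / \<theta>)"
    by (rule nn_integral_has_integral_lebesgue'[OF _ hi]) simp
  have "(\<integral>\<^sup>+x. ennreal (\<bar>x\<bar> powr (\<theta> - 1)) * indicator {-h..h} x \<partial>lborel) \<le> 2 * ennreal (h powr \<theta> / \<theta>)"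
    unfolding *[symmetric] by (rule nn_integral_even_le) auto
  also have "\<dots> = ennreal (2 / \<theta> * h powr \<theta>)"
  proof -
    note numeral_times_ennreal
    then show ?thesis using assms by simp
  qed
  finally show ?thesis .
qed

lemma measurable_majorant [measurable]: "majorant C \<theta> \<kappa> \<in> borel_measurable borel"
  unfolding majorant_def[abs_def] by measurable

text \<open>The common bound for the increments over \<open>[s,t]\<close> of all kernels at the point \<open>y\<close>.\<close>

definition window :: "real \<Rightarrow> real \<Rightarrow> real \<Rightarrow> real \<Rightarrow> real \<Rightarrow> real \<Rightarrow> ennreal" where
  "window C \<theta> \<kappa> s t y = (\<integral>\<^sup>+v. ennreal (majorant C \<theta> \<kappa> (v - y)) * indicator {s..t} v \<partial>lborel)"

lemma measurable_window [measurable]: "window C \<theta> \<kappa> s t \<in> borel_measurable borel"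
  unfolding window_def[abs_def] by measurable

text \<open>At distance more than \<open>t-s\<close> from the singularity the integrand is at most \<open>(t-s)\<^bsup>\<theta>-1\<^esup>\<close>, and
  the part closer to it is integrated explicitly.\<close>

lemma window_le:
  assumes \<theta>: "0 < \<theta>" "\<theta> \<le> 1" and "\<kappa> \<ge> 0" "C \<ge> 0" "s \<le> t"
  shows "window C \<theta> \<kappa> s t y \<le> ennreal (C * (1 + 2 / \<theta>) * (t - s) powr \<theta>)"
proof (cases "s = t")
  case True
  have "window C \<theta> \<kappa> s t y = integral\<^sup>N lborel (\<lambda>_::real. 0)"
    unfolding window_def
  proof (rule nn_integral_cong_AE)
    show "AE v in lborel. ennreal (majorant C \<theta> \<kappa> (v - y)) * indicator {s..t} v = 0"
      using AE_lborel_singleton[of s] by eventually_elim (use True in auto)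
  qed
  then show ?thesis by simp
next
  case False
  define h where "h = t - s"
  have h: "h > 0" using assms False by (simp add: h_def)
  define f where "f x = ennreal (\<bar>x\<bar> powr (\<theta> - 1)) * indicator {-h..h} x" for x
  have [measurable]: "f \<in> borel_measurable borel" unfolding f_def by measurable
  have "window C \<theta> \<kappa> s t y \<le> (\<integral>\<^sup>+v. ennreal C * (ennreal (h powr (\<theta> - 1)) * indicator {s..t} v + f (v - y)) \<partial>lborel)"
    unfolding window_def
  proof (rule nn_integral_mono)
    fix v
    have "majorant C \<theta> \<kappa> (v - y) \<le> C * (\<bar>v - y\<bar> powr (\<theta> - 1) * 1)"
      unfolding majorant_def using assms by (intro mult_left_mono) auto
    moreover have "ennreal (\<bar>v - y\<bar> powr (\<theta> - 1)) * indicator {s..t} v \<le> ennreal (h powr (\<theta> - 1)) * indicator {s..t} v + f (v - y)"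
    proof (cases "\<bar>v - y\<bar> \<le> h")
      case True
      then show ?thesis by (auto simp: f_def split: split_indicator)
    next
      case False
      then have "\<bar>v - y\<bar> powr (\<theta> - 1) \<le> h powr (\<theta> - 1)" using h \<theta> by (intro powr_mono2') auto
      then show ?thesis by (auto split: split_indicator intro: add_increasing2 ennreal_leI)
    qed
    ultimately have "ennreal (majorant C \<theta> \<kappa> (v - y)) * indicator {s..t} v
      \<le> ennreal C * (ennreal (\<bar>v - y\<bar> powr (\<theta> - 1)) * indicator {s..t} v)"
      using assms by (auto simp: ennreal_mult[symmetric] split: split_indicator intro!: ennreal_leI)
    also have "\<dots> \<le> ennreal C * (ennreal (h powr (\<theta> - 1)) * indicator {s..t} v + f (v - y))"
      by (intro mult_left_mono) (fact, simp)
    finally show "ennreal (majorant C \<theta> \<kappa> (v - y)) * indicator {s..t} v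
      \<le> ennreal C * (ennreal (h powr (\<theta> - 1)) * indicator {s..t} v + f (v - y))" .
  qed
  also have "\<dots> = ennreal C * (ennreal (h powr (\<theta> - 1)) * ennreal h + (\<integral>\<^sup>+v. f (v - y) \<partial>lborel))"
    using h by (subst nn_integral_cmult, measurable, subst nn_integral_add, measurable)
      (simp add: nn_integral_cmult_indicator h_def)
  also have "(\<integral>\<^sup>+v. f (v - y) \<partial>lborel) = (\<integral>\<^sup>+x. f x \<partial>lborel)"
    using nn_integral_real_affine[of f 1 "- y"] by simp
  also have "\<dots> \<le> ennreal (2 / \<theta> * h powr \<theta>)"
    unfolding f_def by (rule nn_integral_power_singularity) (use h \<theta> in auto)
  also have "ennreal (h powr (\<theta> - 1)) * ennreal h = ennreal (h powr \<theta>)"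
    using h by (simp add: ennreal_mult[symmetric] powr_diff)
  also have "ennreal C * (ennreal (h powr \<theta>) + ennreal (2 / \<theta> * h powr \<theta>)) = ennreal (C * (1 + 2 / \<theta>) * h powr \<theta>)"
    using \<theta> assms by (subst ennreal_plus[symmetric], simp, simp, subst ennreal_mult[symmetric]) (auto simp: algebra_simps)
  finally show ?thesis by (simp add: h_def mult_left_mono add_left_mono)
qed

lemma majorant_integral_finite:
  assumes \<theta>: "0 < \<theta>" "\<theta> \<le> 1" and "\<kappa> > 0" "C \<ge> 0"
  shows "(\<integral>\<^sup>+u. ennreal (majorant C \<theta> \<kappa> u) \<partial>lborel) < \<infinity>"
proof -
  define f where "f x = ennreal (\<bar>x\<bar> powr (\<theta> - 1)) * indicator {-1..1} x" for x :: real
  define e where "e x = ennreal (exp (- \<kappa> * \<bar>x\<bar>))" for x :: real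
  have [measurable]: "f \<in> borel_measurable borel" "e \<in> borel_measurable borel" unfolding f_def e_def by measurable
  have "(\<integral>\<^sup>+u. ennreal (majorant C \<theta> \<kappa> u) \<partial>lborel) \<le> (\<integral>\<^sup>+u. ennreal C * (f u + e u) \<partial>lborel)"
  proof (rule nn_integral_mono)
    fix u
    have "ennreal (\<bar>u\<bar> powr (\<theta> - 1) * exp (- \<kappa> * \<bar>u\<bar>)) \<le> f u + e u"
    proof (cases "\<bar>u\<bar> \<le> 1")
      case True
      have "\<bar>u\<bar> powr (\<theta> - 1) * exp (- \<kappa> * \<bar>u\<bar>) \<le> \<bar>u\<bar> powr (\<theta> - 1) * 1"
        using assms by (intro mult_left_mono) auto
      then show ?thesis using True by (auto simp: f_def indicator_def abs_le_iff intro!: add_increasing2 ennreal_leI)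
    next
      case False
      have "\<bar>u\<bar> powr (\<theta> - 1) \<le> 1 powr (\<theta> - 1)" using False \<theta> by (intro powr_mono2') auto
      then have "\<bar>u\<bar> powr (\<theta> - 1) * exp (- \<kappa> * \<bar>u\<bar>) \<le> 1 * exp (- \<kappa> * \<bar>u\<bar>)"
        by (intro mult_right_mono) auto
      then show ?thesis by (auto simp: e_def intro!: add_increasing ennreal_leI)
    qed
    then have "ennreal C * ennreal (\<bar>u\<bar> powr (\<theta> - 1) * exp (- \<kappa> * \<bar>u\<bar>)) \<le> ennreal C * (f u + e u)"
      by (rule mult_left_mono) simp
    then show "ennreal (majorant C \<theta> \<kappa> u) \<le> ennreal C * (f u + e u)"
      unfolding majorant_def using assms by (simp add: ennreal_mult[symmetric])
  qed
  also have "\<dots> = ennreal C * ((\<integral>\<^sup>+u. f u \<partial>lborel) + (\<integral>\<^sup>+u. e u \<partial>lborel))"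
    by (subst nn_integral_cmult, measurable, subst nn_integral_add) auto
  also have "\<dots> < \<infinity>"
  proof -
    have 1: "(\<integral>\<^sup>+u. f u \<partial>lborel) < \<infinity>"
      unfolding f_def using nn_integral_power_singularity[OF \<theta>(1), of 1] by (rule le_less_trans) auto
    have "((\<lambda>x. exp (- \<kappa> * x)) has_integral (exp (- \<kappa> * 0) / \<kappa>)) {0..}"
      using has_integral_exp_minus_to_infinity[of \<kappa> 0] assms by simp
    then have hi: "((\<lambda>x. exp (- \<kappa> * \<bar>x\<bar>)) has_integral (exp (- \<kappa> * 0) / \<kappa>)) {0..}"
      by (rule has_integral_eq[rotated]) auto
    have "(\<integral>\<^sup>+x. e x * indicator {0..} x \<partial>lborel) = ennreal (exp (- \<kappa> * 0) / \<kappa>)"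
      unfolding e_def by (rule nn_integral_has_integral_lebesgue'[OF _ hi]) simp
    then have p: "(\<integral>\<^sup>+x. e x * indicator {0..} x \<partial>lborel) < \<infinity>" by simp
    have "(\<integral>\<^sup>+u. e u \<partial>lborel) \<le> (\<integral>\<^sup>+u. e u * indicator {0..} u + e (- u) * indicator {0..} (- u) \<partial>lborel)"
      by (intro nn_integral_mono) (auto simp: e_def split: split_indicator)
    also have "\<dots> = (\<integral>\<^sup>+u. e u * indicator {0..} u \<partial>lborel) + (\<integral>\<^sup>+u. e (- u) * indicator {0..} (- u) \<partial>lborel)"
      by (rule nn_integral_add) measurable
    also have "(\<integral>\<^sup>+u. e (- u) * indicator {0..} (- u) \<partial>lborel) = (\<integral>\<^sup>+u. e u * indicator {0..} u \<partial>lborel)"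
      using nn_integral_real_affine[of "\<lambda>x. e x * indicator {0..} x" "-1" 0] by simp
    finally have "(\<integral>\<^sup>+u. e u \<partial>lborel) < \<infinity>" using p by (auto intro: le_less_trans)
    then show ?thesis using 1 by (auto simp: ennreal_mult_less_top)
  qed
  finally show ?thesis .
qed

text \<open>The square is at most the supremum, of order \<open>(t-s)\<^sup>\<theta>\<close>, times the function itself, whose
  integral over \<open>y\<close> is of order \<open>t-s\<close> by Tonelli's theorem.\<close>

lemma window_square_integral:
  assumes \<theta>: "0 < \<theta>" "\<theta> \<le> 1" and \<kappa>: "\<kappa> > 0" and C: "C \<ge> 0"
  obtains C' where "C' \<ge> 0" "\<And>s t. s \<le> t \<Longrightarrow>
    (\<integral>\<^sup>+y. (window C \<theta> \<kappa> s t y)\<^sup>2 \<partial>lborel) \<le> ennreal (C' * (t - s) powr (1 + \<theta>))"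
proof -
  define I where "I = (\<integral>\<^sup>+u. ennreal (majorant C \<theta> \<kappa> u) \<partial>lborel)"
  obtain r where r: "I = ennreal r" "r \<ge> 0"
    using majorant_integral_finite[OF assms] unfolding I_def[symmetric] by (cases I) auto
  define b where "b = C * (1 + 2 / \<theta>)"
  have b: "b \<ge> 0" using assms by (simp add: b_def)
  show thesis
  proof (rule that[of "b * r"])
    show "b * r \<ge> 0" using b r by simp
    fix s t :: real assume st: "s \<le> t"
    have total: "(\<integral>\<^sup>+y. window C \<theta> \<kappa> s t y \<partial>lborel) = ennreal (r * (t - s))"
    proof -
      have "(\<integral>\<^sup>+y. window C \<theta> \<kappa> s t y \<partial>lborel)
          = (\<integral>\<^sup>+v. \<integral>\<^sup>+y. ennreal (majorant C \<theta> \<kappa> (v - y)) * indicator {s..t} v \<partial>lborel \<partial>lborel)"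
        unfolding window_def by (rule lborel_pair.Fubini') measurable
      also have "\<dots> = (\<integral>\<^sup>+v. I * indicator {s..t} v \<partial>lborel)"
      proof (rule nn_integral_cong)
        fix v
        have "(\<integral>\<^sup>+y. ennreal (majorant C \<theta> \<kappa> (v - y)) \<partial>lborel) = I"
          unfolding I_def using nn_integral_real_affine[of "\<lambda>u. ennreal (majorant C \<theta> \<kappa> u)" "-1" v] by simp
        then show "(\<integral>\<^sup>+y. ennreal (majorant C \<theta> \<kappa> (v - y)) * indicator {s..t} v \<partial>lborel) = I * indicator {s..t} v"
          by (simp add: nn_integral_multc)
      qed
      also have "\<dots> = I * ennreal (t - s)" using st by (simp add: nn_integral_cmult_indicator)
      finally show ?thesis using r st by (simp add: ennreal_mult[symmetric])
    qed
    have "(\<integral>\<^sup>+y. (window C \<theta> \<kappa> s t y)\<^sup>2 \<partial>lborel) \<le> (\<integral>\<^sup>+y. ennreal (b * (t - s) powr \<theta>) * window C \<theta> \<kappa> s t y \<partial>lborel)"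
      unfolding power2_eq_square b_def
      by (intro nn_integral_mono mult_right_mono window_le) (use assms st in auto)
    also have "\<dots> = ennreal (b * (t - s) powr \<theta>) * ennreal (r * (t - s))"
      by (subst nn_integral_cmult) (auto simp: total)
    also have "\<dots> = ennreal (b * r * (t - s) powr (1 + \<theta>))"
    proof -
      have "(t - s) powr (1 + \<theta>) = (t - s) * (t - s) powr \<theta>" using st by (cases "s = t") (auto simp: powr_add)
      then show ?thesis using b r st by (subst ennreal_mult[symmetric]) (auto simp: mult_ac)
    qed
    finally show "(\<integral>\<^sup>+y. (window C \<theta> \<kappa> s t y)\<^sup>2 \<partial>lborel) \<le> ennreal (b * r * (t - s) powr (1 + \<theta>))" .
  qed
qed

lemma kernel_increment_le_window:
  assumes st: "0 \<le> s" "s \<le> t" and int: "set_integrable lborel {0..t} f"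
    and f: "\<And>v. f v \<ge> 0" "\<And>v. v \<noteq> y \<Longrightarrow> f v \<le> majorant C \<theta> \<kappa> (v - y)"
  shows "ennreal \<bar>(LINT v:{0..t}|lborel. f v) - (LINT v:{0..s}|lborel. f v)\<bar> \<le> window C \<theta> \<kappa> s t y"
proof -
  have un: "{0..t} = {0..s} \<union> {s<..t}" using st by auto
  have i1: "set_integrable lborel {0..s} f" and i2: "set_integrable lborel {s<..t} f"
    by (rule set_integrable_subset[OF int]; use st in auto)+
  have "(LINT v:{0..t}|lborel. f v) = (LINT v:{0..s}|lborel. f v) + (LINT v:{s<..t}|lborel. f v)"
    unfolding un by (rule set_integral_Un[OF _ i1 i2]) auto
  moreover have "(LINT v:{s<..t}|lborel. f v) \<ge> 0"
    unfolding set_lebesgue_integral_def using f(1) by (intro Bochner_Integration.integral_nonneg) (auto split: split_indicator)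
  ultimately have "ennreal \<bar>(LINT v:{0..t}|lborel. f v) - (LINT v:{0..s}|lborel. f v)\<bar> = ennreal (LINT v:{s<..t}|lborel. f v)"
    by simp
  also have "\<dots> = (\<integral>\<^sup>+v. ennreal (indicator {s<..t} v *\<^sub>R f v) \<partial>lborel)"
    unfolding set_lebesgue_integral_def using i2 f(1) unfolding set_integrable_def
    by (intro nn_integral_eq_integral[symmetric]) (auto split: split_indicator)
  also have "\<dots> \<le> window C \<theta> \<kappa> s t y"
    unfolding window_def
  proof (rule nn_integral_mono_AE)
    show "AE v in lborel. ennreal (indicator {s<..t} v *\<^sub>R f v) \<le> ennreal (majorant C \<theta> \<kappa> (v - y)) * indicator {s..t} v"
      using AE_lborel_singleton[of y]
      by eventually_elim (use f in \<open>auto split: split_indicator intro: ennreal_leI\<close>)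
  qed
  finally show ?thesis .
qed



section \<open>Convergence of the kernels\<close>

lemma ceiling_scaled_tendsto: "(\<lambda>n. of_int \<lceil>real n * s\<rceil> / real n) \<longlonglongrightarrow> s"
proof (rule LIM_zero_cancel, rule Lim_null_comparison)
  show "\<forall>\<^sub>F n in sequentially. norm (of_int \<lceil>real n * s\<rceil> / real n - s) \<le> 1 / real n"
    using eventually_gt_at_top[of 0]
  proof eventually_elim
    case (elim n)
    have "of_int \<lceil>real n * s\<rceil> / real n - s = (of_int \<lceil>real n * s\<rceil> - real n * s) / real n"
      using elim by (simp add: field_simps)
    moreover have "\<bar>of_int \<lceil>real n * s\<rceil> - real n * s\<bar> \<le> 1" by linarith
    ultimately show ?case using elim by (simp add: divide_right_mono)
  qed
qed (rule lim_1_over_n)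

text \<open>For \<open>y < s\<close> the index is asymptotically \<open>n(s-y)\<close>, so the asymptotics of the coefficients apply;
  for \<open>s < y\<close> it is eventually negative.\<close>

lemma scaled_coeff_tendsto:
  assumes "s \<noteq> y"
  shows "(\<lambda>n. scaled_coeff \<alpha> lam n (\<lceil>real n * s\<rceil> - \<lceil>real n * y\<rceil>))
     \<longlonglongrightarrow> (if y < s then (s - y) powr (\<alpha> - 1) * exp (- lam * (s - y)) else 0) / Gamma \<alpha>"
proof -
  define x where "x n = \<lceil>real n * s\<rceil> - \<lceil>real n * y\<rceil>" for n
  have "(\<lambda>n. of_int \<lceil>real n * s\<rceil> / real n - of_int \<lceil>real n * y\<rceil> / real n) \<longlonglongrightarrow> s - y"
    by (intro tendsto_diff ceiling_scaled_tendsto)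
  then have x: "(\<lambda>n. of_int (x n) / real n) \<longlonglongrightarrow> s - y"
    by (simp add: x_def diff_divide_distrib)
  show ?thesis
  proof (cases "y < s")
    case False
    then have "s - y < 0" using assms by simp
    then have "\<forall>\<^sub>F n in sequentially. of_int (x n) / real n < 0" by (rule order_tendstoD(2)[OF x])
    then have "\<forall>\<^sub>F n in sequentially. 0 = scaled_coeff \<alpha> lam n (x n)"
    proof eventually_elim
      case (elim n)
      then have "x n < 0" by (auto simp: divide_less_0_iff)
      then show ?case by (simp add: scaled_coeff_def)
    qed
    then have "(\<lambda>n. scaled_coeff \<alpha> lam n (x n)) \<longlonglongrightarrow> 0"
      by (rule Lim_transform_eventually[OF tendsto_const])
    then show ?thesis using False by (simp add: x_def)
  next
    case True
    have pos: "\<forall>\<^sub>F n in sequentially. 0 < of_int (x n) / real n"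
      by (rule order_tendstoD(1)[OF x]) (use True in simp)
    have "filterlim (\<lambda>n. of_int (x n) / real n * real n) at_top sequentially"
      by (rule filterlim_tendsto_pos_mult_at_top[OF x _ filterlim_real_sequentially]) (use True in simp)
    moreover have "\<forall>\<^sub>F n in sequentially. of_int (x n) / real n * real n \<le> real (nat (x n))"
      using eventually_gt_at_top[of 0] by eventually_elim auto
    ultimately have "filterlim (\<lambda>n. real (nat (x n))) at_top sequentially"
      by (rule filterlim_at_top_mono)
    then have nat_x: "filterlim (\<lambda>n. nat (x n)) at_top sequentially"
      by (simp only: filterlim_sequentially_iff_filterlim_real)
    have "(\<lambda>n. artfima_coeff \<alpha> (nat (x n)) / real (nat (x n)) powr (\<alpha> - 1) *
        (of_int (x n) / real n) powr (\<alpha> - 1) * exp (- lam * (of_int (x n) / real n)))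
        \<longlonglongrightarrow> 1 / Gamma \<alpha> * (s - y) powr (\<alpha> - 1) * exp (- lam * (s - y))"
      by (intro tendsto_mult tendsto_powr tendsto_exp tendsto_const x
           filterlim_compose[OF artfima_coeff_asymptotic nat_x]) (use True in auto)
    moreover have "\<forall>\<^sub>F n in sequentially. artfima_coeff \<alpha> (nat (x n)) / real (nat (x n)) powr (\<alpha> - 1) *
        (of_int (x n) / real n) powr (\<alpha> - 1) * exp (- lam * (of_int (x n) / real n)) = scaled_coeff \<alpha> lam n (x n)"
      using pos eventually_gt_at_top[of 0]
    proof eventually_elim
      case (elim n)
      then have xn: "x n > 0" using True by (auto simp: zero_less_divide_iff)
      have "(of_int (x n) / real n) powr (\<alpha> - 1) = real (nat (x n)) powr (\<alpha> - 1) * real n powr (1 - \<alpha>)"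
        using xn elim by (simp add: powr_divide powr_diff field_simps)
      then show ?case using xn elim by (simp add: scaled_coeff_def)
    qed
    ultimately have "(\<lambda>n. scaled_coeff \<alpha> lam n (x n)) \<longlonglongrightarrow> 1 / Gamma \<alpha> * (s - y) powr (\<alpha> - 1) * exp (- lam * (s - y))"
      by (rule Lim_transform_eventually)
    then show ?thesis using True by (simp add: x_def)
  qed
qed

text \<open>The constants of the majorant are kept abstract; they enter the estimates only through the
  domination property.\<close>

locale dominated_kernel =
  fixes \<alpha> lam C \<theta> \<kappa> :: real
  assumes alpha: "\<alpha> > 0" and lam: "lam > 0" and theta: "0 < \<theta>" "\<theta> \<le> 1" and kappa: "\<kappa> > 0" and C: "C \<ge> 0"
    and dominated: "\<And>n j u. n > 0 \<Longrightarrow> \<bar>of_int j - real n * u\<bar> \<le> 3 \<Longrightarrow> u \<noteq> 0 \<Longrightarrow>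
      scaled_coeff \<alpha> lam n j \<le> majorant C \<theta> \<kappa> u"
begin

abbreviation win :: "real \<Rightarrow> real \<Rightarrow> real \<Rightarrow> ennreal" where "win \<equiv> window C \<theta> \<kappa>"

abbreviation limit_kernel :: "real \<Rightarrow> real \<Rightarrow> real" where
  "limit_kernel t y \<equiv> tempered_kernel (1/2 + \<alpha>) lam t y / Gamma \<alpha>"

lemma lattice_integrable:
  assumes "n > 0" "t \<in> {0..1}"
  shows "set_integrable lborel {0..t} (\<lambda>s. scaled_coeff \<alpha> lam n (\<lceil>real n * s\<rceil> - i))"
  using integral_cells(1)[of n t "\<lambda>k. scaled_coeff \<alpha> lam n (k - i)"] assms by simp

lemma lattice_kernel_0 [simp]: "lattice_kernel \<alpha> lam n 0 i = 0"
  by (simp add: lattice_kernel_def set_lebesgue_integral_def)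
     (rule integral_eq_zero_AE, use AE_lborel_singleton[of "0::real"] in eventually_elim, auto)

lemma lattice_kernel_eq:
  assumes "n > 0" "t \<in> {0..1}"
  shows "lattice_kernel \<alpha> lam n t i = (\<Sum>k\<in>{1..int n}. scaled_coeff \<alpha> lam n (k - i) * cell_weight n k t) / real n"
  unfolding lattice_kernel_def using integral_cells(2)[of n t "\<lambda>k. scaled_coeff \<alpha> lam n (k - i)"] assms by simp

lemma lattice_increment_le:
  assumes n: "n > 0" and st: "0 \<le> s" "s \<le> t" "t \<le> 1" and i: "\<bar>of_int i - real n * y\<bar> \<le> 2"
  shows "ennreal \<bar>lattice_kernel \<alpha> lam n t i - lattice_kernel \<alpha> lam n s i\<bar> \<le> win s t y"
  unfolding lattice_kernel_def
proof (rule kernel_increment_le_window[OF st(1,2)])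
  show "set_integrable lborel {0..t} (\<lambda>s. scaled_coeff \<alpha> lam n (\<lceil>real n * s\<rceil> - i))"
    by (rule lattice_integrable) (use n st in auto)
  show "scaled_coeff \<alpha> lam n (\<lceil>real n * v\<rceil> - i) \<le> majorant C \<theta> \<kappa> (v - y)" if "v \<noteq> y" for v
  proof (rule dominated[OF n])
    have "\<bar>of_int \<lceil>real n * v\<rceil> - real n * v\<bar> \<le> 1" by linarith
    then show "\<bar>of_int (\<lceil>real n * v\<rceil> - i) - real n * (v - y)\<bar> \<le> 3"
      using i by (simp add: right_diff_distrib) linarith
  qed (use that in simp)
qed (rule scaled_coeff_nonneg[OF alpha])

lemma truncated_increment_le:
  assumes n: "n > 0" and st: "0 \<le> s" "s \<le> t" "t \<le> 1" and i: "\<bar>of_int i - real n * y\<bar> \<le> 2"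
  shows "ennreal \<bar>truncated_kernel \<alpha> lam n t i - truncated_kernel \<alpha> lam n s i\<bar> \<le> win s t y"
  using lattice_increment_le[OF assms] by (simp add: truncated_kernel_def)

lemma truncated_kernel_0 [simp]: "truncated_kernel \<alpha> lam n 0 i = 0"
  by (simp add: truncated_kernel_def)

lemma lattice_tendsto:
  assumes t: "t \<in> {0..1}"
  shows "(\<lambda>n. lattice_kernel \<alpha> lam n t \<lceil>real n * y\<rceil>) \<longlonglongrightarrow> limit_kernel t y"
proof -
  define f where "f s = (if y < s then (s - y) powr (\<alpha> - 1) * exp (- lam * (s - y)) else 0) / Gamma \<alpha>" for s
  have f_meas [measurable]: "f \<in> borel_measurable borel" unfolding f_def by measurable
  have w_meas [measurable]: "(\<lambda>s. indicator {0..t} s * majorant C \<theta> \<kappa> (s - y)) \<in> borel_measurable lborel" by measurable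
  have maj_nonneg: "majorant C \<theta> \<kappa> u \<ge> 0" for u using C by (simp add: majorant_def)
  have w_int: "integrable lborel (\<lambda>s. indicator {0..t} s * majorant C \<theta> \<kappa> (s - y))"
  proof (rule integrableI_nonneg)
    have "(\<integral>\<^sup>+s. ennreal (indicator {0..t} s * majorant C \<theta> \<kappa> (s - y)) \<partial>lborel) = win 0 t y"
      unfolding window_def by (intro nn_integral_cong) (auto split: split_indicator)
    also have "\<dots> < \<infinity>"
      using window_le[OF theta less_imp_le[OF kappa] C, of 0 t y] t by (auto intro: le_less_trans)
    finally show "(\<integral>\<^sup>+s. ennreal (indicator {0..t} s * majorant C \<theta> \<kappa> (s - y)) \<partial>lborel) < \<infinity>" .
  qed (use maj_nonneg in auto)
  \<comment> \<open>the index is shifted since the domination holds for positive \<open>n\<close> only\<close>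
  have "(\<lambda>n. \<integral>s. indicator {0..t} s *\<^sub>R scaled_coeff \<alpha> lam (Suc n) (\<lceil>real (Suc n) * s\<rceil> - \<lceil>real (Suc n) * y\<rceil>) \<partial>lborel)
     \<longlonglongrightarrow> (\<integral>s. indicator {0..t} s *\<^sub>R f s \<partial>lborel)"
  proof (rule integral_dominated_convergence[OF _ _ w_int])
    show "AE s in lborel. (\<lambda>n. indicator {0..t} s *\<^sub>R scaled_coeff \<alpha> lam (Suc n) (\<lceil>real (Suc n) * s\<rceil> - \<lceil>real (Suc n) * y\<rceil>))
        \<longlonglongrightarrow> indicator {0..t} s *\<^sub>R f s"
      using AE_lborel_singleton[of y]
    proof eventually_elim
      case (elim s)
      show ?case
        using LIMSEQ_Suc[OF scaled_coeff_tendsto[OF elim]] unfolding f_def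
        by (intro tendsto_scaleR tendsto_const)
    qed
    show "AE s in lborel. norm (indicator {0..t} s *\<^sub>R scaled_coeff \<alpha> lam (Suc n) (\<lceil>real (Suc n) * s\<rceil> - \<lceil>real (Suc n) * y\<rceil>))
        \<le> indicator {0..t} s * majorant C \<theta> \<kappa> (s - y)" for n
      using AE_lborel_singleton[of y]
    proof eventually_elim
      case (elim s)
      have "\<bar>of_int \<lceil>real (Suc n) * s\<rceil> - real (Suc n) * s\<bar> \<le> 1" "\<bar>of_int \<lceil>real (Suc n) * y\<rceil> - real (Suc n) * y\<bar> \<le> 1"
        by linarith+
      then have "\<bar>of_int (\<lceil>real (Suc n) * s\<rceil> - \<lceil>real (Suc n) * y\<rceil>) - real (Suc n) * (s - y)\<bar> \<le> 3"
        unfolding right_diff_distrib of_int_diff by linarith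
      then have "scaled_coeff \<alpha> lam (Suc n) (\<lceil>real (Suc n) * s\<rceil> - \<lceil>real (Suc n) * y\<rceil>) \<le> majorant C \<theta> \<kappa> (s - y)"
        by (intro dominated) (use elim in auto)
      then show ?case using scaled_coeff_nonneg[OF alpha] by (auto split: split_indicator)
    qed
  qed measurable
  moreover have "(\<integral>s. indicator {0..t} s *\<^sub>R f s \<partial>lborel) = limit_kernel t y"
  proof -
    have "limit_kernel t y = (LINT s:{0..t}|lborel. f s)"
    proof -
      have e: "1/2 + \<alpha> - 3/2 = \<alpha> - 1" by (simp add: field_simps)
      show ?thesis unfolding tempered_kernel_def f_def e by simp
    qed
    then show ?thesis by (simp add: set_lebesgue_integral_def)
  qed
  ultimately have "(\<lambda>n. lattice_kernel \<alpha> lam (Suc n) t \<lceil>real (Suc n) * y\<rceil>) \<longlonglongrightarrow> limit_kernel t y"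
    unfolding lattice_kernel_def set_lebesgue_integral_def by simp
  then show ?thesis by (rule LIMSEQ_imp_Suc)
qed

lemma truncated_tendsto:
  assumes t: "t \<in> {0..1}"
  shows "(\<lambda>K. truncated_kernel \<alpha> lam K t \<lceil>real K * y\<rceil>) \<longlonglongrightarrow> limit_kernel t y"
proof (rule Lim_transform_eventually[OF lattice_tendsto[OF t]])
  show "\<forall>\<^sub>F K in sequentially. lattice_kernel \<alpha> lam K t \<lceil>real K * y\<rceil> = truncated_kernel \<alpha> lam K t \<lceil>real K * y\<rceil>"
    using eventually_ge_at_top[of "nat \<lceil>\<bar>y\<bar>\<rceil> + 1"]
  proof eventually_elim
    case (elim K)
    then have K: "\<bar>y\<bar> + 1 \<le> real K" "1 \<le> real K" by linarith+
    have "\<bar>of_int \<lceil>real K * y\<rceil>\<bar> \<le> \<bar>real K * y\<bar> + 1" by linarith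
    also have "\<dots> \<le> real K * \<bar>y\<bar> + real K" using K by (simp add: abs_mult)
    also have "\<dots> \<le> real K * real K" using mult_left_mono[OF K(1), of "real K"] by (simp add: algebra_simps)
    finally have "real_of_int \<bar>\<lceil>real K * y\<rceil>\<bar> \<le> real_of_int (int (K * K))" by simp
    then have "\<bar>\<lceil>real K * y\<rceil>\<bar> \<le> int (K * K)" by (simp only: of_int_le_iff)
    then show ?case by (simp add: truncated_kernel_def)
  qed
qed

lemma measurable_cells [measurable]: "(\<lambda>y. f \<lceil>real n * y\<rceil>) \<in> borel_measurable borel" for f :: "int \<Rightarrow> real"
  by measurable

lemma measurable_limit_kernel [measurable]:
  assumes "t \<in> {0..1}"
  shows "limit_kernel t \<in> borel_measurable borel"
  by (rule borel_measurable_LIMSEQ_real[OF lattice_tendsto[OF assms]]) measurable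

text \<open>Rounding \<open>y\<close> to the fine lattice first changes its coarse cell for arbitrarily large
  \<open>n\<close> only if \<open>y\<close> is a boundary point of the coarse cells.\<close>

lemma AE_coarse_cells_eventually:
  assumes K: "K > 0"
  shows "AE y in lborel. \<forall>\<^sub>F n in sequentially. \<lceil>real K * (of_int \<lceil>real n * y\<rceil> / real n)\<rceil> = \<lceil>real K * y\<rceil>"
proof -
  have "range (\<lambda>m::int. of_int m / real K) \<in> null_sets lborel"
    by (intro countable_imp_null_set_lborel) auto
  then have "AE y in lborel. y \<notin> range (\<lambda>m::int. of_int m / real K)" by (rule AE_not_in)
  then show ?thesis
  proof eventually_elim
    case (elim y)
    define m where "m = \<lceil>real K * y\<rceil>"
    have "real K * y \<noteq> of_int m"
    proof
      assume "real K * y = of_int m"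
      then have "y = of_int m / real K" using K by (simp add: field_simps)
      then show False using elim by auto
    qed
    moreover have "of_int m - 1 < real K * y" "real K * y \<le> of_int m" unfolding m_def by linarith+
    ultimately have m: "of_int m - 1 < real K * y" "real K * y < of_int m" by auto
    have lim: "(\<lambda>n. real K * (of_int \<lceil>real n * y\<rceil> / real n)) \<longlonglongrightarrow> real K * y"
      by (intro tendsto_mult tendsto_const ceiling_scaled_tendsto)
    show ?case
      using order_tendstoD(1)[OF lim m(1)] order_tendstoD(2)[OF lim m(2)]
      by eventually_elim (unfold m_def[symmetric], intro ceiling_unique, auto)
  qed
qed

lemma window_double_square_finite: "s \<le> t \<Longrightarrow> (\<integral>\<^sup>+y. (2 * win s t y)\<^sup>2 \<partial>lborel) < \<infinity>"
proof -
  assume st: "s \<le> t"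
  obtain C' where C': "(\<integral>\<^sup>+y. (win s t y)\<^sup>2 \<partial>lborel) \<le> ennreal (C' * (t - s) powr (1 + \<theta>))"
    using window_square_integral[OF theta kappa C] st by metis
  have "(\<integral>\<^sup>+y. (2 * win s t y)\<^sup>2 \<partial>lborel) = 4 * (\<integral>\<^sup>+y. (win s t y)\<^sup>2 \<partial>lborel)"
    by (subst nn_integral_cmult[symmetric]) (auto simp: power_mult_distrib)
  also have "\<dots> < \<infinity>" using C' by (auto simp: ennreal_mult_less_top intro: le_less_trans)
  finally show ?thesis .
qed

end

lemma coarse_cell_dist:
  assumes "0 < K" "K \<le> n"
  shows "\<bar>of_int \<lceil>real K * (of_int \<lceil>real n * y\<rceil> / real n)\<rceil> - real K * y\<bar> \<le> 2"
proof -
  define P where "P = real K * (of_int \<lceil>real n * y\<rceil> / real n)"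
  define Q where "Q = real K * y"
  have "P - Q = (real K / real n) * (of_int \<lceil>real n * y\<rceil> - real n * y)"
    using assms by (simp add: P_def Q_def field_simps)
  moreover have "\<bar>(real K / real n) * (of_int \<lceil>real n * y\<rceil> - real n * y)\<bar> \<le> 1 * 1"
    unfolding abs_mult using assms by (intro mult_mono) (auto, linarith)
  ultimately have "\<bar>P - Q\<bar> \<le> 1" by (simp only: mult_1)
  moreover have "\<bar>of_int \<lceil>P\<rceil> - P\<bar> \<le> 1" by linarith
  ultimately have "\<bar>of_int \<lceil>P\<rceil> - Q\<bar> \<le> 2" by linarith
  then show ?thesis by (simp only: P_def Q_def)
qed

context dominated_kernel
begin

text \<open>The difference, at the lattice point \<open>j/n\<close>, of the true kernel and the coarse step function.\<close>

definition coarse_error :: "nat \<Rightarrow> nat \<Rightarrow> real \<Rightarrow> int \<Rightarrow> real" where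
  "coarse_error n K t j = lattice_kernel \<alpha> lam n t j - truncated_kernel \<alpha> lam K t \<lceil>real K * (of_int j / real n)\<rceil>"

definition limit_error :: "nat \<Rightarrow> real \<Rightarrow> real \<Rightarrow> real" where
  "limit_error K t y = limit_kernel t y - truncated_kernel \<alpha> lam K t \<lceil>real K * y\<rceil>"

lemma limit_increment_le:
  assumes st: "0 \<le> s" "s \<le> t" "t \<le> 1"
  shows "ennreal \<bar>limit_kernel t y - limit_kernel s y\<bar> \<le> win s t y"
proof (rule tendsto_upperbound)
  show "(\<lambda>n. ennreal \<bar>lattice_kernel \<alpha> lam n t \<lceil>real n * y\<rceil> - lattice_kernel \<alpha> lam n s \<lceil>real n * y\<rceil>\<bar>)
      \<longlonglongrightarrow> ennreal \<bar>limit_kernel t y - limit_kernel s y\<bar>"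
    by (intro tendsto_ennrealI tendsto_rabs tendsto_diff lattice_tendsto) (use st in auto)
  show "\<forall>\<^sub>F n in sequentially. ennreal \<bar>lattice_kernel \<alpha> lam n t \<lceil>real n * y\<rceil> - lattice_kernel \<alpha> lam n s \<lceil>real n * y\<rceil>\<bar> \<le> win s t y"
    using eventually_gt_at_top[of 0]
  proof eventually_elim
    case (elim n)
    have "\<bar>of_int \<lceil>real n * y\<rceil> - real n * y\<bar> \<le> 2" by linarith
    then show ?case by (rule lattice_increment_le[OF elim st])
  qed
qed simp

lemma limit_kernel_0 [simp]: "limit_kernel 0 y = 0"
proof -
  have "(\<lambda>n. 0) \<longlonglongrightarrow> limit_kernel 0 y" using lattice_tendsto[of 0 y] by simp
  then show ?thesis using LIMSEQ_unique tendsto_const by blast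
qed

lemma coarse_error_0 [simp]: "coarse_error n K 0 j = 0"
  by (simp add: coarse_error_def)

lemma limit_error_0 [simp]: "limit_error K 0 y = 0"
  unfolding limit_error_def by (simp only: limit_kernel_0 truncated_kernel_0 diff_self)

lemma truncated_cell_increment_le:
  assumes K: "0 < K" and st: "0 \<le> s" "s \<le> t" "t \<le> 1"
  shows "ennreal \<bar>truncated_kernel \<alpha> lam K t \<lceil>real K * y\<rceil> - truncated_kernel \<alpha> lam K s \<lceil>real K * y\<rceil>\<bar> \<le> win s t y"
proof (rule truncated_increment_le[OF K st])
  show "\<bar>of_int \<lceil>real K * y\<rceil> - real K * y\<bar> \<le> 2" by linarith
qed

lemma coarse_error_increment_le:
  assumes K: "0 < K" "K \<le> n" and st: "0 \<le> s" "s \<le> t" "t \<le> 1"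
  shows "ennreal \<bar>coarse_error n K t \<lceil>real n * y\<rceil> - coarse_error n K s \<lceil>real n * y\<rceil>\<bar> \<le> 2 * win s t y"
proof -
  let ?i = "\<lceil>real n * y\<rceil>" and ?m = "\<lceil>real K * (of_int \<lceil>real n * y\<rceil> / real n)\<rceil>"
  have n: "0 < n" using K by simp
  have 1: "ennreal \<bar>lattice_kernel \<alpha> lam n t ?i - lattice_kernel \<alpha> lam n s ?i\<bar> \<le> win s t y"
    by (rule lattice_increment_le[OF n st]) linarith
  have 2: "ennreal \<bar>truncated_kernel \<alpha> lam K t ?m - truncated_kernel \<alpha> lam K s ?m\<bar> \<le> win s t y"
    by (rule truncated_increment_le[OF K(1) st coarse_cell_dist[OF K]])
  have "coarse_error n K t ?i - coarse_error n K s ?i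
    = (lattice_kernel \<alpha> lam n t ?i - lattice_kernel \<alpha> lam n s ?i) - (truncated_kernel \<alpha> lam K t ?m - truncated_kernel \<alpha> lam K s ?m)"
    by (simp add: coarse_error_def)
  then show ?thesis using ennreal_abs_diff_le_double[OF 1 2] by (simp only:)
qed

lemma limit_error_increment_le:
  assumes K: "0 < K" and st: "0 \<le> s" "s \<le> t" "t \<le> 1"
  shows "ennreal \<bar>limit_error K t y - limit_error K s y\<bar> \<le> 2 * win s t y"
proof -
  have "limit_error K t y - limit_error K s y = (limit_kernel t y - limit_kernel s y)
      - (truncated_kernel \<alpha> lam K t \<lceil>real K * y\<rceil> - truncated_kernel \<alpha> lam K s \<lceil>real K * y\<rceil>)"
    unfolding limit_error_def by simp
  then show ?thesis
    using ennreal_abs_diff_le_double[OF limit_increment_le[OF st] truncated_cell_increment_le[OF K st]] by (simp only:)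
qed

lemma square_integral_le_window:
  assumes "\<And>y. ennreal \<bar>f y\<bar> \<le> 2 * win s t y"
  shows "mean_square lborel f \<le> 4 * (\<integral>\<^sup>+y. (win s t y)\<^sup>2 \<partial>lborel)"
proof -
  have "mean_square lborel f \<le> (\<integral>\<^sup>+y. 4 * (win s t y)\<^sup>2 \<partial>lborel)"
  proof (rule nn_integral_mono)
    fix y
    have "ennreal ((f y)\<^sup>2) = (ennreal \<bar>f y\<bar>)\<^sup>2" by (simp add: ennreal_power)
    also have "\<dots> \<le> (2 * win s t y)\<^sup>2" by (intro power_mono assms) auto
    finally show "ennreal ((f y)\<^sup>2) \<le> 4 * (win s t y)\<^sup>2" by (simp add: power_mult_distrib)
  qed
  then show ?thesis by (simp add: nn_integral_cmult)
qed

lemma measurable_limit_error [measurable]: "t \<in> {0..1} \<Longrightarrow> limit_error K t \<in> borel_measurable borel"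
  unfolding limit_error_def[abs_def] by measurable

text \<open>Dominated convergence, with twice the window over \<open>[0,t]\<close> as dominating function.\<close>

lemma limit_error_tendsto_0:
  assumes t: "t \<in> {0..1}"
  shows "(\<lambda>K. mean_square lborel (\<lambda>y. limit_error K t y)) \<longlonglongrightarrow> 0"
proof -
  have "(\<lambda>K. mean_square lborel (\<lambda>y. limit_error K t y)) \<longlonglongrightarrow> (\<integral>\<^sup>+(y::real). ennreal (0\<^sup>2) \<partial>lborel)"
  proof (rule nn_integral_square_dominated[where w = "\<lambda>y. 2 * win 0 t y"])
    show "\<forall>\<^sub>F K in sequentially. \<forall>y. ennreal \<bar>limit_error K t y\<bar> \<le> 2 * win 0 t y"
      using eventually_gt_at_top[of 0]
    proof eventually_elim
      case (elim K)
      show ?case using limit_error_increment_le[OF elim, of 0 t] t by simp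
    qed
    show "AE y in lborel. (\<lambda>K. limit_error K t y) \<longlonglongrightarrow> 0"
    proof (rule AE_I2)
      fix y
      have "(\<lambda>K. limit_error K t y) \<longlonglongrightarrow> limit_kernel t y - limit_kernel t y"
        unfolding limit_error_def by (intro tendsto_diff tendsto_const truncated_tendsto t)
      then show "(\<lambda>K. limit_error K t y) \<longlonglongrightarrow> 0" by simp
    qed
    show "(\<integral>\<^sup>+y. (2 * win 0 t y)\<^sup>2 \<partial>lborel) < \<infinity>" using t by (intro window_double_square_finite) auto
  qed (use t in measurable)
  then show ?thesis by simp
qed

text \<open>Pointwise convergence can fail only at boundary points of the coarse cells, which form a null set.\<close>

lemma coarse_error_tendsto:
  assumes t: "t \<in> {0..1}" and K: "0 < K"
  shows "(\<lambda>n. mean_square lborel (\<lambda>y. coarse_error n K t \<lceil>real n * y\<rceil>)) \<longlonglongrightarrow> mean_square lborel (\<lambda>y. limit_error K t y)"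
proof (rule nn_integral_square_dominated[where w = "\<lambda>y. 2 * win 0 t y"])
  show "\<forall>\<^sub>F n in sequentially. \<forall>y. ennreal \<bar>coarse_error n K t \<lceil>real n * y\<rceil>\<bar> \<le> 2 * win 0 t y"
    using eventually_ge_at_top[of K]
  proof eventually_elim
    case (elim n)
    show ?case using coarse_error_increment_le[OF K elim, of 0 t] t by simp
  qed
  show "AE y in lborel. (\<lambda>n. coarse_error n K t \<lceil>real n * y\<rceil>) \<longlonglongrightarrow> limit_error K t y"
    using AE_coarse_cells_eventually[OF K]
  proof eventually_elim
    case (elim y)
    have "\<forall>\<^sub>F n in sequentially. truncated_kernel \<alpha> lam K t \<lceil>real K * y\<rceil>
        = truncated_kernel \<alpha> lam K t \<lceil>real K * (of_int \<lceil>real n * y\<rceil> / real n)\<rceil>"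
      using elim by eventually_elim simp
    then have "(\<lambda>n. truncated_kernel \<alpha> lam K t \<lceil>real K * (of_int \<lceil>real n * y\<rceil> / real n)\<rceil>) \<longlonglongrightarrow> truncated_kernel \<alpha> lam K t \<lceil>real K * y\<rceil>"
      by (rule Lim_transform_eventually[OF tendsto_const])
    then show ?case
      unfolding coarse_error_def limit_error_def by (intro tendsto_diff lattice_tendsto t)
  qed
  show "(\<integral>\<^sup>+y. (2 * win 0 t y)\<^sup>2 \<partial>lborel) < \<infinity>" using t by (intro window_double_square_finite) auto
qed (use t in measurable)

end

section \<open>Approximation of the partial sums by finitely many blocks\<close>

lemma powr_minus_half_add:
  fixes a :: real
  assumes n: "n > 0"
  shows "real n powr (- (1/2 + a)) = real n powr (1 - a) / real n / sqrt (real n)"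
proof -
  have e: "- (1/2 + a) = (1 - a) + ((- 1) + (- (1/2)))" by linarith
  have p1: "real n powr (- 1) = inverse (real n)" using n powr_minus[of "real n" 1] by simp
  have p2: "real n powr (- (1/2)) = inverse (sqrt (real n))"
    using n powr_minus[of "real n" "1/2"] powr_half_sqrt[of "real n"] by simp
  have "real n powr (- (1/2 + a)) = real n powr ((1 - a) + ((- 1) + (- (1/2))))"
    by (rule arg_cong[OF e])
  also have "\<dots> = real n powr (1 - a) * real n powr ((- 1) + (- (1/2)))" by (rule powr_add)
  also have "real n powr ((- 1) + (- (1/2))) = real n powr (- 1) * real n powr (- (1/2))" by (rule powr_add)
  finally show ?thesis unfolding p1 p2 by (simp only: divide_inverse mult.assoc)
qed

lemma continuous_cell_weight: "continuous_on S (cell_weight n k)"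
  unfolding cell_weight_def[abs_def] by (intro continuous_intros)

text \<open>The numbers \<open>i < 2K\<^sup>2 + 1\<close> enumerate the cells \<open>-K\<^sup>2, ..., K\<^sup>2\<close>. Natural numbers are used as
  the definition of a Gaussian random measure speaks of sequences of sets.\<close>

definition cell_number :: "nat \<Rightarrow> nat \<Rightarrow> int" where
  "cell_number K i = int i - int (K * K)"

text \<open>The \<open>j\<close> with \<open>j/n\<close> in the cell \<open>((m-1)/K, m/K]\<close>, written as an interval in order to be finite
  for \<open>n = 0\<close> as well.\<close>

definition block :: "nat \<Rightarrow> nat \<Rightarrow> int \<Rightarrow> int set" where
  "block n K m = {\<lfloor>(of_int m - 1) / real K * real n\<rfloor> + 1 .. \<lfloor>of_int m / real K * real n\<rfloor>}"

lemma mem_block_iff: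
  assumes "n > 0" "K > 0"
  shows "j \<in> block n K m \<longleftrightarrow> \<lceil>real K * (of_int j / real n)\<rceil> = m"
proof -
  have 1: "\<lfloor>(of_int m - 1) / real K * real n\<rfloor> + 1 \<le> j \<longleftrightarrow> of_int m - 1 < real K * (of_int j / real n)"
  proof -
    have "\<lfloor>(of_int m - 1) / real K * real n\<rfloor> + 1 \<le> j \<longleftrightarrow> (of_int m - 1) / real K * real n < of_int j"
      by (simp add: floor_less_iff add1_zle_eq)
    also have "\<dots> \<longleftrightarrow> of_int m - 1 < real K * (of_int j / real n)" using assms by (simp add: field_simps)
    finally show ?thesis .
  qed
  have 2: "j \<le> \<lfloor>of_int m / real K * real n\<rfloor> \<longleftrightarrow> real K * (of_int j / real n) \<le> of_int m"
    using assms by (simp add: le_floor_iff field_simps)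
  show ?thesis unfolding block_def atLeastAtMost_iff 1 2 by (auto simp: ceiling_eq_iff)
qed

lemma finite_block [simp]: "finite (block n K m)"
  by (simp add: block_def)

lemma block_disjoint:
  assumes "K > 0"
  shows "disjoint_family_on (\<lambda>i. block n K (cell_number K i)) I"
proof (cases "n = 0")
  case False
  then show ?thesis
    using mem_block_iff[of n K] assms by (auto simp: disjoint_family_on_def cell_number_def)
qed (simp add: disjoint_family_on_def block_def)

lemma card_block_tendsto:
  assumes "K > 0"
  shows "(\<lambda>n. real (card (block n K m)) / real n) \<longlonglongrightarrow> 1 / real K"
proof -
  have fl: "(\<lambda>n. of_int \<lfloor>x * real n\<rfloor> / real n) \<longlonglongrightarrow> x" for x :: real
  proof (rule LIM_zero_cancel, rule Lim_null_comparison)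
    show "\<forall>\<^sub>F n in sequentially. norm (of_int \<lfloor>x * real n\<rfloor> / real n - x) \<le> 1 / real n"
      using eventually_gt_at_top[of 0]
    proof eventually_elim
      case (elim n)
      have "of_int \<lfloor>x * real n\<rfloor> / real n - x = (of_int \<lfloor>x * real n\<rfloor> - x * real n) / real n"
        using elim by (simp add: field_simps)
      moreover have "\<bar>of_int \<lfloor>x * real n\<rfloor> - x * real n\<bar> \<le> 1" by linarith
      ultimately show ?case using elim by (simp add: divide_right_mono)
    qed
  qed (rule lim_1_over_n)
  have "(\<lambda>n. of_int \<lfloor>of_int m / real K * real n\<rfloor> / real n - of_int \<lfloor>(of_int m - 1) / real K * real n\<rfloor> / real n)
      \<longlonglongrightarrow> of_int m / real K - (of_int m - 1) / real K"
    by (intro tendsto_diff fl)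
  moreover have "real (card (block n K m)) / real n
    = of_int \<lfloor>of_int m / real K * real n\<rfloor> / real n - of_int \<lfloor>(of_int m - 1) / real K * real n\<rfloor> / real n" for n
  proof -
    have "\<lfloor>(of_int m - 1) / real K * real n\<rfloor> \<le> \<lfloor>of_int m / real K * real n\<rfloor>"
      using assms by (intro floor_mono mult_right_mono divide_right_mono) auto
    then show ?thesis by (simp add: block_def diff_divide_distrib)
  qed
  moreover have "of_int m / real K - (of_int m - 1) / real K = 1 / real K" by (simp add: diff_divide_distrib)
  ultimately show ?thesis by simp
qed

context dominated_kernel
begin

lemma continuous_lattice_kernel: "n > 0 \<Longrightarrow> continuous_on {0..1} (\<lambda>t. lattice_kernel \<alpha> lam n t i)"
proof -
  assume n: "n > 0"
  have "continuous_on {0..1} (\<lambda>t. (\<Sum>k\<in>{1..int n}. scaled_coeff \<alpha> lam n (k - i) * cell_weight n k t) / real n)"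
    by (intro continuous_intros continuous_cell_weight) (use n in auto)
  then show ?thesis
    by (rule continuous_on_cong[THEN iffD2, rotated 2]) (auto simp: lattice_kernel_eq[OF n])
qed

end

locale artfima_limit = iid_noise M Z \<sigma> + dominated_kernel \<alpha> lam C \<theta> \<kappa>
  for M :: "'a measure" and Z :: "int \<Rightarrow> 'a \<Rightarrow> real" and \<sigma> \<alpha> lam C \<theta> \<kappa> :: real
begin

definition scaled_sum :: "nat \<Rightarrow> real \<Rightarrow> 'a \<Rightarrow> real" where
  "scaled_sum n t \<omega> = real n powr (- (1/2 + \<alpha>)) * artfima_sum \<alpha> (lam / real n) Z (real n * t) \<omega>"

definition block_noise :: "nat \<Rightarrow> nat \<Rightarrow> nat \<Rightarrow> 'a \<Rightarrow> real" where
  "block_noise n K i \<omega> = (\<Sum>j\<in>block n K (cell_number K i). Z j \<omega>) / sqrt (real n)"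

definition coarse_sum :: "nat \<Rightarrow> nat \<Rightarrow> real \<Rightarrow> 'a \<Rightarrow> real" where
  "coarse_sum n K t \<omega> = (\<Sum>i<2*(K*K)+1. block_noise n K i \<omega> * lattice_kernel \<alpha> lam K t (cell_number K i))"

lemma measurable_artfima [measurable]: "artfima \<alpha> \<mu> Z k \<in> borel_measurable M"
  unfolding artfima_def[abs_def] by measurable

lemma scaled_sum_eq:
  assumes "t \<in> {0..1}"
  shows "scaled_sum n t \<omega> = (\<Sum>k\<in>{1..int n}. (real n powr (- (1/2 + \<alpha>)) * cell_weight n k t) * artfima \<alpha> (lam / real n) Z k \<omega>)"
  unfolding scaled_sum_def using assms
  by (subst artfima_sum_eq_weighted_sum) (auto simp: sum_distrib_left mult.assoc)

lemma measurable_scaled_sum [measurable]: "scaled_sum n t \<in> borel_measurable M"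
  unfolding scaled_sum_def[abs_def] artfima_sum_def by measurable

lemma continuous_scaled_sum: "continuous_on {0..1} (\<lambda>t. scaled_sum n t \<omega>)"
proof -
  have "continuous_on {0..1} (\<lambda>t. \<Sum>k\<in>{1..int n}. (real n powr (- (1/2 + \<alpha>)) * cell_weight n k t) * artfima \<alpha> (lam / real n) Z k \<omega>)"
    by (intro continuous_intros continuous_cell_weight)
  then show ?thesis
    by (rule continuous_on_cong[THEN iffD2, rotated 2]) (auto simp: scaled_sum_eq)
qed

lemma measurable_coarse_sum [measurable]: "coarse_sum n K t \<in> borel_measurable M"
  unfolding coarse_sum_def[abs_def] block_noise_def by measurable

lemma continuous_coarse_sum: "K > 0 \<Longrightarrow> continuous_on {0..1} (\<lambda>t. coarse_sum n K t \<omega>)"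
  unfolding coarse_sum_def by (intro continuous_intros continuous_lattice_kernel)

lemma coarse_sum_eq:
  assumes n: "n > 0" and K: "K > 0"
  obtains A where "finite A" "\<And>t j. j \<notin> A \<Longrightarrow> truncated_kernel \<alpha> lam K t \<lceil>real K * (of_int j / real n)\<rceil> = 0"
    "\<And>t \<omega>. coarse_sum n K t \<omega> = (\<Sum>j\<in>A. truncated_kernel \<alpha> lam K t \<lceil>real K * (of_int j / real n)\<rceil> / sqrt (real n) * Z j \<omega>)"
proof (rule that)
  define I where "I = {..<2*(K*K)+1}"
  define A where "A = (\<Union>i\<in>I. block n K (cell_number K i))"
  show "finite A" by (auto simp: A_def I_def)
  have inI: "\<bar>cell_number K i\<bar> \<le> int (K * K)" if "i \<in> I" for i
  proof -
    have "\<bar>int i - int q\<bar> \<le> int q" if "i < 2 * q + 1" for q :: nat using that by linarith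
    then show ?thesis using that unfolding I_def cell_number_def lessThan_iff by blast
  qed
  show "truncated_kernel \<alpha> lam K t \<lceil>real K * (of_int j / real n)\<rceil> = 0" if j: "j \<notin> A" for t j
  proof (rule ccontr)
    let ?m = "\<lceil>real K * (of_int j / real n)\<rceil>"
    assume "truncated_kernel \<alpha> lam K t ?m \<noteq> 0"
    then have m: "\<bar>?m\<bar> \<le> int (K * K)" by (auto simp: truncated_kernel_def split: if_splits)
    define i where "i = nat (?m + int (K * K))"
    have "int (nat (l + int q)) - int q = l \<and> nat (l + int q) < 2 * q + 1" if "\<bar>l\<bar> \<le> int q" for l :: int and q :: nat
      using that by linarith
    then have i: "cell_number K i = ?m" "i \<in> I"
      using m unfolding i_def cell_number_def I_def lessThan_iff by blast+
    have "j \<in> block n K (cell_number K i)" unfolding i(1) mem_block_iff[OF n K] ..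
    then show False using j i(2) by (auto simp: A_def)
  qed
  show "coarse_sum n K t \<omega> = (\<Sum>j\<in>A. truncated_kernel \<alpha> lam K t \<lceil>real K * (of_int j / real n)\<rceil> / sqrt (real n) * Z j \<omega>)" for t \<omega>
  proof -
    have "(\<Sum>j\<in>A. truncated_kernel \<alpha> lam K t \<lceil>real K * (of_int j / real n)\<rceil> / sqrt (real n) * Z j \<omega>)
      = (\<Sum>i\<in>I. \<Sum>j\<in>block n K (cell_number K i). truncated_kernel \<alpha> lam K t \<lceil>real K * (of_int j / real n)\<rceil> / sqrt (real n) * Z j \<omega>)"
      unfolding A_def
      by (rule sum.UNION_disjoint) (use block_disjoint[OF K, of n I] in \<open>auto simp: I_def disjoint_family_on_def\<close>)
    also have "\<dots> = (\<Sum>i\<in>I. block_noise n K i \<omega> * lattice_kernel \<alpha> lam K t (cell_number K i))"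
    proof (intro sum.cong refl)
      fix i assume i: "i \<in> I"
      have "(\<Sum>j\<in>block n K (cell_number K i). truncated_kernel \<alpha> lam K t \<lceil>real K * (of_int j / real n)\<rceil> / sqrt (real n) * Z j \<omega>)
        = (\<Sum>j\<in>block n K (cell_number K i). lattice_kernel \<alpha> lam K t (cell_number K i) / sqrt (real n) * Z j \<omega>)"
        using inI[OF i] by (intro sum.cong refl) (simp add: mem_block_iff[OF n K] truncated_kernel_def)
      also have "\<dots> = block_noise n K i \<omega> * lattice_kernel \<alpha> lam K t (cell_number K i)"
        
        unfolding block_noise_def sum_divide_distrib sum_distrib_right by (intro sum.cong) auto
      finally show "(\<Sum>j\<in>block n K (cell_number K i). truncated_kernel \<alpha> lam K t \<lceil>real K * (of_int j / real n)\<rceil> / sqrt (real n) * Z j \<omega>)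
        = block_noise n K i \<omega> * lattice_kernel \<alpha> lam K t (cell_number K i)" .
    qed
    finally show ?thesis by (simp add: coarse_sum_def I_def)
  qed
qed

text \<open>Both processes are linear forms in the noise, and the sum of the squared coefficients of
  their difference is the integral of a step function with cells of length \<open>1/n\<close>.\<close>

lemma discrete_error_second_moment:
  assumes n: "n > 0" and K: "K > 0" and t: "t \<in> {0..1}" and s: "s \<in> {0..1}"
  shows "mean_square M (\<lambda>\<omega>. (scaled_sum n t \<omega> - coarse_sum n K t \<omega>) - (scaled_sum n s \<omega> - coarse_sum n K s \<omega>))
    \<le> ennreal (\<sigma>\<^sup>2) * mean_square lborel (\<lambda>y. coarse_error n K t \<lceil>real n * y\<rceil> - coarse_error n K s \<lceil>real n * y\<rceil>)"
    (is "_ \<le> ?R")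
proof -
  obtain A where A: "finite A" "\<And>t j. j \<notin> A \<Longrightarrow> truncated_kernel \<alpha> lam K t \<lceil>real K * (of_int j / real n)\<rceil> = 0"
    "\<And>t \<omega>. coarse_sum n K t \<omega> = (\<Sum>j\<in>A. truncated_kernel \<alpha> lam K t \<lceil>real K * (of_int j / real n)\<rceil> / sqrt (real n) * Z j \<omega>)"
    using coarse_sum_eq[OF n K] by blast
  define b where "b j = artfima_coeff \<alpha> j * exp (- (lam / real n) * real j)" for j
  define w where "w k = real n powr (- (1/2 + \<alpha>)) * (cell_weight n k t - cell_weight n k s)" for k
  define \<tau> where "\<tau> t j = truncated_kernel \<alpha> lam K t \<lceil>real K * (of_int j / real n)\<rceil>" for t j
  define e where "e j = (\<tau> t j - \<tau> s j) / sqrt (real n)" for j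
  define c where "c i = (\<Sum>k\<in>{1..int n}. w k * (if k - i < 0 then 0 else b (nat (k - i))))" for i
  have c: "c i = (lattice_kernel \<alpha> lam n t i - lattice_kernel \<alpha> lam n s i) / sqrt (real n)" for i
  proof -
    have p: "real n powr (- (1/2 + \<alpha>)) = real n powr (1 - \<alpha>) / real n / sqrt (real n)"
      by (rule powr_minus_half_add[OF n])
    have sc: "real n powr (1 - \<alpha>) * (if k - i < 0 then 0 else b (nat (k - i))) = scaled_coeff \<alpha> lam n (k - i)" for k
      by (auto simp: scaled_coeff_def b_def)
    have "c i = (\<Sum>k\<in>{1..int n}. scaled_coeff \<alpha> lam n (k - i) * (cell_weight n k t - cell_weight n k s) / real n / sqrt (real n))"
      unfolding c_def
    proof (intro sum.cong refl)
      fix k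
      have "w k * (if k - i < 0 then 0 else b (nat (k - i)))
        = (real n powr (1 - \<alpha>) * (if k - i < 0 then 0 else b (nat (k - i)))) * (cell_weight n k t - cell_weight n k s) / real n / sqrt (real n)"
      proof -
        have alg: "x / y / z * d * v = x * v * d / y / z" for x y z d v :: real by simp
        show ?thesis unfolding w_def p by (rule alg)
      qed
      then show "w k * (if k - i < 0 then 0 else b (nat (k - i)))
        = scaled_coeff \<alpha> lam n (k - i) * (cell_weight n k t - cell_weight n k s) / real n / sqrt (real n)"
        unfolding sc .
    qed
    also have "\<dots> = (lattice_kernel \<alpha> lam n t i - lattice_kernel \<alpha> lam n s i) / sqrt (real n)"
      unfolding lattice_kernel_eq[OF n t] lattice_kernel_eq[OF n s]
      by (simp only: sum_divide_distrib[symmetric] right_diff_distrib sum_subtractf diff_divide_distrib)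
    finally show ?thesis .
  qed
  have eq: "(scaled_sum n t \<omega> - coarse_sum n K t \<omega>) - (scaled_sum n s \<omega> - coarse_sum n K s \<omega>)
    = (\<Sum>k\<in>{1..int n}. w k * (\<Sum>j. b j * Z (k - int j) \<omega>)) - (\<Sum>i\<in>A. e i * Z i \<omega>)" for \<omega>
  proof -
    have "scaled_sum n t \<omega> - scaled_sum n s \<omega> = (\<Sum>k\<in>{1..int n}. w k * artfima \<alpha> (lam / real n) Z k \<omega>)"
      unfolding scaled_sum_eq[OF t] scaled_sum_eq[OF s] w_def
      by (simp add: sum_subtractf[symmetric] left_diff_distrib right_diff_distrib)
    moreover have "coarse_sum n K t \<omega> - coarse_sum n K s \<omega> = (\<Sum>i\<in>A. e i * Z i \<omega>)"
      unfolding A(3) e_def \<tau>_def by (simp add: sum_subtractf[symmetric] left_diff_distrib diff_divide_distrib)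
    ultimately show ?thesis by (simp add: artfima_def b_def)
  qed
  have "mean_square M (\<lambda>\<omega>. (\<Sum>k\<in>{1..int n}. w k * (\<Sum>j. b j * Z (k - int j) \<omega>)) - (\<Sum>i\<in>A. e i * Z i \<omega>)) \<le> ?R"
  proof (rule moving_average_second_moment)
    show "summable (\<lambda>j. \<bar>b j\<bar>)"
      unfolding b_def by (rule summable_artfima_coeff[OF alpha]) (use lam n in simp)
    show "finite A" by (rule A(1))
    show "e i = 0" if "i \<notin> A" for i using A(2)[OF that] by (simp add: e_def \<tau>_def)
    fix F :: "int set" assume F: "finite F"
    have "(c i - e i)\<^sup>2 = (coarse_error n K t i - coarse_error n K s i)\<^sup>2 / real n" for i
      unfolding c e_def coarse_error_def \<tau>_def[symmetric] diff_divide_distrib[symmetric]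
      using n by (simp add: power_divide algebra_simps)
    then have "ennreal (\<sigma>\<^sup>2 * (\<Sum>i\<in>F. (c i - e i)\<^sup>2)) = ennreal (\<sigma>\<^sup>2) * ennreal ((\<Sum>i\<in>F. (coarse_error n K t i - coarse_error n K s i)\<^sup>2) / real n)"
      by (simp add: ennreal_mult[symmetric] sum_nonneg sum_divide_distrib)
    also have "\<dots> \<le> ?R"
      by (intro mult_left_mono sum_cells_le n F) auto
    finally show "ennreal (\<sigma>\<^sup>2 * (\<Sum>i\<in>F. ((\<Sum>k\<in>{1..int n}. w k * (if k - i < 0 then 0 else b (nat (k - i)))) - e i)\<^sup>2)) \<le> ?R"
      unfolding c_def .
  qed simp
  then show ?thesis unfolding eq .
qed

lemma scaled_sum_0 [simp]: "scaled_sum n 0 \<omega> = 0"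
  by (simp add: scaled_sum_def artfima_sum_def)

lemma coarse_sum_0 [simp]: "coarse_sum n K 0 \<omega> = 0"
  by (simp add: coarse_sum_def)

text \<open>The increments of the difference are controlled by the window bound uniformly in \<open>n\<close>; on the
  dyadic grid its second moments converge, as \<open>n \<rightarrow> \<infinity>\<close>, to values below \<open>\<eta>\<close>.\<close>

theorem discrete_approximation:
  assumes C': "\<And>s t. s \<le> t \<Longrightarrow> (\<integral>\<^sup>+y. (win s t y)\<^sup>2 \<partial>lborel) \<le> ennreal (C' * (t - s) powr (1 + \<theta>))" "C' \<ge> 0"
    and K: "K > 0" and tau: "\<tau> > 0" and eta: "\<eta> > 0"
    and grid: "\<And>j. j \<le> 2 ^ m \<Longrightarrow> ennreal (\<sigma>\<^sup>2) * mean_square lborel (\<lambda>y. limit_error K (real j / 2 ^ m) y) < ennreal \<eta>"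
  shows "\<forall>\<^sub>F n in sequentially. (\<integral>\<^sup>+\<omega>. sup01 (\<lambda>t. scaled_sum n t \<omega> - coarse_sum n K t \<omega>) \<partial>M)
    \<le> ennreal (real (2 ^ m + 1) * (\<tau> + \<eta> / \<tau>)) + chaining_tail (4 * \<sigma>\<^sup>2 * C') (1 + \<theta>) m"
proof -
  have "\<forall>\<^sub>F n in sequentially. ennreal (\<sigma>\<^sup>2) * mean_square lborel (\<lambda>y. coarse_error n K (real j / 2 ^ m) \<lceil>real n * y\<rceil>) < ennreal \<eta>"
    if "j \<in> {..2^m}" for j
  proof -
    have j: "j \<le> 2 ^ m" using that by simp
    have "(\<lambda>n. ennreal (\<sigma>\<^sup>2) * mean_square lborel (\<lambda>y. coarse_error n K (real j / 2 ^ m) \<lceil>real n * y\<rceil>))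
      \<longlonglongrightarrow> ennreal (\<sigma>\<^sup>2) * mean_square lborel (\<lambda>y. limit_error K (real j / 2 ^ m) y)"
      by (rule ennreal_tendsto_cmult[OF _ coarse_error_tendsto[OF dyadic_in_unit[OF j] K]]) simp
    then show ?thesis by (rule order_tendstoD(2)) (rule grid[OF j])
  qed
  then have "\<forall>\<^sub>F n in sequentially. \<forall>j\<in>{..2^m}. ennreal (\<sigma>\<^sup>2) * mean_square lborel (\<lambda>y. coarse_error n K (real j / 2 ^ m) \<lceil>real n * y\<rceil>) < ennreal \<eta>"
    by (intro eventually_ball_finite) auto
  then show ?thesis
    using eventually_ge_at_top[of K]
  proof eventually_elim
    case (elim n)
    have n: "n > 0" using elim K by simp
    show ?case
    proof (rule expected_supremum_le[OF prob_space_axioms])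
      fix s t :: real assume st: "0 \<le> s" "s \<le> t" "t \<le> 1"
      have "mean_square M (\<lambda>\<omega>. (scaled_sum n t \<omega> - coarse_sum n K t \<omega>) - (scaled_sum n s \<omega> - coarse_sum n K s \<omega>))
        \<le> ennreal (\<sigma>\<^sup>2) * mean_square lborel (\<lambda>y. coarse_error n K t \<lceil>real n * y\<rceil> - coarse_error n K s \<lceil>real n * y\<rceil>)"
        by (rule discrete_error_second_moment) (use st n K in auto)
      also have "\<dots> \<le> ennreal (\<sigma>\<^sup>2) * (4 * ennreal (C' * (t - s) powr (1 + \<theta>)))"
      proof (rule mult_left_mono)
        have "mean_square lborel (\<lambda>y. coarse_error n K t \<lceil>real n * y\<rceil> - coarse_error n K s \<lceil>real n * y\<rceil>)
          \<le> 4 * (\<integral>\<^sup>+y. (win s t y)\<^sup>2 \<partial>lborel)"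
          by (rule square_integral_le_window) (rule coarse_error_increment_le[OF K elim(2) st])
        also have "\<dots> \<le> 4 * ennreal (C' * (t - s) powr (1 + \<theta>))"
          by (rule mult_left_mono[OF C'(1)[OF st(2)]]) simp
        finally show "mean_square lborel (\<lambda>y. coarse_error n K t \<lceil>real n * y\<rceil> - coarse_error n K s \<lceil>real n * y\<rceil>)
          \<le> 4 * ennreal (C' * (t - s) powr (1 + \<theta>))" .
      qed simp
      also have "\<dots> \<le> ennreal (4 * \<sigma>\<^sup>2 * C' * (t - s) powr (1 + \<theta>))"
        by (rule scaled_variance_le[OF C'(2)])
      finally show "mean_square M (\<lambda>\<omega>. (scaled_sum n t \<omega> - coarse_sum n K t \<omega>) - (scaled_sum n s \<omega> - coarse_sum n K s \<omega>))
        \<le> ennreal (4 * \<sigma>\<^sup>2 * C' * (t - s) powr (1 + \<theta>))" .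
    next
      fix j :: nat assume j: "j \<le> 2 ^ m"
      have "mean_square M (\<lambda>\<omega>. scaled_sum n (real j / 2 ^ m) \<omega> - coarse_sum n K (real j / 2 ^ m) \<omega>)
        \<le> ennreal (\<sigma>\<^sup>2) * mean_square lborel (\<lambda>y. coarse_error n K (real j / 2 ^ m) \<lceil>real n * y\<rceil>)"
        using discrete_error_second_moment[OF n K dyadic_in_unit[OF j], of 0] by simp
      also have "\<dots> \<le> ennreal \<eta>" using j by (intro less_imp_le bspec[OF elim(1)]) simp
      finally show "mean_square M (\<lambda>\<omega>. scaled_sum n (real j / 2 ^ m) \<omega> - coarse_sum n K (real j / 2 ^ m) \<omega>) \<le> ennreal \<eta>" .
    next
      show "(\<lambda>\<omega>. scaled_sum n t \<omega> - coarse_sum n K t \<omega>) \<in> borel_measurable M" for t by measurable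
      show "continuous_on {0..1} (\<lambda>t. scaled_sum n t \<omega> - coarse_sum n K t \<omega>)" for \<omega>
        by (intro continuous_on_diff continuous_scaled_sum continuous_coarse_sum K)
      show "0 \<le> 4 * \<sigma>\<^sup>2 * C'" using C'(2) by simp
      show "0 < \<tau>" "0 \<le> \<eta>" using tau eta by simp_all
    qed
  qed
qed

end

section \<open>Approximation of the limit process and its existence\<close>

locale gaussian_limit = gaussian_noise N "scale_measure (ennreal (\<sigma>\<^sup>2)) lborel" B + dominated_kernel \<alpha> lam C \<theta> \<kappa>
  for N :: "'b measure" and B :: "real set \<Rightarrow> 'b \<Rightarrow> real" and \<sigma> \<alpha> lam C \<theta> \<kappa> :: real
begin

definition grid_cell :: "nat \<Rightarrow> nat \<Rightarrow> real set" where
  "grid_cell K i = {(of_int (cell_number K i) - 1) / real K <.. of_int (cell_number K i) / real K}"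

definition gauss_steps :: "nat \<Rightarrow> real \<Rightarrow> (real \<times> real set) list" where
  "gauss_steps K t = map (\<lambda>i. (lattice_kernel \<alpha> lam K t (cell_number K i), grid_cell K i)) [0..<2*(K*K)+1]"

text \<open>The integral of the coarse step function against the Gaussian random measure, with the same
  coefficients as \<open>coarse_sum\<close>.\<close>

definition gauss_sum :: "nat \<Rightarrow> real \<Rightarrow> 'b \<Rightarrow> real" where
  "gauss_sum K t \<omega> = (\<Sum>i<2*(K*K)+1. B (grid_cell K i) \<omega> * lattice_kernel \<alpha> lam K t (cell_number K i))"

lemma grid_cell_finite [simp]: "grid_cell K i \<in> finite_sets (scale_measure (ennreal (\<sigma>\<^sup>2)) lborel)"
proof -
  have "emeasure lborel (grid_cell K i) < \<infinity>"
    unfolding grid_cell_def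
    by (rule le_less_trans[OF emeasure_mono[of _ "{(of_int (cell_number K i) - 1) / real K .. of_int (cell_number K i) / real K}"]])
       (auto simp: emeasure_lborel_Icc_eq)
  moreover have "grid_cell K i \<in> sets borel" by (simp add: grid_cell_def)
  ultimately show ?thesis by (simp add: finite_sets_def ennreal_mult_less_top)
qed

lemma measure_grid_cell:
  assumes "K > 0"
  shows "measure (scale_measure (ennreal (\<sigma>\<^sup>2)) lborel) (grid_cell K i) = \<sigma>\<^sup>2 * (1 / real K)"
proof -
  have "emeasure lborel (grid_cell K i) = ennreal (1 / real K)"
    using assms unfolding grid_cell_def
    by (subst emeasure_lborel_Ioc) (auto simp: divide_right_mono diff_divide_distrib)
  then have "emeasure (scale_measure (ennreal (\<sigma>\<^sup>2)) lborel) (grid_cell K i) = ennreal (\<sigma>\<^sup>2 * (1 / real K))"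
    by (simp add: ennreal_mult[symmetric] grid_cell_def)
  then show ?thesis by (simp add: measure_def)
qed

lemma grid_cell_disjoint:
  assumes "K > 0"
  shows "disjoint_family_on (grid_cell K) I"
proof -
  have "i = j" if "y \<in> grid_cell K i" "y \<in> grid_cell K j" for i j y
  proof -
    have "\<lceil>real K * y\<rceil> = cell_number K i" "\<lceil>real K * y\<rceil> = cell_number K j"
      using that cell_eq[OF assms] unfolding grid_cell_def by blast+
    then show ?thesis by (simp add: cell_number_def)
  qed
  then show ?thesis by (auto simp: disjoint_family_on_def)
qed

lemma steps_gauss [simp]: "steps (gauss_steps K t)"
  by (auto simp: steps_def gauss_steps_def)

lemma step_integral_gauss: "step_integral B (gauss_steps K t) \<omega> = gauss_sum K t \<omega>"
  unfolding step_integral_def gauss_steps_def gauss_sum_def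
  by (simp add: comp_def interv_sum_list_conv_sum_set_nat atLeast0LessThan mult.commute del: upt_Suc)

lemma step_fun_gauss:
  assumes K: "K > 0"
  shows "step_fun (gauss_steps K t) y = truncated_kernel \<alpha> lam K t \<lceil>real K * y\<rceil>"
proof -
  let ?m = "\<lceil>real K * y\<rceil>"
  have "step_fun (gauss_steps K t) y = (\<Sum>i<2*(K*K)+1. lattice_kernel \<alpha> lam K t (cell_number K i) * indicator (grid_cell K i) y)"
    unfolding step_fun_def gauss_steps_def
    by (simp add: comp_def interv_sum_list_conv_sum_set_nat atLeast0LessThan del: upt_Suc)
  also have "\<dots> = (\<Sum>i<2*(K*K)+1. if i = nat (?m + int (K*K)) then truncated_kernel \<alpha> lam K t ?m else 0)"
  proof (intro sum.cong refl)
    fix i assume "i \<in> {..<2*(K*K)+1}"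
    then have i: "i < 2*(K*K)+1" by simp
    have mem: "y \<in> grid_cell K i \<longleftrightarrow> ?m = cell_number K i"
      unfolding grid_cell_def using cell_eq[OF K, of y "cell_number K i"] by simp
    have *: "(l = int i - int q \<longrightarrow> i = nat (l + int q) \<and> \<bar>l\<bar> \<le> int q) \<and>
      (i = nat (l + int q) \<longrightarrow> \<bar>l\<bar> \<le> int q \<longrightarrow> l = int i - int q)" if "i < 2 * q + 1" for q :: nat and l :: int
      using that by auto
    show "lattice_kernel \<alpha> lam K t (cell_number K i) * indicator (grid_cell K i) y
      = (if i = nat (?m + int (K*K)) then truncated_kernel \<alpha> lam K t ?m else 0)"
    proof (cases "?m = cell_number K i")
      case True
      then have "i = nat (?m + int (K*K))" "\<bar>?m\<bar> \<le> int (K*K)"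
        using *[OF i, of ?m] unfolding cell_number_def by blast+
      then show ?thesis using mem True by (simp add: truncated_kernel_def)
    next
      case False
      then have "i = nat (?m + int (K*K)) \<Longrightarrow> \<not> \<bar>?m\<bar> \<le> int (K*K)"
        using *[OF i, of ?m] unfolding cell_number_def by blast
      then show ?thesis using mem False by (auto simp: truncated_kernel_def)
    qed
  qed
  also have "\<dots> = (if nat (?m + int (K*K)) < 2*(K*K)+1 then truncated_kernel \<alpha> lam K t ?m else 0)"
    by (subst sum.delta) auto
  also have "\<dots> = truncated_kernel \<alpha> lam K t ?m"
  proof (cases "\<bar>?m\<bar> \<le> int (K*K)")
    case True
    have "nat (l + int q) < 2*q+1" if "\<bar>l\<bar> \<le> int q" for q :: nat and l :: int using that by linarith
    from this[OF True] show ?thesis by simp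
  qed (simp add: truncated_kernel_def)
  finally show ?thesis .
qed

lemma measurable_gauss_sum [measurable]: "gauss_sum K t \<in> borel_measurable N"
proof -
  have "step_integral B (gauss_steps K t) \<in> borel_measurable N" by (rule measurable_step_integral) simp
  then show ?thesis by (simp add: step_integral_gauss[abs_def])
qed

lemma continuous_gauss_sum: "K > 0 \<Longrightarrow> continuous_on {0..1} (\<lambda>t. gauss_sum K t \<omega>)"
  unfolding gauss_sum_def by (intro continuous_intros continuous_lattice_kernel)

lemma wiener_gauss_sum:
  assumes "K > 0"
  shows "wiener_integral (\<lambda>y. truncated_kernel \<alpha> lam K t \<lceil>real K * y\<rceil>) (gauss_sum K t)"
  using wiener_integral_step[OF steps_gauss[of K t]]
  by (simp add: step_integral_gauss[abs_def] step_fun_gauss[OF assms, abs_def])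

lemma nn_integral_scaled: "f \<in> borel_measurable borel \<Longrightarrow>
    (\<integral>\<^sup>+y. f y \<partial>scale_measure (ennreal (\<sigma>\<^sup>2)) lborel) = ennreal (\<sigma>\<^sup>2) * (\<integral>\<^sup>+y. f y \<partial>lborel)"
  by (rule nn_integral_scale_measure) simp

lemma wiener_integrand_measurable: "wiener_integral f J \<Longrightarrow> f \<in> borel_measurable borel"
proof -
  have "borel_measurable (scale_measure (ennreal (\<sigma>\<^sup>2)) lborel) = (borel_measurable borel :: (real \<Rightarrow> real) set)"
    by (rule measurable_cong_sets) auto
  then show "wiener_integral f J \<Longrightarrow> f \<in> borel_measurable borel" unfolding wiener_integral_def by blast
qed

text \<open>The chaining bound for a process of stochastic integrals. The factor \<open>4\<close> in front of the window
  allows differences of two approximation errors, and \<open>64 = 4 \<sqdot> 4\<^sup>2\<close> also contains the constant of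
  \<open>wiener_integral_bound\<close>.\<close>

lemma expected_supremum_wiener:
  assumes C': "\<And>s t. s \<le> t \<Longrightarrow> (\<integral>\<^sup>+y. (win s t y)\<^sup>2 \<partial>lborel) \<le> ennreal (C' * (t - s) powr (1 + \<theta>))" "C' \<ge> 0"
    and J: "\<And>t. t \<in> {0..1} \<Longrightarrow> wiener_integral (k t) (J t)"
    and cont: "\<And>\<omega>. \<omega> \<in> space N \<Longrightarrow> continuous_on {0..1} (\<lambda>t. J t \<omega>)"
    and k: "\<And>s t y. 0 \<le> s \<Longrightarrow> s \<le> t \<Longrightarrow> t \<le> 1 \<Longrightarrow> ennreal \<bar>k t y - k s y\<bar> \<le> 4 * win s t y"
    and tau: "\<tau> > 0" and eta: "\<eta> \<ge> 0"
    and grid: "\<And>j. j \<le> 2 ^ m \<Longrightarrow> 4 * (ennreal (\<sigma>\<^sup>2) * mean_square lborel (\<lambda>y. k (real j / 2 ^ m) y)) \<le> ennreal \<eta>"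
  shows "(\<integral>\<^sup>+\<omega>. sup01 (\<lambda>t. J t \<omega>) \<partial>N)
    \<le> ennreal (real (2 ^ m + 1) * (\<tau> + \<eta> / \<tau>)) + chaining_tail (64 * \<sigma>\<^sup>2 * C') (1 + \<theta>) m"
proof (rule expected_supremum_le[OF prob_space_axioms])
  show "J t \<in> borel_measurable N" if "t \<in> {0..1}" for t using J[OF that] by (simp add: wiener_integral_def)
  have k_meas: "k t \<in> borel_measurable borel" if "t \<in> {0..1}" for t using J[OF that] by (rule wiener_integrand_measurable)
  fix s t :: real assume st: "0 \<le> s" "s \<le> t" "t \<le> 1"
  have [measurable]: "k t \<in> borel_measurable borel" "k s \<in> borel_measurable borel" using k_meas st by auto
  have "mean_square N (\<lambda>\<omega>. J t \<omega> - J s \<omega>)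
    \<le> 4 * mean_square (scale_measure (ennreal (\<sigma>\<^sup>2)) lborel) (\<lambda>y. k t y - k s y)"
    by (rule wiener_integral_bound, rule wiener_integral_diff; rule J) (use st in auto)
  also have "\<dots> = 4 * (ennreal (\<sigma>\<^sup>2) * mean_square lborel (\<lambda>y. k t y - k s y))"
    by (subst nn_integral_scaled) auto
  also have "\<dots> \<le> 4 * (ennreal (\<sigma>\<^sup>2) * (16 * ennreal (C' * (t - s) powr (1 + \<theta>))))"
  proof (intro mult_left_mono)
    have "mean_square lborel (\<lambda>y. k t y - k s y) \<le> (\<integral>\<^sup>+y. 16 * (win s t y)\<^sup>2 \<partial>lborel)"
    proof (rule nn_integral_mono)
      fix y
      have "ennreal ((k t y - k s y)\<^sup>2) = (ennreal \<bar>k t y - k s y\<bar>)\<^sup>2" by (simp add: ennreal_power)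
      also have "\<dots> \<le> (4 * win s t y)\<^sup>2" by (intro power_mono k st) auto
      finally show "ennreal ((k t y - k s y)\<^sup>2) \<le> 16 * (win s t y)\<^sup>2" by (simp add: power_mult_distrib)
    qed
    also have "\<dots> = 16 * (\<integral>\<^sup>+y. (win s t y)\<^sup>2 \<partial>lborel)" by (simp add: nn_integral_cmult)
    also have "\<dots> \<le> 16 * ennreal (C' * (t - s) powr (1 + \<theta>))"
      by (rule mult_left_mono[OF C'(1)[OF st(2)]]) simp
    finally show "mean_square lborel (\<lambda>y. k t y - k s y) \<le> 16 * ennreal (C' * (t - s) powr (1 + \<theta>))" .
  qed auto
  also have "\<dots> = ennreal (64 * \<sigma>\<^sup>2 * C' * (t - s) powr (1 + \<theta>))"
  proof -
    note numeral_times_ennreal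
    then show ?thesis using C'(2) by (simp add: ennreal_mult[symmetric] mult.assoc mult.left_commute)
  qed
  finally show "mean_square N (\<lambda>\<omega>. J t \<omega> - J s \<omega>) \<le> ennreal (64 * \<sigma>\<^sup>2 * C' * (t - s) powr (1 + \<theta>))" .
next
  fix j :: nat assume j: "j \<le> 2 ^ m"
  have "wiener_integral (k (real j / 2 ^ m)) (J (real j / 2 ^ m))" by (rule J[OF dyadic_in_unit[OF j]])
  then have "mean_square N (\<lambda>\<omega>. J (real j / 2 ^ m) \<omega>)
     \<le> 4 * mean_square (scale_measure (ennreal (\<sigma>\<^sup>2)) lborel) (\<lambda>y. k (real j / 2 ^ m) y)"
    and [measurable]: "k (real j / 2 ^ m) \<in> borel_measurable borel"
    by (auto intro: wiener_integral_bound wiener_integrand_measurable)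
  then show "mean_square N (\<lambda>\<omega>. J (real j / 2 ^ m) \<omega>) \<le> ennreal \<eta>"
    using grid[OF j] by (subst (asm) nn_integral_scaled) auto
next
  show "0 \<le> 64 * \<sigma>\<^sup>2 * C'" using C'(2) by simp
qed (use cont tau eta in auto)

lemma limit_error_eventually_small:
  assumes "\<eta> > 0"
  shows "\<forall>\<^sub>F K in sequentially. \<forall>j\<in>{..2^m}. ennreal (\<sigma>\<^sup>2) * mean_square lborel (\<lambda>y. limit_error K (real j / 2 ^ m) y) < ennreal \<eta>"
proof -
  have "\<forall>\<^sub>F K in sequentially. ennreal (\<sigma>\<^sup>2) * mean_square lborel (\<lambda>y. limit_error K (real j / 2 ^ m) y) < ennreal \<eta>"
    if "j \<in> {..2^m}" for j
  proof -
    have j: "j \<le> 2 ^ m" using that by simp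
    have "(\<lambda>K. ennreal (\<sigma>\<^sup>2) * mean_square lborel (\<lambda>y. limit_error K (real j / 2 ^ m) y)) \<longlonglongrightarrow> ennreal (\<sigma>\<^sup>2) * 0"
      by (rule ennreal_tendsto_cmult[OF _ limit_error_tendsto_0[OF dyadic_in_unit[OF j]]]) simp
    then show ?thesis by (rule order_tendstoD(2)) (use assms in simp)
  qed
  then show ?thesis by (intro eventually_ball_finite) auto
qed

end

context gaussian_limit
begin

lemma wiener_coarse_difference:
  assumes "K > 0" "L > 0"
  shows "wiener_integral (\<lambda>y. limit_error L t y - limit_error K t y) (\<lambda>\<omega>. gauss_sum K t \<omega> - gauss_sum L t \<omega>)"
proof -
  have "(\<lambda>y. truncated_kernel \<alpha> lam K t \<lceil>real K * y\<rceil> - truncated_kernel \<alpha> lam L t \<lceil>real L * y\<rceil>)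
      = (\<lambda>y. limit_error L t y - limit_error K t y)"
    unfolding limit_error_def by auto
  then show ?thesis
    using wiener_integral_diff[OF wiener_gauss_sum[OF assms(1), of t] wiener_gauss_sum[OF assms(2), of t]] by simp
qed

lemma limit_error_difference_square:
  assumes "t \<in> {0..1}"
  shows "mean_square lborel (\<lambda>y. limit_error L t y - limit_error K t y)
    \<le> 2 * mean_square lborel (\<lambda>y. limit_error L t y) + 2 * mean_square lborel (\<lambda>y. limit_error K t y)"
proof -
  have [measurable]: "limit_error L t \<in> borel_measurable borel" "limit_error K t \<in> borel_measurable borel"
    using assms by measurable
  have "mean_square lborel (\<lambda>y. limit_error L t y - limit_error K t y)
    \<le> 2 * mean_square lborel (\<lambda>y. limit_error L t y) + 2 * mean_square lborel (\<lambda>y. - limit_error K t y)"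
    by (rule nn_integral_square_sum) auto
  then show ?thesis by simp
qed

lemma gauss_sum_uniformly_cauchy:
  assumes "e > 0"
  shows "\<exists>n0>0. \<forall>K\<ge>n0. \<forall>L\<ge>n0. (\<integral>\<^sup>+\<omega>. sup01 (\<lambda>t. gauss_sum K t \<omega> - gauss_sum L t \<omega>) \<partial>N) \<le> ennreal e"
proof -
  obtain C' where C': "C' \<ge> 0" "\<And>s t. s \<le> t \<Longrightarrow> (\<integral>\<^sup>+y. (win s t y)\<^sup>2 \<partial>lborel) \<le> ennreal (C' * (t - s) powr (1 + \<theta>))"
    using window_square_integral[OF theta kappa C] by blast
  have c: "0 \<le> 64 * \<sigma>\<^sup>2 * C'" "1 < 1 + \<theta>" using C'(1) theta by auto
  obtain m :: nat and \<tau> \<eta> :: real where p: "\<tau> > 0" "\<eta> > 0"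
    "ennreal (real (2 ^ m + 1) * (\<tau> + \<eta> / \<tau>)) + chaining_tail (64 * \<sigma>\<^sup>2 * C') (1 + \<theta>) m \<le> ennreal e"
    by (rule chaining_parameters[OF c assms])
  obtain n0 where n0: "\<And>K j. K \<ge> n0 \<Longrightarrow> j \<le> 2 ^ m \<Longrightarrow>
      ennreal (\<sigma>\<^sup>2) * mean_square lborel (\<lambda>y. limit_error K (real j / 2 ^ m) y) < ennreal (\<eta> / 16)"
    using limit_error_eventually_small[of "\<eta> / 16" m] p(2) unfolding eventually_sequentially by auto
  show ?thesis
  proof (intro exI[of _ "Suc n0"] conjI allI impI)
    fix K L assume KL: "Suc n0 \<le> K" "Suc n0 \<le> L"
    then have pos: "K > 0" "L > 0" by auto
    have "(\<integral>\<^sup>+\<omega>. sup01 (\<lambda>t. gauss_sum K t \<omega> - gauss_sum L t \<omega>) \<partial>N)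
      \<le> ennreal (real (2 ^ m + 1) * (\<tau> + \<eta> / \<tau>)) + chaining_tail (64 * \<sigma>\<^sup>2 * C') (1 + \<theta>) m"
    proof (rule expected_supremum_wiener[OF C'(2,1) wiener_coarse_difference[OF pos]])
      show "continuous_on {0..1} (\<lambda>t. gauss_sum K t \<omega> - gauss_sum L t \<omega>)" for \<omega>
        by (intro continuous_on_diff continuous_gauss_sum pos)
      fix s t y :: real assume st: "0 \<le> s" "s \<le> t" "t \<le> 1"
      have "ennreal \<bar>(limit_error L t y - limit_error L s y) - (limit_error K t y - limit_error K s y)\<bar> \<le> 2 * (2 * win s t y)"
        by (rule ennreal_abs_diff_le_double; rule limit_error_increment_le) (use pos st in auto)
      moreover have "(limit_error L t y - limit_error L s y) - (limit_error K t y - limit_error K s y)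
         = (limit_error L t y - limit_error K t y) - (limit_error L s y - limit_error K s y)" by linarith
      ultimately show "ennreal \<bar>(limit_error L t y - limit_error K t y) - (limit_error L s y - limit_error K s y)\<bar> \<le> 4 * win s t y"
        by (simp add: mult.assoc[symmetric])
    next
      fix j :: nat assume j: "j \<le> 2 ^ m"
      define a where "a K = mean_square lborel (\<lambda>y. limit_error K (real j / 2 ^ m) y)" for K
      have "4 * (ennreal (\<sigma>\<^sup>2) * mean_square lborel (\<lambda>y. limit_error L (real j / 2 ^ m) y - limit_error K (real j / 2 ^ m) y))
         \<le> 4 * (ennreal (\<sigma>\<^sup>2) * (2 * a L + 2 * a K))"
        unfolding a_def by (intro mult_left_mono limit_error_difference_square dyadic_in_unit j) auto
      also have "\<dots> = 8 * (ennreal (\<sigma>\<^sup>2) * a L) + 8 * (ennreal (\<sigma>\<^sup>2) * a K)"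
        by (rule four_times_double_sum)
      also have "\<dots> \<le> 8 * ennreal (\<eta> / 16) + 8 * ennreal (\<eta> / 16)"
        unfolding a_def using KL by (intro add_mono mult_left_mono less_imp_le[OF n0[OF _ j]]) auto
      also have "\<dots> = ennreal \<eta>"
      proof -
        note numeral_times_ennreal
        then have "8 * ennreal (\<eta> / 16) = ennreal (\<eta> / 2)" using p(2) by simp
        then show ?thesis using p(2) by (simp add: ennreal_plus[symmetric] del: ennreal_plus)
      qed
      finally show "4 * (ennreal (\<sigma>\<^sup>2) * mean_square lborel (\<lambda>y. limit_error L (real j / 2 ^ m) y - limit_error K (real j / 2 ^ m) y)) \<le> ennreal \<eta>" .
    qed (use p in auto)
    also note p(3)
    finally show "(\<integral>\<^sup>+\<omega>. sup01 (\<lambda>t. gauss_sum K t \<omega> - gauss_sum L t \<omega>) \<partial>N) \<le> ennreal e" .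
  qed simp
qed

text \<open>Along a subsequence the expected supremum distances of consecutive coarse processes are
  summable, so the processes converge uniformly outside a null set, on which the limit is set to
  zero. Fatou's lemma identifies the limit as a stochastic integral of the limit kernel.\<close>

theorem continuous_limit_exists:
  "\<exists>J. (\<forall>t\<in>{0..1}. wiener_integral (limit_kernel t) (J t)) \<and> (\<forall>\<omega>. continuous_on {0..1} (\<lambda>t. J t \<omega>))"
proof -
  have "\<forall>j. \<exists>n0>0. \<forall>K\<ge>n0. \<forall>L\<ge>n0. (\<integral>\<^sup>+\<omega>. sup01 (\<lambda>t. gauss_sum K t \<omega> - gauss_sum L t \<omega>) \<partial>N) \<le> ennreal ((1/2) ^ j)"
    by (rule allI, rule gauss_sum_uniformly_cauchy) simp
  from choice[OF this] obtain n0 where n0': "\<forall>j. n0 j > 0 \<and> (\<forall>K\<ge>n0 j. \<forall>L\<ge>n0 j.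
    (\<integral>\<^sup>+\<omega>. sup01 (\<lambda>t. gauss_sum K t \<omega> - gauss_sum L t \<omega>) \<partial>N) \<le> ennreal ((1/2) ^ j))" ..
  have n0: "n0 j > 0" "\<lbrakk>K \<ge> n0 j; L \<ge> n0 j\<rbrakk> \<Longrightarrow>
    (\<integral>\<^sup>+\<omega>. sup01 (\<lambda>t. gauss_sum K t \<omega> - gauss_sum L t \<omega>) \<partial>N) \<le> ennreal ((1/2) ^ j)" for j K L
    using n0' by blast+
  \<comment> \<open>summing makes the indices increase, so that both \<open>k j\<close> and \<open>k (Suc j)\<close> exceed \<open>n0 j\<close>\<close>
  define k where "k j = (\<Sum>i\<le>j. n0 i) + j" for j :: nat
  have k_ge: "k j \<ge> n0 j" for j
    unfolding k_def by (rule trans_le_add1, rule member_le_sum) auto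
  have k_Suc: "k (Suc j) \<ge> n0 j" for j using k_ge[of j] by (simp add: k_def)
  have k_pos: "k j > 0" for j using k_ge[of j] n0(1)[of j] by linarith
  have k_lim: "filterlim k at_top sequentially"
    by (rule filterlim_at_top_mono[OF filterlim_ident]) (simp add: k_def)
  define d where "d j t \<omega> = gauss_sum (k (Suc j)) t \<omega> - gauss_sum (k j) t \<omega>" for j t \<omega>
  define D where "D j \<omega> = sup01 (\<lambda>t. d j t \<omega>)" for j \<omega>
  have d_cont: "continuous_on {0..1} (\<lambda>t. d j t \<omega>)" for j \<omega>
    unfolding d_def by (intro continuous_on_diff continuous_gauss_sum k_pos)
  have [measurable]: "d j t \<in> borel_measurable N" for j t unfolding d_def[abs_def] by measurable
  have D_meas [measurable]: "D j \<in> borel_measurable N" for j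
    unfolding D_def[abs_def] by (rule measurable_path_supremum) (auto intro: d_cont)
  have D_le: "(\<integral>\<^sup>+\<omega>. D j \<omega> \<partial>N) \<le> ennreal ((1/2) ^ j)" for j
    unfolding D_def d_def by (rule n0(2)[OF k_Suc k_ge])
  define good where "good \<omega> \<longleftrightarrow> (\<Sum>j. D j \<omega>) < \<infinity>" for \<omega>
  \<comment> \<open>the expected total of the suprema is finite\<close>
  have AE_good: "AE \<omega> in N. good \<omega>"
  proof -
    have "(\<integral>\<^sup>+\<omega>. (\<Sum>j. D j \<omega>) \<partial>N) = (\<Sum>j. \<integral>\<^sup>+\<omega>. D j \<omega> \<partial>N)" by (rule nn_integral_suminf) measurable
    also have "\<dots> \<le> (\<Sum>j. ennreal ((1/2) ^ j))" by (intro suminf_le D_le) auto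
    also have "\<dots> = ennreal (\<Sum>j. (1/2) ^ j)" by (rule suminf_ennreal2) (auto intro: summable_geometric)
    finally have "(\<integral>\<^sup>+\<omega>. (\<Sum>j. D j \<omega>) \<partial>N) \<noteq> \<infinity>" by (auto simp: top_unique)
    then have "AE \<omega> in N. (\<Sum>j. D j \<omega>) \<noteq> \<infinity>" by (intro nn_integral_PInf_AE) auto
    then show ?thesis by eventually_elim (simp add: good_def less_top)
  qed
  have good_bound: "norm (d j t \<omega>) \<le> enn2real (D j \<omega>)" "summable (\<lambda>j. enn2real (D j \<omega>))"
    if g: "good \<omega>" and t: "t \<in> {0..1}" for j t \<omega>
  proof -
    have fin: "D j \<omega> < \<infinity>" for j
      using g ennreal_suminf_lessD[of "\<lambda>j. D j \<omega>" "\<infinity>" j] unfolding good_def by simp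
    have "ennreal \<bar>d j t \<omega>\<bar> \<le> D j \<omega>" unfolding D_def using t by (rule SUP_upper)
    then have "enn2real (ennreal \<bar>d j t \<omega>\<bar>) \<le> enn2real (D j \<omega>)" using fin[of j] by (intro enn2real_mono) auto
    then show "norm (d j t \<omega>) \<le> enn2real (D j \<omega>)" by simp
    have "(\<Sum>j. ennreal (enn2real (D j \<omega>))) \<noteq> top"
      using g fin unfolding good_def by (simp add: less_top)
    then show "summable (\<lambda>j. enn2real (D j \<omega>))" by (intro summable_suminf_not_top) auto
  qed
  define J where "J t \<omega> = (if good \<omega> then gauss_sum (k 0) t \<omega> + (\<Sum>j. d j t \<omega>) else 0)" for t \<omega>
  have [measurable]: "Measurable.pred N good" unfolding good_def[abs_def] by measurable
  have J_meas [measurable]: "J t \<in> borel_measurable N" for t unfolding J_def[abs_def] by measurable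
  have J_lim: "(\<lambda>m. gauss_sum (k m) t \<omega>) \<longlonglongrightarrow> J t \<omega>" if g: "good \<omega>" and t: "t \<in> {0..1}" for t \<omega>
  proof -
    have "summable (\<lambda>j. d j t \<omega>)"
      by (rule summable_comparison_test'[OF good_bound(2)[OF g t], of 0]) (rule good_bound(1)[OF g t])
    then have "(\<lambda>m. gauss_sum (k 0) t \<omega> + (\<Sum>j<m. d j t \<omega>)) \<longlonglongrightarrow> gauss_sum (k 0) t \<omega> + (\<Sum>j. d j t \<omega>)"
      by (intro tendsto_add tendsto_const summable_LIMSEQ)
    moreover have "gauss_sum (k 0) t \<omega> + (\<Sum>j<m. d j t \<omega>) = gauss_sum (k m) t \<omega>" for m
      unfolding d_def using sum_lessThan_telescope[of "\<lambda>j. gauss_sum (k j) t \<omega>" m] by simp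
    ultimately show ?thesis using g by (simp add: J_def)
  qed
  show ?thesis
  proof (intro exI[of _ J] conjI ballI allI)
    show "continuous_on {0..1} (\<lambda>t. J t \<omega>)" for \<omega>
    proof (cases "good \<omega>")
      case True
      have "uniform_limit {0..1} (\<lambda>m t. \<Sum>j<m. d j t \<omega>) (\<lambda>t. \<Sum>j. d j t \<omega>) sequentially"
        by (rule Weierstrass_m_test[where M = "\<lambda>j. enn2real (D j \<omega>)"])
           (use good_bound(1)[OF True] good_bound(2)[OF True, of 0] in auto)
      then have "continuous_on {0..1} (\<lambda>t. \<Sum>j. d j t \<omega>)"
        by (rule uniform_limit_theorem[rotated]) (auto intro!: always_eventually continuous_on_sum d_cont)
      then have "continuous_on {0..1} (\<lambda>t. gauss_sum (k 0) t \<omega> + (\<Sum>j. d j t \<omega>))"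
        by (intro continuous_on_add continuous_gauss_sum k_pos)
      then show ?thesis using True by (simp add: J_def)
    qed (simp add: J_def)
    fix t :: real assume t: "t \<in> {0..1}"
    let ?mu = "scale_measure (ennreal (\<sigma>\<^sup>2)) lborel"
    define a where "a K = ennreal (\<sigma>\<^sup>2) * mean_square lborel (\<lambda>y. limit_error K t y)" for K
    have "a \<longlonglongrightarrow> ennreal (\<sigma>\<^sup>2) * 0"
      unfolding a_def by (rule ennreal_tendsto_cmult[OF _ limit_error_tendsto_0[OF t]]) simp
    then have a_lim: "a \<longlonglongrightarrow> 0" by simp
    have a_k: "(\<lambda>m. a (k m)) \<longlonglongrightarrow> 0" by (rule filterlim_compose[OF a_lim k_lim])
    have [measurable]: "limit_error K t \<in> borel_measurable borel" for K using t by measurable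
    have lim_meas: "limit_kernel t \<in> borel_measurable borel" by (rule measurable_limit_kernel[OF t])
    have step_err: "mean_square ?mu (\<lambda>y. step_fun (gauss_steps (k m) t) y - limit_kernel t y) = a (k m)" for m
    proof -
      have "mean_square ?mu (\<lambda>y. step_fun (gauss_steps (k m) t) y - limit_kernel t y)
        = mean_square ?mu (\<lambda>y. limit_error (k m) t y)"
        unfolding step_fun_gauss[OF k_pos] limit_error_def by (subst power2_commute) (rule refl)
      also have "\<dots> = a (k m)" unfolding a_def by (rule nn_integral_scaled) measurable
      finally show ?thesis .
    qed
    have gauss_err: "mean_square N (\<lambda>\<omega>. step_integral B (gauss_steps (k m) t) \<omega> - J t \<omega>) \<le> 8 * a (k m)" for m
    proof -
      have "AE \<omega> in N. ennreal ((gauss_sum (k m) t \<omega> - J t \<omega>)\<^sup>2)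
          = liminf (\<lambda>l. ennreal ((gauss_sum (k m) t \<omega> - gauss_sum (k l) t \<omega>)\<^sup>2))"
        using AE_good
      proof eventually_elim
        case (elim \<omega>)
        have "(\<lambda>l. ennreal ((gauss_sum (k m) t \<omega> - gauss_sum (k l) t \<omega>)\<^sup>2)) \<longlonglongrightarrow> ennreal ((gauss_sum (k m) t \<omega> - J t \<omega>)\<^sup>2)"
          by (intro tendsto_ennrealI tendsto_power tendsto_diff tendsto_const J_lim elim t)
        then show ?case by (intro lim_imp_Liminf[symmetric]) auto
      qed
      then have "mean_square N (\<lambda>\<omega>. gauss_sum (k m) t \<omega> - J t \<omega>)
          = (\<integral>\<^sup>+\<omega>. liminf (\<lambda>l. ennreal ((gauss_sum (k m) t \<omega> - gauss_sum (k l) t \<omega>)\<^sup>2)) \<partial>N)"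
        by (rule nn_integral_cong_AE)
      also have "\<dots> \<le> liminf (\<lambda>l. \<integral>\<^sup>+\<omega>. ennreal ((gauss_sum (k m) t \<omega> - gauss_sum (k l) t \<omega>)\<^sup>2) \<partial>N)"
        by (rule nn_integral_liminf) measurable
      also have "\<dots> \<le> liminf (\<lambda>l. 8 * a (k l) + 8 * a (k m))"
      proof (rule Liminf_mono, rule always_eventually, rule allI)
        fix l
        have "mean_square N (\<lambda>\<omega>. gauss_sum (k m) t \<omega> - gauss_sum (k l) t \<omega>)
          \<le> 4 * mean_square ?mu (\<lambda>y. limit_error (k l) t y - limit_error (k m) t y)"
          by (rule wiener_integral_bound[OF wiener_coarse_difference[OF k_pos k_pos]])
        also have "\<dots> = 4 * (ennreal (\<sigma>\<^sup>2) * mean_square lborel (\<lambda>y. limit_error (k l) t y - limit_error (k m) t y))"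
          by (subst nn_integral_scaled) auto
        also have "\<dots> \<le> 4 * (ennreal (\<sigma>\<^sup>2) * (2 * mean_square lborel (\<lambda>y. limit_error (k l) t y) + 2 * mean_square lborel (\<lambda>y. limit_error (k m) t y)))"
          by (intro mult_left_mono limit_error_difference_square t) auto
        also have "\<dots> = 8 * a (k l) + 8 * a (k m)"
          unfolding a_def
          by (rule four_times_double_sum)
        finally show "mean_square N (\<lambda>\<omega>. gauss_sum (k m) t \<omega> - gauss_sum (k l) t \<omega>) \<le> 8 * a (k l) + 8 * a (k m)" .
      qed
      also have "\<dots> = 8 * 0 + 8 * a (k m)"
        by (rule lim_imp_Liminf, simp, intro tendsto_add tendsto_const ennreal_tendsto_cmult a_k) simp
      finally show ?thesis by (simp add: step_integral_gauss)
    qed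
    show "wiener_integral (limit_kernel t) (J t)"
      unfolding wiener_integral_def
    proof (intro conjI exI[of _ "\<lambda>m. gauss_steps (k m) t"] allI)
      show "limit_kernel t \<in> borel_measurable ?mu"
        using lim_meas by (rule measurable_cong_sets[THEN equalityD2, THEN subsetD, rotated 2]) auto
      show "(\<lambda>m. mean_square ?mu (\<lambda>y. step_fun (gauss_steps (k m) t) y - limit_kernel t y)) \<longlonglongrightarrow> 0"
        unfolding step_err by (rule a_k)
      show "(\<lambda>m. mean_square N (\<lambda>\<omega>. step_integral B (gauss_steps (k m) t) \<omega> - J t \<omega>)) \<longlonglongrightarrow> 0"
      proof (rule tendsto_sandwich[OF _ _ tendsto_const])
        have "(\<lambda>m. 8 * a (k m)) \<longlonglongrightarrow> 8 * 0" by (rule ennreal_tendsto_cmult[OF _ a_k]) simp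
        then show "(\<lambda>m. 8 * a (k m)) \<longlonglongrightarrow> 0" by simp
      qed (use gauss_err in auto)
    qed auto
  qed
qed

end

section \<open>The scaling limit\<close>

locale scaling_limit = artfima_limit M Z \<sigma> \<alpha> lam C \<theta> \<kappa> + G: gaussian_limit N B \<sigma> \<alpha> lam C \<theta> \<kappa>
  for M :: "'a measure" and Z :: "int \<Rightarrow> 'a \<Rightarrow> real" and N :: "'b measure" and B :: "real set \<Rightarrow> 'b \<Rightarrow> real"
    and \<sigma> \<alpha> lam C \<theta> \<kappa> :: real
begin

text \<open>For fixed \<open>K\<close> both processes are the same linear image of finitely many real variables.\<close>

lemma coarse_weak_limit:
  fixes F :: "(real \<Rightarrow>\<^sub>C real) \<Rightarrow> real"
  assumes K: "K > 0" and F: "continuous_on UNIV F" "\<And>x. \<bar>F x\<bar> \<le> c"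
  shows "(\<lambda>n. \<integral>\<omega>. F (extend01 (\<lambda>t. coarse_sum n K t \<omega>)) \<partial>M) \<longlonglongrightarrow> (\<integral>\<omega>. F (extend01 (\<lambda>t. G.gauss_sum K t \<omega>)) \<partial>N)"
proof -
  let ?I = "{..<2*(K*K)+1}"
  let ?v = "\<lambda>i. extend01 (\<lambda>t. lattice_kernel \<alpha> lam K t (cell_number K i))"
  have X: "extend01 (\<lambda>t. coarse_sum n K t \<omega>) = (\<Sum>i\<in>?I. ((\<Sum>j\<in>block n K (cell_number K i). Z j \<omega>) / sqrt (real n)) *\<^sub>R ?v i)" for n \<omega>
    unfolding coarse_sum_def block_noise_def by (rule extend01_combination) (rule continuous_lattice_kernel[OF K])
  have Y: "extend01 (\<lambda>t. G.gauss_sum K t \<omega>) = (\<Sum>i\<in>?I. B (G.grid_cell K i) \<omega> *\<^sub>R ?v i)" for \<omega>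
    unfolding G.gauss_sum_def by (rule extend01_combination) (rule continuous_lattice_kernel[OF K])
  show ?thesis
    unfolding X Y
  proof (rule joint_block_clt[where w = "\<lambda>_. 1 / real K", OF _ _ _ _ _ G.prob_space_axioms _ _ F])
    show "disjoint_family_on (\<lambda>i. block n K (cell_number K i)) ?I" for n by (rule block_disjoint[OF K])
    show "(\<lambda>n. real (card (block n K (cell_number K i))) / real n) \<longlonglongrightarrow> 1 / real K" for i by (rule card_block_tendsto[OF K])
    show "G.indep_vars (\<lambda>_. borel) (\<lambda>i. B (G.grid_cell K i)) ?I"
      using G.noise G.grid_cell_disjoint[OF K] G.grid_cell_finite
      unfolding gaussian_random_measure_def by blast
    show "centred_gaussian N (B (G.grid_cell K i)) (\<sigma>\<^sup>2 * (1 / real K))" for i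
    proof -
      have "centred_gaussian N (B (G.grid_cell K i)) (measure (scale_measure (ennreal (\<sigma>\<^sup>2)) lborel) (G.grid_cell K i))"
        using G.noise G.grid_cell_finite unfolding gaussian_random_measure_def by blast
      then show ?thesis unfolding G.measure_grid_cell[OF K] .
    qed
  qed (use K in auto)
qed

lemma measurable_extend01_coarse: "K > 0 \<Longrightarrow> (\<lambda>\<omega>. extend01 (\<lambda>t. coarse_sum n K t \<omega>)) \<in> borel_measurable M"
  by (rule measurable_extend01) (auto intro: continuous_coarse_sum)

lemma measurable_extend01_scaled: "(\<lambda>\<omega>. extend01 (\<lambda>t. scaled_sum n t \<omega>)) \<in> borel_measurable M"
  by (rule measurable_extend01) (auto intro: continuous_scaled_sum)

lemma measurable_extend01_gauss: "K > 0 \<Longrightarrow> (\<lambda>\<omega>. extend01 (\<lambda>t. G.gauss_sum K t \<omega>)) \<in> borel_measurable N"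
  by (rule measurable_extend01) (auto intro: G.continuous_gauss_sum)

text \<open>The grids that make the chaining bounds small are chosen first, one for each side; then \<open>K\<close> is
  taken so large that the approximation error is small at all points of both grids.\<close>

theorem scaled_sum_converges:
  assumes J: "\<And>t. t \<in> {0..1} \<Longrightarrow> G.wiener_integral (limit_kernel t) (J t)"
    and cont: "\<And>\<omega>. \<omega> \<in> space N \<Longrightarrow> continuous_on {0..1} (\<lambda>t. J t \<omega>)"
  shows "converges_weakly C01 M (\<lambda>n. path01 (scaled_sum n)) N (path01 J)"
proof (rule converges_weakly_C01I)
  have J_meas: "J t \<in> borel_measurable N" if "t \<in> {0..1}" for t
    using J[OF that] by (simp add: G.wiener_integral_def)
  show Jm: "(\<lambda>\<omega>. extend01 (\<lambda>t. J t \<omega>)) \<in> borel_measurable N"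
    by (rule measurable_extend01[OF J_meas cont])
  fix F :: "(real \<Rightarrow>\<^sub>C real) \<Rightarrow> real" and c
  assume F: "continuous_on UNIV F" "\<And>x. \<bar>F x\<bar> \<le> c"
  show "(\<lambda>n. \<integral>\<omega>. F (extend01 (\<lambda>t. scaled_sum n t \<omega>)) \<partial>M) \<longlonglongrightarrow> (\<integral>\<omega>. F (extend01 (\<lambda>t. J t \<omega>)) \<partial>N)"
  proof (rule weak_limit_by_approximation[where XK = "\<lambda>K n \<omega>. extend01 (\<lambda>t. coarse_sum n (Suc K) t \<omega>)"
        and YK = "\<lambda>K \<omega>. extend01 (\<lambda>t. G.gauss_sum (Suc K) t \<omega>)", OF prob_space_axioms G.prob_space_axioms
        measurable_extend01_scaled Jm _ _ _ _ F])
    fix e :: real assume e: "e > 0"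
    obtain C' where C': "C' \<ge> 0" "\<And>s t. s \<le> t \<Longrightarrow> (\<integral>\<^sup>+y. (win s t y)\<^sup>2 \<partial>lborel) \<le> ennreal (C' * (t - s) powr (1 + \<theta>))"
      using window_square_integral[OF theta kappa C] by blast
    have c: "0 \<le> 4 * \<sigma>\<^sup>2 * C'" "0 \<le> 64 * \<sigma>\<^sup>2 * C'" "1 < 1 + \<theta>" using C'(1) theta by auto
    obtain m1 :: nat and \<tau>1 \<eta>1 :: real where p1: "\<tau>1 > 0" "\<eta>1 > 0"
      "ennreal (real (2 ^ m1 + 1) * (\<tau>1 + \<eta>1 / \<tau>1)) + chaining_tail (4 * \<sigma>\<^sup>2 * C') (1 + \<theta>) m1 \<le> ennreal e"
      by (rule chaining_parameters[OF c(1,3) e])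
    obtain m2 :: nat and \<tau>2 \<eta>2 :: real where p2: "\<tau>2 > 0" "\<eta>2 > 0"
      "ennreal (real (2 ^ m2 + 1) * (\<tau>2 + \<eta>2 / \<tau>2)) + chaining_tail (64 * \<sigma>\<^sup>2 * C') (1 + \<theta>) m2 \<le> ennreal e"
      by (rule chaining_parameters[OF c(2,3) e])
    have "\<eta>2 / 4 > 0" using p2(2) by simp
    from eventually_conj[OF G.limit_error_eventually_small[OF p1(2), of m1] G.limit_error_eventually_small[OF this, of m2]]
    obtain K where K:
      "\<And>j. j \<le> 2 ^ m1 \<Longrightarrow> ennreal (\<sigma>\<^sup>2) * mean_square lborel (\<lambda>y. limit_error (Suc K) (real j / 2 ^ m1) y) < ennreal \<eta>1"
      "\<And>j. j \<le> 2 ^ m2 \<Longrightarrow> ennreal (\<sigma>\<^sup>2) * mean_square lborel (\<lambda>y. limit_error (Suc K) (real j / 2 ^ m2) y) < ennreal (\<eta>2 / 4)"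
      unfolding eventually_sequentially by (meson atMost_iff le_SucI order_refl)
    have "\<forall>\<^sub>F n in sequentially. (\<integral>\<^sup>+\<omega>. sup01 (\<lambda>t. scaled_sum n t \<omega> - coarse_sum n (Suc K) t \<omega>) \<partial>M)
      \<le> ennreal (real (2 ^ m1 + 1) * (\<tau>1 + \<eta>1 / \<tau>1)) + chaining_tail (4 * \<sigma>\<^sup>2 * C') (1 + \<theta>) m1"
      by (rule discrete_approximation[OF C'(2,1) zero_less_Suc p1(1,2) K(1)])
    then have "\<forall>\<^sub>F n in sequentially. (\<integral>\<^sup>+\<omega>. ennreal (dist (extend01 (\<lambda>t. scaled_sum n t \<omega>)) (extend01 (\<lambda>t. coarse_sum n (Suc K) t \<omega>))) \<partial>M) \<le> ennreal e"
    proof eventually_elim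
      case (elim n)
      have "(\<integral>\<^sup>+\<omega>. ennreal (dist (extend01 (\<lambda>t. scaled_sum n t \<omega>)) (extend01 (\<lambda>t. coarse_sum n (Suc K) t \<omega>))) \<partial>M)
        \<le> (\<integral>\<^sup>+\<omega>. sup01 (\<lambda>t. scaled_sum n t \<omega> - coarse_sum n (Suc K) t \<omega>) \<partial>M)"
        by (intro nn_integral_mono dist_extend01 continuous_scaled_sum continuous_coarse_sum) simp
      also note elim
      also note p1(3)
      finally show ?case .
    qed
    moreover have "(\<integral>\<^sup>+\<omega>. ennreal (dist (extend01 (\<lambda>t. J t \<omega>)) (extend01 (\<lambda>t. G.gauss_sum (Suc K) t \<omega>))) \<partial>N) \<le> ennreal e"
    proof -
      have "(\<integral>\<^sup>+\<omega>. ennreal (dist (extend01 (\<lambda>t. J t \<omega>)) (extend01 (\<lambda>t. G.gauss_sum (Suc K) t \<omega>))) \<partial>N)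
        \<le> (\<integral>\<^sup>+\<omega>. sup01 (\<lambda>t. J t \<omega> - G.gauss_sum (Suc K) t \<omega>) \<partial>N)"
        by (intro nn_integral_mono dist_extend01 cont G.continuous_gauss_sum) simp_all
      also have "\<dots> \<le> ennreal (real (2 ^ m2 + 1) * (\<tau>2 + \<eta>2 / \<tau>2)) + chaining_tail (64 * \<sigma>\<^sup>2 * C') (1 + \<theta>) m2"
      proof (rule G.expected_supremum_wiener[OF C'(2,1), where k = "limit_error (Suc K)"])
        show "G.wiener_integral (limit_error (Suc K) t) (\<lambda>\<omega>. J t \<omega> - G.gauss_sum (Suc K) t \<omega>)" if "t \<in> {0..1}" for t
          unfolding limit_error_def[abs_def]
          by (rule G.wiener_integral_diff[OF J[OF that] G.wiener_gauss_sum]) simp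
        show "continuous_on {0..1} (\<lambda>t. J t \<omega> - G.gauss_sum (Suc K) t \<omega>)" if "\<omega> \<in> space N" for \<omega>
          by (intro continuous_on_diff cont that G.continuous_gauss_sum) simp
        fix s t y :: real assume st: "0 \<le> s" "s \<le> t" "t \<le> 1"
        have "ennreal \<bar>limit_error (Suc K) t y - limit_error (Suc K) s y\<bar> \<le> 2 * win s t y"
          by (rule limit_error_increment_le[OF zero_less_Suc st])
        also have "\<dots> \<le> 4 * win s t y" by (rule mult_right_mono) auto
        finally show "ennreal \<bar>limit_error (Suc K) t y - limit_error (Suc K) s y\<bar> \<le> 4 * win s t y" .
      next
        fix j :: nat assume j: "j \<le> 2 ^ m2"
        have "4 * (ennreal (\<sigma>\<^sup>2) * mean_square lborel (\<lambda>y. limit_error (Suc K) (real j / 2 ^ m2) y)) \<le> 4 * ennreal (\<eta>2 / 4)"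
          by (rule mult_left_mono[OF less_imp_le[OF K(2)[OF j]]]) simp
        also have "\<dots> = ennreal \<eta>2"
        proof -
          note numeral_times_ennreal
          then show ?thesis using p2(2) by simp
        qed
        finally show "4 * (ennreal (\<sigma>\<^sup>2) * mean_square lborel (\<lambda>y. limit_error (Suc K) (real j / 2 ^ m2) y)) \<le> ennreal \<eta>2" .
      qed (use p2 in auto)
      also note p2(3)
      finally show ?thesis .
    qed
    ultimately show "\<exists>K. (\<forall>\<^sub>F n in sequentially. (\<integral>\<^sup>+\<omega>. ennreal (dist (extend01 (\<lambda>t. scaled_sum n t \<omega>)) (extend01 (\<lambda>t. coarse_sum n (Suc K) t \<omega>))) \<partial>M) \<le> ennreal e)
      \<and> (\<integral>\<^sup>+\<omega>. ennreal (dist (extend01 (\<lambda>t. J t \<omega>)) (extend01 (\<lambda>t. G.gauss_sum (Suc K) t \<omega>))) \<partial>N) \<le> ennreal e"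
      by blast
  qed (auto intro: measurable_extend01_coarse measurable_extend01_gauss coarse_weak_limit)
qed (auto intro: measurable_extend01_scaled continuous_scaled_sum cont)

end

theorem theorem5p4:
  fixes \<alpha> lam H \<sigma> :: real
    and M :: "'a measure" and Z :: "int \<Rightarrow> 'a \<Rightarrow> real"
    and N :: "'b measure" and B :: "real set \<Rightarrow> 'b \<Rightarrow> real"
  assumes "\<alpha> > 0" and "lam > 0" and "H = 1/2 + \<alpha>"
    and "prob_space M"
    and "prob_space.indep_vars M (\<lambda>_. borel) Z UNIV"
    and "\<And>j. distr M borel (Z j) = distr M borel (Z 0)"
    and "integrable M (\<lambda>\<omega>. (Z 0 \<omega>)\<^sup>2)"
    and "prob_space.expectation M (Z 0) = 0"
    and "prob_space.variance M (Z 0) = \<sigma>\<^sup>2"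
    and "gaussian_random_measure N (scale_measure (ennreal (\<sigma>\<^sup>2)) lborel) B"
  shows "(\<exists>W. tempered_Hermite1 N \<sigma> B H lam W) \<and>
    (\<forall>W. tempered_Hermite1 N \<sigma> B H lam W \<longrightarrow>
      converges_weakly C01
        M (\<lambda>n. path01 (\<lambda>t \<omega>.
             real n powr (- H) * artfima_sum \<alpha> (lam / real n) Z (real n * t) \<omega>))
        N (path01 (\<lambda>t \<omega>. W t \<omega> / Gamma \<alpha>)))"
proof -
  obtain C where C: "C > 0" "\<And>n j u. n > 0 \<Longrightarrow> \<bar>of_int j - real n * u\<bar> \<le> 3 \<Longrightarrow> u \<noteq> 0 \<Longrightarrow>
     scaled_coeff \<alpha> lam n j \<le> majorant C (min \<alpha> 1) (lam/2) u"
    using scaled_coeff_le_majorant[OF assms(1,2)] by blast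
  interpret M: prob_space M by fact
  have kernel: "dominated_kernel \<alpha> lam C (min \<alpha> 1) (lam/2)"
    by unfold_locales (use assms(1,2) C in auto)
  interpret S: scaling_limit M Z N B \<sigma> \<alpha> lam C "min \<alpha> 1" "lam/2"
  proof (intro scaling_limit.intro artfima_limit.intro gaussian_limit.intro iid_noise.intro)
    show "iid_noise_axioms M Z \<sigma>"
      by unfold_locales (use assms in auto)
    show "gaussian_noise N (scale_measure (ennreal (\<sigma>\<^sup>2)) lborel) B"
      by unfold_locales (rule assms)
  qed (rule assms kernel)+
  have Gam: "Gamma \<alpha> > 0" using assms(1) by (rule Gamma_real_pos)
  have "\<exists>W. tempered_Hermite1 N \<sigma> B H lam W"
  proof -
    obtain J where J: "\<And>t. t \<in> {0..1} \<Longrightarrow> S.G.wiener_integral (S.limit_kernel t) (J t)"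
      "\<And>\<omega>. continuous_on {0..1} (\<lambda>t. J t \<omega>)"
      using S.G.continuous_limit_exists by blast
    have "tempered_Hermite1 N \<sigma> B H lam (\<lambda>t \<omega>. Gamma \<alpha> * J t \<omega>)"
      unfolding tempered_Hermite1_def
    proof (intro conjI ballI)
      fix t :: real assume "t \<in> {0..1}"
      from S.G.has_stoch_integral_wiener[OF S.G.wiener_integral_scale[OF J(1)[OF this], of "Gamma \<alpha>"]]
      show "has_stoch_integral N (scale_measure (ennreal (\<sigma>\<^sup>2)) lborel) B (tempered_kernel H lam t) (\<lambda>\<omega>. Gamma \<alpha> * J t \<omega>)"
        using Gam assms(3) by simp
    qed (intro continuous_on_mult continuous_on_const J(2))
    then show ?thesis by blast
  qed
  moreover have "converges_weakly C01
        M (\<lambda>n. path01 (\<lambda>t \<omega>. real n powr (- H) * artfima_sum \<alpha> (lam / real n) Z (real n * t) \<omega>))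
        N (path01 (\<lambda>t \<omega>. W t \<omega> / Gamma \<alpha>))" if W: "tempered_Hermite1 N \<sigma> B H lam W" for W
  proof -
    have "S.G.wiener_integral (S.limit_kernel t) (\<lambda>\<omega>. W t \<omega> / Gamma \<alpha>)" if "t \<in> {0..1}" for t
      using S.G.wiener_integral_scale[OF S.G.wiener_integral_stoch, of "tempered_kernel H lam t" "W t" "1 / Gamma \<alpha>"]
        W that assms(3) by (simp add: tempered_Hermite1_def)
    moreover have "continuous_on {0..1} (\<lambda>t. W t \<omega> / Gamma \<alpha>)" if "\<omega> \<in> space N" for \<omega>
      using W that Gam unfolding tempered_Hermite1_def by (intro continuous_on_divide continuous_on_const) auto
    ultimately have "converges_weakly C01 M (\<lambda>n. path01 (S.scaled_sum n)) N (path01 (\<lambda>t \<omega>. W t \<omega> / Gamma \<alpha>))"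
      by (rule S.scaled_sum_converges)
    then show ?thesis unfolding S.scaled_sum_def[abs_def] assms(3) .
  qed
  ultimately show ?thesis by blast
qed

end
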